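(* Let $\mathfrak g$ be a semisimple Lie algebra over an algebraically closed field $\Bbbk$ of characteristic $0$, and let $\sigma_1,\sigma_2,\sigma_3$ be involutions of $\mathfrak g$ with $\sigma_1\sigma_2=\sigma_2\sigma_1$, $\sigma_1\neq\sigma_2$ and $\sigma_3=\sigma_1\sigma_2$. For $i,j\in\{0,1\}$ let $\mathfrak g_{ij}=\{x\in\mathfrak g:\sigma_1(x)=(-1)^ix,\ \sigma_2(x)=(-1)^jx\}$. Suppose that $\sigma_1$ is of maximal rank. Then: (1) every Cartan subspace $\mathfrak c_{11}$ of $\mathfrak g_{11}$ is also a Cartan subspace of $\mathfrak g_{01}\oplus\mathfrak g_{11}$ (the $(-1)$-eigenspace of $\sigma_2$); (2) every Cartan subspace $\mathfrak c_{10}$ of $\mathfrak g_{10}$ is also a Cartan subspace of $\mathfrak g_{10}\oplus\mathfrak g_{01}$ (the $(-1)$-eigenspace of $\sigma_3$).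
   Context: Involutions are Lie algebra automorphisms of order $2$ (assumed induced from involutions of a connected semisimple group $G$ with Lie algebra $\mathfrak g$). For an involution $\sigma$ of a reductive Lie algebra $\mathfrak h=\mathfrak h_0\oplus\mathfrak h_1$ ($\mathfrak h_i$ the $(-1)^i$-eigenspace), a Cartan subspace of $\mathfrak h_1$ is a maximal subspace of $\mathfrak h_1$ consisting of pairwise commuting semisimple elements. Here $\mathfrak g_{11}$ is the $(-1)$-eigenspace of the involution induced by $\sigma_2$ on $\mathfrak g^{\sigma_1\sigma_2}=\mathfrak g_{00}\oplus\mathfrak g_{11}$, and $\mathfrak g_{10}$ is the $(-1)$-eigenspace of the involution induced on $\mathfrak g^{\sigma_2}=\mathfrak g_{00}\oplus\mathfrak g_{10}$. An involution $\sigma$ of $\mathfrak g$ is of maximal rank if its $(-1)$-eigenspace contains a Cartan subalgebra of $\mathfrak g$. *)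

theory Defs
  imports Main "HOL-Computational_Algebra.Polynomial"
begin

(* Ambient setting: a Lie algebra g is the whole type 'v, a vector space over
   the field 'k via the scalar multiplication sc, with Lie bracket br. *)

definition alg_closed :: "'k::field itself \<Rightarrow> bool" where
  "alg_closed _ \<longleftrightarrow> (\<forall>p :: 'k poly. 0 < degree p \<longrightarrow> (\<exists>x. poly p x = 0))"

definition lie_algebra :: "('k::field \<Rightarrow> 'v::ab_group_add \<Rightarrow> 'v) \<Rightarrow> ('v \<Rightarrow> 'v \<Rightarrow> 'v) \<Rightarrow> bool" where
  "lie_algebra sc br \<longleftrightarrow>
     vector_space sc \<and>
     (\<forall>x y z. br (x + y) z = br x z + br y z) \<and>
     (\<forall>x y z. br x (y + z) = br x y + br x z) \<and>
     (\<forall>c x y. br (sc c x) y = sc c (br x y)) \<and>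
     (\<forall>c x y. br x (sc c y) = sc c (br x y)) \<and>
     (\<forall>x. br x x = 0) \<and>
     (\<forall>x y z. br x (br y z) + br y (br z x) + br z (br x y) = 0)"

definition fin_dim :: "('k::field \<Rightarrow> 'v::ab_group_add \<Rightarrow> 'v) \<Rightarrow> bool" where
  "fin_dim sc \<longleftrightarrow> (\<exists>B. finite B \<and> module.span sc B = UNIV)"

definition subalgebra :: "('k::field \<Rightarrow> 'v::ab_group_add \<Rightarrow> 'v) \<Rightarrow> ('v \<Rightarrow> 'v \<Rightarrow> 'v) \<Rightarrow> 'v set \<Rightarrow> bool" where
  "subalgebra sc br H \<longleftrightarrow> module.subspace sc H \<and> (\<forall>x\<in>H. \<forall>y\<in>H. br x y \<in> H)"

definition lie_ideal :: "('k::field \<Rightarrow> 'v::ab_group_add \<Rightarrow> 'v) \<Rightarrow> ('v \<Rightarrow> 'v \<Rightarrow> 'v) \<Rightarrow> 'v set \<Rightarrow> bool" where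
  "lie_ideal sc br I \<longleftrightarrow> module.subspace sc I \<and> (\<forall>x. \<forall>y\<in>I. br x y \<in> I)"

fun derived_series :: "('k::field \<Rightarrow> 'v::ab_group_add \<Rightarrow> 'v) \<Rightarrow> ('v \<Rightarrow> 'v \<Rightarrow> 'v) \<Rightarrow> 'v set \<Rightarrow> nat \<Rightarrow> 'v set" where
  "derived_series sc br I 0 = I"
| "derived_series sc br I (Suc n) =
     module.span sc {br x y | x y. x \<in> derived_series sc br I n \<and> y \<in> derived_series sc br I n}"

definition solvable :: "('k::field \<Rightarrow> 'v::ab_group_add \<Rightarrow> 'v) \<Rightarrow> ('v \<Rightarrow> 'v \<Rightarrow> 'v) \<Rightarrow> 'v set \<Rightarrow> bool" where
  "solvable sc br I \<longleftrightarrow> (\<exists>n. derived_series sc br I n = {0})"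

fun lower_central :: "('k::field \<Rightarrow> 'v::ab_group_add \<Rightarrow> 'v) \<Rightarrow> ('v \<Rightarrow> 'v \<Rightarrow> 'v) \<Rightarrow> 'v set \<Rightarrow> nat \<Rightarrow> 'v set" where
  "lower_central sc br H 0 = H"
| "lower_central sc br H (Suc n) =
     module.span sc {br x y | x y. x \<in> H \<and> y \<in> lower_central sc br H n}"

definition nilpotent_alg :: "('k::field \<Rightarrow> 'v::ab_group_add \<Rightarrow> 'v) \<Rightarrow> ('v \<Rightarrow> 'v \<Rightarrow> 'v) \<Rightarrow> 'v set \<Rightarrow> bool" where
  "nilpotent_alg sc br H \<longleftrightarrow> (\<exists>n. lower_central sc br H n = {0})"

definition semisimple_lie :: "('k::field \<Rightarrow> 'v::ab_group_add \<Rightarrow> 'v) \<Rightarrow> ('v \<Rightarrow> 'v \<Rightarrow> 'v) \<Rightarrow> bool" where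
  "semisimple_lie sc br \<longleftrightarrow> lie_algebra sc br \<and> fin_dim sc \<and>
     (\<forall>I. lie_ideal sc br I \<and> solvable sc br I \<longrightarrow> I = {0})"

definition cartan_subalgebra :: "('k::field \<Rightarrow> 'v::ab_group_add \<Rightarrow> 'v) \<Rightarrow> ('v \<Rightarrow> 'v \<Rightarrow> 'v) \<Rightarrow> 'v set \<Rightarrow> bool" where
  "cartan_subalgebra sc br H \<longleftrightarrow> subalgebra sc br H \<and> nilpotent_alg sc br H \<and>
     {x. \<forall>y\<in>H. br x y \<in> H} = H"

(* x is semisimple: ad x is a semisimple (over an algebraically closed field:
   diagonalisable) endomorphism of g, i.e. g is spanned by eigenvectors of ad x *)
definition semisimple_elt :: "('k::field \<Rightarrow> 'v::ab_group_add \<Rightarrow> 'v) \<Rightarrow> ('v \<Rightarrow> 'v \<Rightarrow> 'v) \<Rightarrow> 'v \<Rightarrow> bool" where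
  "semisimple_elt sc br x \<longleftrightarrow> module.span sc {y. \<exists>c. br x y = sc c y} = UNIV"

definition lie_involution :: "('k::field \<Rightarrow> 'v::ab_group_add \<Rightarrow> 'v) \<Rightarrow> ('v \<Rightarrow> 'v \<Rightarrow> 'v) \<Rightarrow> ('v \<Rightarrow> 'v) \<Rightarrow> bool" where
  "lie_involution sc br \<sigma> \<longleftrightarrow> Vector_Spaces.linear sc sc \<sigma> \<and>
     (\<forall>x y. \<sigma> (br x y) = br (\<sigma> x) (\<sigma> y)) \<and> \<sigma> \<circ> \<sigma> = id \<and> \<sigma> \<noteq> id"

definition commuting_ss_subspace :: "('k::field \<Rightarrow> 'v::ab_group_add \<Rightarrow> 'v) \<Rightarrow> ('v \<Rightarrow> 'v \<Rightarrow> 'v) \<Rightarrow> 'v set \<Rightarrow> 'v set \<Rightarrow> bool" where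
  "commuting_ss_subspace sc br V C \<longleftrightarrow> module.subspace sc C \<and> C \<subseteq> V \<and>
     (\<forall>x\<in>C. semisimple_elt sc br x) \<and> (\<forall>x\<in>C. \<forall>y\<in>C. br x y = 0)"

definition cartan_subspace :: "('k::field \<Rightarrow> 'v::ab_group_add \<Rightarrow> 'v) \<Rightarrow> ('v \<Rightarrow> 'v \<Rightarrow> 'v) \<Rightarrow> 'v set \<Rightarrow> 'v set \<Rightarrow> bool" where
  "cartan_subspace sc br V C \<longleftrightarrow> commuting_ss_subspace sc br V C \<and>
     (\<forall>C'. commuting_ss_subspace sc br V C' \<and> C \<subseteq> C' \<longrightarrow> C' = C)"

definition maximal_rank :: "('k::field \<Rightarrow> 'v::ab_group_add \<Rightarrow> 'v) \<Rightarrow> ('v \<Rightarrow> 'v \<Rightarrow> 'v) \<Rightarrow> ('v \<Rightarrow> 'v) \<Rightarrow> bool" where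
  "maximal_rank sc br \<sigma> \<longleftrightarrow> (\<exists>H. cartan_subalgebra sc br H \<and> H \<subseteq> {x. \<sigma> x = - x})"

end

theory Submission
  imports Defs
begin

text \<open>
  Write \<open>g\<^sub>1\<close> and \<open>g\<^sub>0\<close> for the eigenspaces of \<open>\<sigma>1\<close> for \<open>-1\<close> and \<open>1\<close>.
  By Jordan decomposition and nondegeneracy of the Killing form, a Cartan subspace \<open>C\<close> of \<open>g\<^sub>1\<^sub>1\<close>
  is its own centralizer in \<open>g\<^sub>1\<^sub>1\<close>. Extend \<open>C\<close> to a Cartan subspace \<open>T\<close> of \<open>g\<^sub>1\<close>.
  Maximal rank forces \<open>z(T) = T\<close>; instead of conjugacy of Cartan subspaces, a dimension count shows this.
  If \<open>x\<close> is generic in \<open>T\<close>, then \<open>ad x\<close> exchanges \<open>g\<^sub>0\<close> and \<open>g\<^sub>1\<close> away from \<open>z(x) = z(T)\<close>, so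
  \<open>z(T) = T + m\<close> with \<open>m \<subseteq> g\<^sub>0\<close> has dimension \<open>dim H + 2 dim m\<close>, where \<open>H \<subseteq> g\<^sub>1\<close> is a Cartan subalgebra.
  Choose a Borel-like \<open>b = H + n\<close> and a parabolic \<open>p = z(T) + u\<close> with \<open>n\<close> and \<open>u\<close> their orthogonals.
  Computing \<open>dim (b \<inter> p)\<close> in two ways gives \<open>dim z(T) \<le> dim H + 2 dim N\<close>, where \<open>N\<close> is the
  image of \<open>n \<inter> p\<close> in \<open>z(T)\<close>. It consists of nilpotent elements of \<open>m\<close>, so \<open>N = m\<close>, the Killing form
  vanishes on \<open>m\<close>, and \<open>m = 0\<close>.
  Finally, if \<open>y \<in> g\<^sub>0\<^sub>1\<close> centralizes \<open>C\<close>, then \<open>[T, y] \<subseteq> z(C) \<inter> g\<^sub>1\<^sub>1 = C\<close>, so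
  \<open>(ad t)\<^sup>2 y = 0\<close> and hence \<open>[t, y] = 0\<close> for \<open>t \<in> T\<close>; thus \<open>y \<in> T\<close> and \<open>y = 0\<close>.
  The second claim is the first one for the pair \<open>\<sigma>1, \<sigma>3\<close>.
\<close>

section \<open>Linear algebra over an algebraically closed field of characteristic 0\<close>

locale acl_vector_space = finite_dimensional_vector_space scale Basis
  for scale :: "'k::field_char_0 \<Rightarrow> 'v::ab_group_add \<Rightarrow> 'v" (infixr \<open>*s\<close> 75)
    and Basis :: "'v set" +
  assumes alg_closed_field: "alg_closed TYPE('k)"
begin

abbreviation lin :: "('v \<Rightarrow> 'v) \<Rightarrow> bool" where
  "lin f \<equiv> Vector_Spaces.linear scale scale f"

sublocale vp: finite_dimensional_vector_space_pair scale Basis scale Basis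
  by unfold_locales

lemma lin_iff: "lin f \<longleftrightarrow> (\<forall>x y. f (x + y) = f x + f y) \<and> (\<forall>c x. f (c *s x) = c *s f x)"
  by (simp add: Vector_Spaces.linear_iff vector_space_axioms)

lemma linI: "(\<And>x y. f (x + y) = f x + f y) \<Longrightarrow> (\<And>c x. f (c *s x) = c *s f x) \<Longrightarrow> lin f"
  by (simp add: lin_iff)

lemma
  assumes "lin f"
  shows lin_add: "f (x + y) = f x + f y" and lin_scale: "f (c *s x) = c *s f x"
    and lin_zero: "f 0 = 0" and lin_diff: "f (x - y) = f x - f y" and lin_neg: "f (- x) = - f x"
    and lin_sum: "f (sum g A) = (\<Sum>a\<in>A. f (g a))"
  using assms vp.linear_0[OF assms] vp.linear_diff[OF assms] vp.linear_neg[OF assms]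
    vp.linear_sum[OF assms] by (simp_all add: lin_iff)

lemma lin_comp: "lin f \<Longrightarrow> lin g \<Longrightarrow> lin (\<lambda>v. f (g v))"
  by (simp add: lin_iff)

lemma lin_pow: "lin f \<Longrightarrow> lin (f ^^ k)"
  by (induction k) (auto simp: lin_iff)

lemma lin_shift: "lin f \<Longrightarrow> lin (\<lambda>v. f v - c *s v)"
  by (simp add: lin_iff scale_right_diff_distrib scale_right_distrib mult.commute)

lemma lin_eq_on_span:
  assumes "lin f" "lin g" "span S = UNIV" "\<And>x. x \<in> S \<Longrightarrow> f x = g x"
  shows "f = g"
  using vp.linear_eq_on[OF assms(1,2), of _ S] assms(3,4) by auto

subsection \<open>Generalised eigenspaces\<close>

text \<open>The generalised eigenspace. The exponent may depend on the vector, so membership is a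
  local condition on which \<open>genE_induct\<close> can recurse.\<close>

definition genE :: "('v \<Rightarrow> 'v) \<Rightarrow> 'k \<Rightarrow> 'v set" where
  "genE A c = {v. \<exists>k. ((\<lambda>v. A v - c *s v) ^^ k) v = 0}"

lemma pow_zero_mono:
  assumes "lin f" "(f ^^ k) v = 0" "k \<le> m"
  shows "(f ^^ m) v = 0"
proof -
  have "(f ^^ (m - k + k)) v = 0"
    unfolding funpow_add using assms(1,2) by (simp add: lin_zero lin_pow)
  with assms(3) show ?thesis by simp
qed

lemma subspace_locally_nilpotent:
  assumes "lin f"
  shows "subspace {v. \<exists>k. (f ^^ k) v = 0}"
proof (rule subspaceI; clarsimp)
  show "\<exists>k. (f ^^ k) 0 = 0" by (rule exI[of _ 0]) simp
next
  fix x y k l assume "(f ^^ k) x = 0" "(f ^^ l) y = 0"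
  then have "(f ^^ (max k l)) x = 0" "(f ^^ (max k l)) y = 0"
    using pow_zero_mono[OF assms] by auto
  then have "(f ^^ (max k l)) (x + y) = 0" by (simp add: lin_add[OF lin_pow[OF assms]])
  then show "\<exists>k. (f ^^ k) (x + y) = 0" ..
next
  fix c x k assume "(f ^^ k) x = 0"
  then have "(f ^^ k) (c *s x) = 0" by (simp add: lin_scale[OF lin_pow[OF assms]])
  then show "\<exists>k. (f ^^ k) (c *s x) = 0" ..
qed

lemma subspace_genE: "lin A \<Longrightarrow> subspace (genE A c)"
  unfolding genE_def by (intro subspace_locally_nilpotent lin_shift)

lemma genE_commute:
  assumes "lin B" "\<And>v. A (B v) = B (A v)" "v \<in> genE A c"
  shows "B v \<in> genE A c"
proof -
  let ?f = "\<lambda>v. A v - c *s v"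
  have "(?f ^^ k) (B v) = B ((?f ^^ k) v)" for k
    by (induction k) (simp_all add: assms(2) lin_diff[OF assms(1)] lin_scale[OF assms(1)])
  moreover obtain k where "(?f ^^ k) v = 0" using assms(3) by (auto simp: genE_def)
  ultimately have "(?f ^^ k) (B v) = 0" by (simp add: lin_zero[OF assms(1)])
  then show ?thesis unfolding genE_def by blast
qed

lemma genE_invariant: "lin A \<Longrightarrow> v \<in> genE A c \<Longrightarrow> A v \<in> genE A c"
  by (rule genE_commute) auto

lemma eigenvector_genE: "A v = c *s v \<Longrightarrow> v \<in> genE A c"
  unfolding genE_def by (auto intro: exI[of _ 1])

text \<open>Induction on an exponent that kills \<open>v\<close>: the vector
  \<open>A v - c *s v\<close> is killed one step earlier. This takes the place of arguments with
  Jordan blocks.\<close>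

lemma genE_induct [consumes 2, case_names zero step]:
  assumes "lin A" "v \<in> genE A c"
    and "P 0" "\<And>v. v \<in> genE A c \<Longrightarrow> P (A v - c *s v) \<Longrightarrow> P v"
  shows "P v"
proof -
  let ?f = "\<lambda>v. A v - c *s v"
  obtain k where "(?f ^^ k) v = 0" using assms(2) by (auto simp: genE_def)
  then show ?thesis
  proof (induction k arbitrary: v)
    case (Suc k)
    then have "(?f ^^ k) (?f v) = 0" by (simp add: funpow_Suc_right del: funpow.simps)
    moreover have "v \<in> genE A c" using Suc.prems genE_def by blast
    ultimately show ?case using Suc.IH assms(4) by blast
  qed (use assms(3) in simp)
qed

lemma genE_shiftI:
  assumes "A v - c *s v \<in> genE A c" shows "v \<in> genE A c"
proof -
  let ?f = "\<lambda>v. A v - c *s v"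
  obtain k where "(?f ^^ k) (?f v) = 0" using assms by (auto simp: genE_def)
  then have "(?f ^^ Suc k) v = 0" by (simp add: funpow_Suc_right del: funpow.simps)
  then show ?thesis unfolding genE_def by blast
qed

text \<open>The induction reduces to a true eigenvector for \<open>c\<close>. There the powers of
  \<open>A - d\<close> are the powers of the nonzero scalar \<open>c - d\<close>.\<close>

lemma genE_disjoint:
  assumes A: "lin A" and "v \<in> genE A c" "v \<in> genE A d" "c \<noteq> d"
  shows "v = 0"
  using A assms(2,3)
proof (induction rule: genE_induct)
  case (step v)
  have "A v - c *s v \<in> genE A d"
    using step.prems A by (intro subspace_diff subspace_scale subspace_genE genE_invariant)
  then have ev: "A v = c *s v" using step.IH by simp
  have "((\<lambda>v. A v - d *s v) ^^ k) v = (c - d) ^ k *s v" for k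
    by (induction k) (simp_all add: lin_scale[OF A] ev flip: scale_left_diff_distrib, simp add: algebra_simps)
  then show ?case using step.prems \<open>c \<noteq> d\<close> by (auto simp: genE_def)
qed simp

text \<open>On this space \<open>A - d\<close> is the nonzero scalar \<open>c - d\<close> plus a
  locally nilpotent operator. A solution \<open>w\<close> for the nilpotent remainder of
  \<open>v\<close> is turned into the solution \<open>(v - w) / (c - d)\<close> for
  \<open>v\<close>.\<close>

lemma genE_shift_surj:
  assumes A: "lin A" and "v \<in> genE A c" "c \<noteq> d"
  shows "\<exists>w\<in>genE A c. A w - d *s w = v"
  using A assms(2)
proof (induction rule: genE_induct)
  case zero
  show ?case using subspace_0[OF subspace_genE[OF A]] by (intro bexI[of _ 0]) (simp_all add: lin_zero[OF A])
next
  case (step v)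
  then obtain w where w: "w \<in> genE A c" "A w - d *s w = A v - c *s v" by blast
  define e where "e = inverse (c - d)"
  have e: "e * (c - d) = 1" using \<open>c \<noteq> d\<close> by (simp add: e_def)
  have "A (e *s (v - w)) - d *s (e *s (v - w)) = e *s ((A v - c *s v) + (c - d) *s v - (A w - d *s w))"
    by (simp add: lin_scale[OF A] lin_diff[OF A] algebra_simps)
  also have "\<dots> = v" using w(2) e by simp
  finally show ?case
    using step.hyps w(1) by (intro bexI[of _ "e *s (v - w)"] subspace_scale subspace_diff subspace_genE A)
qed

text \<open>A power of \<open>A - a\<close> that kills the component at \<open>a\<close> leaves a
  shorter vanishing sum. By induction it kills the other components as well, so these also lie in
  \<open>genE A a\<close> and vanish by \<open>genE_disjoint\<close>.\<close>

lemma genE_sum_zero: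
  assumes A: "lin A" and "finite F" "\<And>c. c \<in> F \<Longrightarrow> f c \<in> genE A c" "(\<Sum>c\<in>F. f c) = 0" "c \<in> F"
  shows "f c = 0"
  using assms(2-)
proof (induction F arbitrary: f c)
  case (insert a F)
  let ?g = "\<lambda>v. A v - a *s v"
  obtain k where k: "(?g ^^ k) (f a) = 0" using insert.prems(1)[of a] by (auto simp: genE_def)
  have lg: "lin (?g ^^ k)" by (intro lin_pow lin_shift A)
  have comm: "A ((?g ^^ k) v) = (?g ^^ k) (A v)" for v k
    by (induction k arbitrary: v) (simp_all add: lin_diff[OF A] lin_scale[OF A])
  have F0: "f d = 0" if "d \<in> F" for d
  proof -
    have "(\<Sum>d\<in>F. (?g ^^ k) (f d)) = (?g ^^ k) (\<Sum>d\<in>insert a F. f d)"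
      using insert.hyps k by (simp add: lin_add[OF lg] lin_sum[OF lg])
    then have "(\<Sum>d\<in>F. (?g ^^ k) (f d)) = 0" using insert.prems(2) lin_zero[OF lg] by simp
    then have "(?g ^^ k) (f d) = 0"
      using insert.IH[of "\<lambda>d. (?g ^^ k) (f d)" d] insert.prems(1) genE_commute[OF lg, of A] comm that by auto
    then have "f d \<in> genE A a" unfolding genE_def by blast
    moreover have "f d \<in> genE A d" "d \<noteq> a" using that insert.prems(1) insert.hyps by auto
    ultimately show ?thesis using genE_disjoint[OF A] by blast
  qed
  then have "f a = 0" using insert.prems(2) insert.hyps by simp
  with F0 insert.prems(3) show ?case by auto
qed simp

text \<open>The total function \<open>f\<close>, zero outside \<open>F\<close>, gives one component
  per eigenvalue, so a new vector is absorbed by updating \<open>f\<close> at its eigenvalue,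
  whether or not that was in \<open>F\<close> before.\<close>

lemma span_genE_explicit:
  assumes A: "lin A" and "w \<in> span (\<Union>c\<in>I. genE A c)"
  shows "\<exists>F f. finite F \<and> F \<subseteq> I \<and> (\<forall>c. f c \<in> genE A c) \<and> (\<forall>c. c \<notin> F \<longrightarrow> f c = 0) \<and> w = (\<Sum>c\<in>F. f c)"
  using assms(2)
proof (induction rule: span_induct_alt)
  case base
  show ?case
    using subspace_0[OF subspace_genE[OF A]] by (intro exI[of _ "{}"] exI[of _ "\<lambda>_. 0"]) auto
next
  case (step a x w)
  then obtain F f where F: "finite F" "F \<subseteq> I" "\<forall>c. f c \<in> genE A c" "\<forall>c. c \<notin> F \<longrightarrow> f c = 0"
    "w = (\<Sum>c\<in>F. f c)" by blast
  obtain c0 where c0: "c0 \<in> I" "x \<in> genE A c0" using step by blast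
  let ?f = "f(c0 := a *s x + f c0)"
  have "(\<Sum>c\<in>insert c0 F. ?f c) = ?f c0 + (\<Sum>c\<in>F - {c0}. f c)"
    using F(1) by (subst sum.insert_remove) auto
  also have "\<dots> = a *s x + (\<Sum>c\<in>insert c0 F. f c)"
    using F(1) by (subst sum.insert_remove[of F f]) (auto simp: algebra_simps)
  also have "(\<Sum>c\<in>insert c0 F. f c) = w"
    using F by (subst F(5), intro sum.mono_neutral_right) auto
  finally show ?case
    using F c0 by (intro exI[of _ "insert c0 F"] exI[of _ ?f])
      (auto intro!: subspace_add subspace_scale subspace_genE A)
qed

section \<open>Polynomials evaluated at an operator, and the decomposition into generalised
  eigenspaces\<close>

definition pact :: "('v \<Rightarrow> 'v) \<Rightarrow> 'k poly \<Rightarrow> 'v \<Rightarrow> 'v" where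
  "pact A p v = (\<Sum>i\<le>degree p. coeff p i *s (A ^^ i) v)"

lemma pact_bound: "degree p \<le> n \<Longrightarrow> pact A p v = (\<Sum>i\<le>n. coeff p i *s (A ^^ i) v)"
  unfolding pact_def by (intro sum.mono_neutral_left) (auto simp: coeff_eq_0)

text \<open>Splitting off a root lowers the degree of a polynomial that annihilates
  \<open>v\<close>, at the price of passing from \<open>v\<close> to
  \<open>A v - r *s v\<close>.\<close>

lemma pact_linear_factor:
  assumes A: "lin A"
  shows "pact A ([:- r, 1:] * q) v = pact A q (A v - r *s v)"
proof -
  let ?n = "degree q"
  have "pact A ([:- r, 1:] * q) v
      = (\<Sum>i\<le>Suc ?n. (coeff (pCons 0 q) i - r * coeff q i) *s (A ^^ i) v)"
    by (subst pact_bound[of _ "Suc ?n"]) (use degree_mult_le[of "[:- r, 1:]" q] in simp_all)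
  also have "\<dots> = (\<Sum>i\<le>Suc ?n. coeff (pCons 0 q) i *s (A ^^ i) v)
                - (\<Sum>i\<le>Suc ?n. (r * coeff q i) *s (A ^^ i) v)"
    by (simp only: scale_left_diff_distrib sum_subtractf)
  also have "(\<Sum>i\<le>Suc ?n. coeff (pCons 0 q) i *s (A ^^ i) v) = (\<Sum>i\<le>?n. coeff q i *s (A ^^ i) (A v))"
    by (subst sum.atMost_Suc_shift) (simp add: funpow_swap1)
  also have "(\<Sum>i\<le>Suc ?n. (r * coeff q i) *s (A ^^ i) v) = (\<Sum>i\<le>?n. coeff q i *s (A ^^ i) (r *s v))"
    by (simp add: coeff_eq_0 lin_scale[OF lin_pow[OF A]] mult.commute)
  finally show ?thesis
    by (simp add: pact_def lin_diff[OF lin_pow[OF A]] scale_right_diff_distrib sum_subtractf)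
qed

text \<open>The iterates of \<open>v\<close> up to exponent \<open>dimension\<close> are one too
  many to be independent. Dependence is a notion for sets, so coinciding iterates are a case of
  their own, with a difference of two monomials as polynomial.\<close>

lemma annihilating_poly: "\<exists>p. p \<noteq> 0 \<and> pact A p v = 0"
proof (cases "inj_on (\<lambda>i. (A ^^ i) v) {..dimension}")
  case True
  let ?S = "(\<lambda>i. (A ^^ i) v) ` {..dimension}"
  have "dependent ?S"
  proof (rule dependent_biggerset_general)
    show "finite ?S \<Longrightarrow> dim ?S < card ?S"
      using dim_subset_UNIV[of ?S] True by (simp add: card_image)
  qed
  then obtain u w where u: "(\<Sum>w\<in>?S. u w *s w) = 0" "w \<in> ?S" "u w \<noteq> 0"
    by (auto simp: dependent_finite)
  then obtain j where j: "j \<le> dimension" "u ((A ^^ j) v) \<noteq> 0" by auto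
  define p where "p = (\<Sum>i\<le>dimension. monom (u ((A ^^ i) v)) i)"
  have cp: "coeff p i = (if i \<le> dimension then u ((A ^^ i) v) else 0)" for i
    by (simp add: p_def coeff_sum)
  have "degree p \<le> dimension" by (rule degree_le) (simp add: cp)
  then have "pact A p v = 0"
    using u(1) by (simp add: pact_bound cp sum.reindex[OF True])
  moreover have "p \<noteq> 0" using cp[of j] j by auto
  ultimately show ?thesis by blast
next
  case False
  then obtain i j where ij: "i < j" "(A ^^ i) v = (A ^^ j) v"
    by (auto simp: inj_on_def) (metis linorder_neqE_nat)
  define p :: "'k poly" where "p = monom 1 j - monom 1 i"
  have cp: "coeff p l = (if l = j then 1 else if l = i then - 1 else 0)" for l
    using ij(1) by (auto simp: p_def coeff_monom)
  have "degree p \<le> j" using ij(1) by (intro degree_le) (auto simp: cp)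
  then have "pact A p v = (\<Sum>l\<le>j. coeff p l *s (A ^^ l) v)" by (rule pact_bound)
  also have "\<dots> = (\<Sum>l\<in>{i, j}. coeff p l *s (A ^^ l) v)"
    using ij(1) by (intro sum.mono_neutral_right) (auto simp: cp)
  also have "\<dots> = 0" using ij by (simp add: cp)
  finally show ?thesis using cp[of j] by (intro exI[of _ p]) auto
qed

text \<open>Induction on the degree of a polynomial annihilating \<open>v\<close>. Algebraic
  closedness supplies a root \<open>r\<close>, the induction hypothesis covers
  \<open>A v - r *s v\<close>, and \<open>shift\<close> goes back to \<open>v\<close>.\<close>

lemma span_genE:
  assumes A: "lin A"
  shows "span (\<Union>c. genE A c) = UNIV"
proof -
  let ?S = "span (\<Union>c. genE A c)"
  \<comment> \<open>The components of \<open>A v - r *s v\<close> at eigenvalues other than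
    \<open>r\<close> can be hit by \<open>A - r\<close> from inside \<open>?S\<close>. After
    subtracting such a preimage \<open>v'\<close>, the vector \<open>v - v'\<close> is a generalised
    eigenvector for \<open>r\<close>.\<close>
  have shift: "v \<in> ?S" if shifted: "A v - r *s v \<in> ?S" for v r
  proof -
    have "\<exists>v'\<in>?S. w - (A v' - r *s v') \<in> genE A r" if "w \<in> ?S" for w
      using that
    proof (induction rule: span_induct_alt)
      case base
      show ?case using subspace_0[OF subspace_genE[OF A]] by (intro bexI[of _ 0] span_zero) (simp add: lin_zero[OF A])
    next
      case (step a x w)
      then obtain v' c where v': "v' \<in> ?S" "w - (A v' - r *s v') \<in> genE A r" and c: "x \<in> genE A c" by blast
      have "\<exists>x'\<in>?S. x - (A x' - r *s x') \<in> genE A r"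
      proof (cases "c = r")
        case True
        then show ?thesis using c by (intro bexI[of _ 0] span_zero) (simp add: lin_zero[OF A])
      next
        case False
        then obtain x' where "x' \<in> genE A c" "A x' - r *s x' = x" using genE_shift_surj[OF A c] by blast
        then show ?thesis using subspace_0[OF subspace_genE[OF A]] by (intro bexI[of _ x'] span_base) auto
      qed
      then obtain x' where x': "x' \<in> ?S" "x - (A x' - r *s x') \<in> genE A r" by blast
      have "a *s (x - (A x' - r *s x')) + (w - (A v' - r *s v')) \<in> genE A r"
        using x'(2) v'(2) by (intro subspace_add subspace_scale subspace_genE A)
      moreover have "a *s (x - (A x' - r *s x')) + (w - (A v' - r *s v'))
          = (a *s x + w) - (A (a *s x' + v') - r *s (a *s x' + v'))"
        by (simp add: lin_scale[OF A] lin_add[OF A] algebra_simps)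
      ultimately show ?case
        using x'(1) v'(1) by (intro bexI[of _ "a *s x' + v'"] span_add span_scale) auto
    qed
    then obtain v' where v': "v' \<in> ?S" "(A v - r *s v) - (A v' - r *s v') \<in> genE A r" using shifted by meson
    have "A (v - v') - r *s (v - v') \<in> genE A r"
      using v'(2) by (simp add: lin_diff[OF A] algebra_simps)
    then have "v - v' \<in> ?S" by (intro span_base) (auto dest: genE_shiftI)
    from span_add[OF this v'(1)] show ?thesis by simp
  qed
  have "v \<in> ?S" if "p \<noteq> 0" "pact A p v = 0" for p v
    using that
  proof (induction "degree p" arbitrary: p v)
    case 0
    then obtain a where "p = [:a:]" "a \<noteq> 0" by (metis degree_eq_zeroE pCons_0_0)
    then show ?case using 0 by (simp add: pact_def span_zero)
  next
    case (Suc n)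
    then obtain r where "poly p r = 0"
      using alg_closed_field unfolding alg_closed_def by (metis zero_less_Suc)
    then obtain q where q: "p = [:- r, 1:] * q" by (auto simp: poly_eq_0_iff_dvd)
    then have "q \<noteq> 0" using Suc.prems by auto
    then have "degree p = Suc (degree q)" unfolding q by (subst degree_mult_eq) auto
    moreover have "pact A q (A v - r *s v) = 0"
      using Suc.prems(2) unfolding q pact_linear_factor[OF A] .
    ultimately have "A v - r *s v \<in> ?S"
      using Suc.hyps(1)[of q] Suc.hyps(2) \<open>q \<noteq> 0\<close> by simp
    then show ?case by (rule shift)
  qed
  then show ?thesis using annihilating_poly by blast
qed

end

section \<open>Additive functions on the field with rational or integral values\<close>

text \<open>The field is regarded as a vector space over the rationals. If \<open>f\<close> vanishes
  at the new element \<open>a\<close>, it is replaced by \<open>g + q f\<close> with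
  \<open>g a = 1\<close>; only finitely many \<open>q\<close> create a zero at an element of
  \<open>S\<close> where \<open>f\<close> is nonzero.\<close>

lemma additive_rat_functional:
  fixes S :: "'k::field_char_0 set"
  assumes "finite S"
  shows "\<exists>f :: 'k \<Rightarrow> rat. (\<forall>x y. f (x + y) = f x + f y) \<and> (\<forall>s\<in>S. s \<noteq> 0 \<longrightarrow> f s \<noteq> 0)"
  using assms
proof induction
  case empty
  show ?case by (intro exI[of _ "\<lambda>_. 0"]) simp
next
  case (insert a S)
  then obtain f :: "'k \<Rightarrow> rat" where f: "\<forall>x y. f (x + y) = f x + f y" "\<forall>s\<in>S. s \<noteq> 0 \<longrightarrow> f s \<noteq> 0"
    by blast
  show ?case
  proof (cases "a = 0 \<or> f a \<noteq> 0")
    case True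
    then show ?thesis using f by (intro exI[of _ f]) auto
  next
    case False
    interpret vs: vector_space "\<lambda>(q::rat) (x::'k). of_rat q * x"
      by unfold_locales (simp_all add: algebra_simps of_rat_add of_rat_mult)
    interpret vr: vector_space "(*) :: rat \<Rightarrow> rat \<Rightarrow> rat"
      by unfold_locales (simp_all add: algebra_simps)
    interpret pair: vector_space_pair "\<lambda>(q::rat) (x::'k). of_rat q * x" "(*) :: rat \<Rightarrow> rat \<Rightarrow> rat"
      by unfold_locales
    have "vs.independent {a}" using False by simp
    then obtain g where g: "Vector_Spaces.linear (\<lambda>(q::rat) (x::'k). of_rat q * x) ((*) :: rat \<Rightarrow> rat \<Rightarrow> rat) g" "g a = 1"
      using pair.linear_independent_extend[of "{a}" "\<lambda>_. 1"] by auto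
    have gadd: "g (x + y) = g x + g y" for x y using g(1) by (rule pair.linear_add)
    have "finite ((\<lambda>s. - g s / f s) ` S)" using insert.hyps by simp
    then obtain q where q: "q \<notin> (\<lambda>s. - g s / f s) ` S"
      using ex_new_if_finite[OF infinite_UNIV_char_0] by blast
    have "g s + q * f s \<noteq> 0" if "s \<in> insert a S" "s \<noteq> 0" for s
    proof (cases "s = a")
      case False
      then have "f s \<noteq> 0" "q \<noteq> - g s / f s" using that f(2) q by auto
      then show ?thesis by (simp add: field_simps)
    qed (use \<open>\<not> (a = 0 \<or> f a \<noteq> 0)\<close> g in simp)
    then show ?thesis using f(1) gadd by (intro exI[of _ "\<lambda>x. g x + q * f x"]) (simp add: algebra_simps)
  qed
qed

lemma common_denominator:
  fixes f :: "'k \<Rightarrow> rat"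
  assumes "finite S"
  shows "\<exists>N::int. N \<noteq> 0 \<and> (\<forall>s\<in>S. of_int N * f s \<in> \<int>)"
  using assms
proof induction
  case empty
  show ?case by (intro exI[of _ 1]) simp
next
  case (insert a S)
  then obtain N :: int where N: "N \<noteq> 0" "\<forall>s\<in>S. of_int N * f s \<in> \<int>" by blast
  obtain p q where pq: "f a = of_int p / of_int q" "q > 0"
    by (cases "f a") (auto simp: Fract_of_int_quotient)
  have "of_int (q * N) * f s \<in> \<int>" if "s \<in> insert a S" for s
  proof (cases "s = a")
    case True
    then have "of_int (q * N) * f s = of_int (N * p)" using pq by simp
    then show ?thesis using Ints_of_int by metis
  next
    case False
    then have "of_int q * (of_int N * f s) \<in> \<int>" using N(2) that False Ints_mult[OF Ints_of_int] by blast
    then show ?thesis by (simp only: of_int_mult mult.assoc)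
  qed
  then show ?case using N(1) pq(2) by (intro exI[of _ "q * N"]) auto
qed

text \<open>Clearing denominators makes the rational functional integral on \<open>S\<close> without
  new zeros. Applied to the spectrum of \<open>ad x\<close>, it yields sums of squares in Cartan's
  criterion and integral gradings later.\<close>

lemma additive_int_valued:
  fixes S :: "'k::field_char_0 set"
  assumes "finite S"
  shows "\<exists>f :: 'k \<Rightarrow> 'k. (\<forall>x y. f (x + y) = f x + f y) \<and>
    (\<forall>s\<in>S. f s \<in> \<int>) \<and> (\<forall>s\<in>S. f s = 0 \<longrightarrow> s = 0)"
proof -
  obtain f :: "'k \<Rightarrow> rat" where f: "\<forall>x y. f (x + y) = f x + f y" "\<forall>s\<in>S. s \<noteq> 0 \<longrightarrow> f s \<noteq> 0"
    using additive_rat_functional[OF assms] by blast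
  obtain N :: int where N: "N \<noteq> 0" "\<forall>s\<in>S. of_int N * f s \<in> \<int>"
    using common_denominator[OF assms] by blast
  have "(of_rat (of_int N * f s) :: 'k) \<in> \<int>" if "s \<in> S" for s
  proof -
    obtain z where "of_int N * f s = of_int z" using N(2) \<open>s \<in> S\<close> Ints_cases by blast
    then show ?thesis by (metis Ints_of_int of_rat_of_int_eq)
  qed
  then show ?thesis using f N
    by (intro exI[of _ "\<lambda>x. of_rat (of_int N * f x)"]) (simp add: distrib_left of_rat_add, auto)
qed

section \<open>Projections onto generalised eigenspaces, and operators that are scalar on each of
  them\<close>

context acl_vector_space
begin

lemma genE_inter_span_others:
  assumes A: "lin A" and "w \<in> genE A c" "w \<in> span (\<Union>d\<in>-{c}. genE A d)"
  shows "w = 0"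
proof -
  obtain F f where F: "finite F" "F \<subseteq> -{c}" "\<forall>d. f d \<in> genE A d" "w = (\<Sum>d\<in>F. f d)"
    using span_genE_explicit[OF A assms(3)] by blast
  let ?f = "f(c := - w)"
  have "c \<notin> F" using F(2) by auto
  have "(\<Sum>d\<in>F. ?f d) = (\<Sum>d\<in>F. f d)" using \<open>c \<notin> F\<close> by (intro sum.cong) auto
  then have "(\<Sum>d\<in>insert c F. ?f d) = 0" using F \<open>c \<notin> F\<close> by simp
  then have "?f c = 0"
    using F subspace_neg[OF subspace_genE[OF A] assms(2)]
    by (intro genE_sum_zero[OF A, of "insert c F" ?f]) auto
  then show ?thesis by simp
qed

definition gproj :: "('v \<Rightarrow> 'v) \<Rightarrow> 'k \<Rightarrow> 'v \<Rightarrow> 'v" where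
  "gproj A c v = (THE w. w \<in> genE A c \<and> v - w \<in> span (\<Union>d\<in>-{c}. genE A d))"

lemma gproj_ex1:
  assumes A: "lin A"
  shows "\<exists>!w. w \<in> genE A c \<and> v - w \<in> span (\<Union>d\<in>-{c}. genE A d)"
proof -
  have "(\<Union>d. genE A d) = genE A c \<union> (\<Union>d\<in>-{c}. genE A d)" by auto
  then have "v \<in> span (genE A c \<union> (\<Union>d\<in>-{c}. genE A d))" using span_genE[OF A] by simp
  then obtain x y where xy: "v = x + y" "x \<in> span (genE A c)" "y \<in> span (\<Union>d\<in>-{c}. genE A d)"
    unfolding span_Un by blast
  then have x: "x \<in> genE A c" using subspace_genE[OF A] by (metis span_eq_iff)
  show ?thesis
  proof (rule ex1I[of _ x])
    fix w assume w: "w \<in> genE A c \<and> v - w \<in> span (\<Union>d\<in>-{c}. genE A d)"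
    have "w - x \<in> genE A c" using w x by (intro subspace_diff subspace_genE A) auto
    moreover have "y - (v - w) \<in> span (\<Union>d\<in>-{c}. genE A d)" using w xy(3) span_diff by blast
    moreover have "y - (v - w) = w - x" using xy(1) by simp
    ultimately have "w - x = 0" using genE_inter_span_others[OF A] by metis
    then show "w = x" by simp
  qed (use xy x in auto)
qed

lemma gproj_in: "lin A \<Longrightarrow> gproj A c v \<in> genE A c"
  and gproj_rest: "lin A \<Longrightarrow> v - gproj A c v \<in> span (\<Union>d\<in>-{c}. genE A d)"
  unfolding gproj_def using theI'[OF gproj_ex1, of A c v] by simp_all

lemma gproj_eqI:
  "lin A \<Longrightarrow> w \<in> genE A c \<Longrightarrow> v - w \<in> span (\<Union>d\<in>-{c}. genE A d) \<Longrightarrow> gproj A c v = w"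
  unfolding gproj_def using the1_equality[OF gproj_ex1, of A w c v] by simp

lemma lin_gproj:
  assumes A: "lin A" shows "lin (gproj A c)"
proof (rule linI)
  fix x y
  have "(x - gproj A c x) + (y - gproj A c y) \<in> span (\<Union>d\<in>-{c}. genE A d)"
    by (intro span_add gproj_rest A)
  then show "gproj A c (x + y) = gproj A c x + gproj A c y"
    by (intro gproj_eqI A subspace_add subspace_genE gproj_in) (simp add: algebra_simps)
next
  fix a x
  have "a *s (x - gproj A c x) \<in> span (\<Union>d\<in>-{c}. genE A d)"
    by (intro span_scale gproj_rest A)
  then show "gproj A c (a *s x) = a *s gproj A c x"
    by (intro gproj_eqI A subspace_scale subspace_genE gproj_in) (simp add: algebra_simps)
qed

lemma gproj_same: "lin A \<Longrightarrow> v \<in> genE A c \<Longrightarrow> gproj A c v = v"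
  by (rule gproj_eqI) (auto simp: span_zero)

lemma gproj_other: "lin A \<Longrightarrow> v \<in> genE A d \<Longrightarrow> d \<noteq> c \<Longrightarrow> gproj A c v = 0"
  by (rule gproj_eqI) (auto intro: span_base simp: subspace_0[OF subspace_genE])

lemma lin_eq_on_genE:
  assumes "lin A" "lin f" "lin g" "\<And>c v. v \<in> genE A c \<Longrightarrow> f v = g v"
  shows "f = g"
  using lin_eq_on_span[OF assms(2,3) span_genE[OF assms(1)]] assms(4) by blast

lemma gproj_commute:
  assumes A: "lin A" and B: "lin B" and "\<And>v. A (B v) = B (A v)"
  shows "gproj A c (B v) = B (gproj A c v)"
proof -
  have "(\<lambda>v. gproj A c (B v)) = (\<lambda>v. B (gproj A c v))"
  proof (rule lin_eq_on_genE[OF A])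
    fix d v assume v: "v \<in> genE A d"
    then have "B v \<in> genE A d" using genE_commute[OF B, of A] assms(3) by blast
    with v show "gproj A c (B v) = B (gproj A c v)"
      by (cases "d = c") (simp_all add: gproj_same[OF A] gproj_other[OF A] lin_zero[OF B])
  qed (rule lin_comp[OF lin_gproj[OF A] B] lin_comp[OF B lin_gproj[OF A]])+
  from fun_cong[OF this, of v] show ?thesis .
qed

definition spec :: "('v \<Rightarrow> 'v) \<Rightarrow> 'k set" where
  "spec A = {c. genE A c \<noteq> {0}}"

text \<open>Every basis vector involves finitely many eigenvalues, so finitely many generalised
  eigenspaces span. A further one would meet the span of the others nontrivially.\<close>

lemma finite_spec:
  assumes A: "lin A" shows "finite (spec A)"
proof -
  have "\<exists>F. finite F \<and> b \<in> span (\<Union>c\<in>F. genE A c)" for b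
  proof -
    obtain F f where F: "finite F" "\<forall>d. f d \<in> genE A d" "b = (\<Sum>d\<in>F. f d)"
      using span_genE_explicit[OF A, of b UNIV] span_genE[OF A] by blast
    have "b \<in> span (\<Union>c\<in>F. genE A c)" unfolding F(3) using F(2) by (intro span_sum span_base) auto
    with F(1) show ?thesis by blast
  qed
  then obtain F where F: "\<And>b. finite (F b)" "\<And>b. b \<in> span (\<Union>c\<in>F b. genE A c)" by metis
  let ?F = "\<Union>b\<in>Basis. F b"
  have "Basis \<subseteq> span (\<Union>c\<in>?F. genE A c)"
  proof
    fix b assume "b \<in> Basis"
    then have "span (\<Union>c\<in>F b. genE A c) \<subseteq> span (\<Union>c\<in>?F. genE A c)" by (intro span_mono) blast
    then show "b \<in> span (\<Union>c\<in>?F. genE A c)" using F(2) by blast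
  qed
  then have U: "span (\<Union>c\<in>?F. genE A c) = UNIV"
    using span_minimal[of Basis "span (\<Union>c\<in>?F. genE A c)"] span_Basis by auto
  have "spec A \<subseteq> ?F"
  proof
    fix c assume "c \<in> spec A"
    then obtain v where v: "v \<in> genE A c" "v \<noteq> 0"
      using subspace_0[OF subspace_genE[OF A]] unfolding spec_def by blast
    show "c \<in> ?F"
    proof (rule ccontr)
      assume "c \<notin> ?F"
      then have "span (\<Union>c\<in>?F. genE A c) \<subseteq> span (\<Union>d\<in>-{c}. genE A d)" by (intro span_mono) blast
      then show False using U v genE_inter_span_others[OF A v(1)] by blast
    qed
  qed
  then show ?thesis using F(1) finite_Basis by (meson finite_UN finite_subset)
qed

lemma sum_gproj_weighted:
  assumes A: "lin A" and v: "v \<in> genE A c"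
  shows "(\<Sum>d\<in>spec A. f d *s gproj A d v) = f c *s v"
proof (cases "v = 0")
  case False
  then have "c \<in> spec A" using v by (auto simp: spec_def)
  then have "(\<Sum>d\<in>spec A. f d *s gproj A d v) = (\<Sum>d\<in>{c}. f d *s gproj A d v)"
    using finite_spec[OF A] gproj_other[OF A v] by (intro sum.mono_neutral_right) auto
  then show ?thesis by (simp add: gproj_same[OF A v])
qed (simp add: lin_zero[OF lin_gproj[OF A]])

text \<open>The operator acting on \<open>genE A c\<close> as the scalar \<open>f c\<close>. For
  \<open>f\<close> the identity it is the semisimple part of \<open>A\<close>; for additive
  \<open>f\<close> it turns derivations into derivations.\<close>

definition scop :: "('v \<Rightarrow> 'v) \<Rightarrow> ('k \<Rightarrow> 'k) \<Rightarrow> 'v \<Rightarrow> 'v" where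
  "scop A f v = (\<Sum>d\<in>spec A. f d *s gproj A d v)"

lemma scop_genE: "lin A \<Longrightarrow> v \<in> genE A c \<Longrightarrow> scop A f v = f c *s v"
  unfolding scop_def by (rule sum_gproj_weighted)

lemma lin_scop: "lin A \<Longrightarrow> lin (scop A f)"
  unfolding scop_def
  by (rule linI) (simp_all add: lin_add[OF lin_gproj] lin_scale[OF lin_gproj] scale_right_distrib
      sum.distrib scale_sum_right mult.commute)

lemma sum_gproj: 
  assumes A: "lin A" shows "(\<Sum>d\<in>spec A. gproj A d v) = v"
proof -
  have "scop A (\<lambda>_. 1) = (\<lambda>v. v)"
    by (rule lin_eq_on_genE[OF A]) (simp_all add: lin_scop A scop_genE linear_ident)
  then have "scop A (\<lambda>_. 1) v = v" by simp
  then show ?thesis by (simp add: scop_def)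
qed

lemma gproj_zero_imp_zero: "lin A \<Longrightarrow> (\<And>c. gproj A c v = 0) \<Longrightarrow> v = 0"
  using sum_gproj[of A v] by simp

subsection \<open>Trace\<close>

definition tr :: "('v \<Rightarrow> 'v) \<Rightarrow> 'k" where
  "tr f = (\<Sum>b\<in>Basis. representation Basis (f b) b)"

text \<open>Both sides are the same double sum of products of matrix coefficients. Allowing two
  bases gives cyclicity of the trace and, with one operator the identity, its independence of the
  basis.\<close>

lemma trace_comm_bases:
  assumes B: "independent B" "span B = UNIV" and B': "independent B'" "span B' = UNIV"
    and f: "lin f" and g: "lin g"
  shows "(\<Sum>b\<in>B. representation B (f (g b)) b) = (\<Sum>c\<in>B'. representation B' (g (f c)) c)"
proof -
  have fin: "finite B" "finite B'" using B B' finiteI_independent by auto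
  have key: "representation C (h v) c = (\<Sum>d\<in>D. representation D v d * representation C (h d) c)"
    if C: "independent C" "span C = UNIV" and D: "independent D" "span D = UNIV" and h: "lin h" for C D h v c
  proof -
    have fD: "finite D" using D finiteI_independent by auto
    have "h v = (\<Sum>d\<in>D. representation D v d *s h d)"
      using arg_cong[OF sum_representation_eq[OF D(1), of v D], of h] D(2) fD
      by (simp add: lin_scale[OF h] lin_sum[OF h])
    then show ?thesis
      using C by (simp add: representation_sum representation_scale)
  qed
  have "(\<Sum>b\<in>B. representation B (f (g b)) b)
      = (\<Sum>b\<in>B. \<Sum>c\<in>B'. representation B' (g b) c * representation B (f c) b)"
    by (intro sum.cong refl key[OF B B' f])
  also have "\<dots> = (\<Sum>c\<in>B'. \<Sum>b\<in>B. representation B (f c) b * representation B' (g b) c)"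
    by (subst sum.swap) (simp add: mult.commute)
  also have "\<dots> = (\<Sum>c\<in>B'. representation B' (g (f c)) c)"
    by (intro sum.cong refl key[OF B' B g, symmetric])
  finally show ?thesis .
qed

lemma tr_comm: "lin f \<Longrightarrow> lin g \<Longrightarrow> tr (\<lambda>v. f (g v)) = tr (\<lambda>v. g (f v))"
  unfolding tr_def by (intro trace_comm_bases independent_Basis span_Basis)

lemma tr_basis:
  "independent B \<Longrightarrow> span B = UNIV \<Longrightarrow> lin f \<Longrightarrow> tr f = (\<Sum>b\<in>B. representation B (f b) b)"
  unfolding tr_def using trace_comm_bases[OF independent_Basis span_Basis, of B f "\<lambda>v. v"] linear_ident by simp

lemma tr_add: "tr (\<lambda>v. f v + g v) = tr f + tr g"
  and tr_scale: "tr (\<lambda>v. c *s f v) = c * tr f"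
  and tr_diff: "tr (\<lambda>v. f v - g v) = tr f - tr g"
  and tr_zero: "tr (\<lambda>v. 0) = 0"
  by (simp_all add: tr_def representation_add representation_scale representation_diff representation_zero
      independent_Basis span_Basis sum.distrib sum_subtractf sum_distrib_left)

lemma tr_sum: "tr (\<lambda>v. \<Sum>i\<in>I. f i v) = (\<Sum>i\<in>I. tr (f i))"
  by (induction I rule: infinite_finite_induct) (simp_all add: tr_zero tr_add)

definition nilp :: "('v \<Rightarrow> 'v) \<Rightarrow> bool" where
  "nilp f \<longleftrightarrow> (\<forall>v. \<exists>k. (f ^^ k) v = 0)"

lemma nilp_uniform:
  assumes f: "lin f" and "nilp f"
  shows "\<exists>k. \<forall>v. (f ^^ k) v = 0"
proof -
  obtain k where k: "\<And>v. (f ^^ k v) v = 0" using assms(2) unfolding nilp_def by metis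
  define m where "m = Max (k ` Basis)"
  have "(f ^^ m) b = 0" if "b \<in> Basis" for b
    using that finite_Basis by (intro pow_zero_mono[OF f k]) (simp add: m_def)
  then have "f ^^ m = (\<lambda>_. 0)"
    by (intro lin_eq_on_span[OF lin_pow[OF f] _ span_Basis]) (simp_all add: lin_iff)
  then show ?thesis by metis
qed

text \<open>
  For a generalised inverse \<open>g\<close> of \<open>f\<close>, the operator \<open>f \<circ> f \<circ> g\<close> has the same trace as \<open>f\<close>
  and a smaller nilpotency index.
\<close>

lemma tr_nilpotent_pow:
  assumes "lin f" "\<And>v. (f ^^ k) v = 0"
  shows "tr f = 0"
  using assms
proof (induction k arbitrary: f)
  case 0
  then have "f = (\<lambda>_. 0)" by auto
  then show ?case by (simp add: tr_zero)
next
  case (Suc k)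
  note f = Suc.prems(1)
  obtain g where g: "lin g" "\<And>v. f (g (f v)) = f v"
    using vp.linear_exists_right_inverse_on[OF f subspace_UNIV] by auto
  let ?h = "\<lambda>v. f (f (g v))"
  have "tr f = tr (\<lambda>v. f (g (f v)))" using g(2) by simp
  also have "\<dots> = tr ?h" using tr_comm[of "\<lambda>v. f (g v)" f] f g(1) lin_comp by auto
  finally have eq: "tr f = tr ?h" .
  \<comment> \<open>Every inner \<open>g\<close> stands between two copies of \<open>f\<close> and
    is absorbed, so the \<open>k\<close>-th power of \<open>?h\<close> is the
    \<open>Suc k\<close>-th power of \<open>f\<close> after a single \<open>g\<close>.\<close>
  have pow: "(?h ^^ Suc j) v = (f ^^ Suc j) (f (g v))" for j v
    by (induction j) (simp_all add: g(2))
  show ?case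
  proof (cases k)
    case 0
    then have "f = (\<lambda>_. 0)" using Suc.prems(2) by auto
    then show ?thesis by (simp add: tr_zero)
  next
    case (Suc j)
    have "(?h ^^ k) v = 0" for v
    proof -
      have "(?h ^^ k) v = (f ^^ Suc k) (g v)" unfolding Suc pow by (simp add: funpow_swap1)
      then show ?thesis using Suc.prems(2) by simp
    qed
    with Suc.IH[of ?h, OF lin_comp[OF f lin_comp[OF f g(1)]]] show ?thesis using eq by simp
  qed
qed

lemma tr_nilp: "lin f \<Longrightarrow> nilp f \<Longrightarrow> tr f = 0"
  using nilp_uniform tr_nilpotent_pow by blast

text \<open>In a basis extending one of the range, vectors of the range are fixed and the images of
  the others have no diagonal coefficient.\<close>

lemma tr_idempotent:
  assumes P: "lin P" "\<And>v. P (P v) = P v"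
  shows "tr P = of_nat (dim (range P))"
proof -
  obtain B1 where B1: "B1 \<subseteq> range P" "independent B1" "range P \<subseteq> span B1" "card B1 = dim (range P)"
    using basis_exists by metis
  define B where "B = extend_basis B1"
  have B: "independent B" "span B = UNIV" "B1 \<subseteq> B"
    using B1(2) independent_extend_basis span_extend_basis extend_basis_superset by (auto simp: B_def)
  have fB: "finite B" using B finiteI_independent by auto
  have "representation B (P b) b = (if b \<in> B1 then 1 else 0)" if "b \<in> B" for b
  proof (cases "b \<in> B1")
    case True
    then have "P b = b" using B1(1) P(2) by auto
    then show ?thesis using True that B by (simp add: representation_basis)
  next
    case False
    have "representation B (P b) = representation B1 (P b)"
      using B1 B by (intro representation_extend) auto
    then show ?thesis using False representation_ne_zero by auto
  qed
  then have "tr P = (\<Sum>b\<in>B. if b \<in> B1 then 1 else 0)" using tr_basis[OF B(1,2) P(1)] by simp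
  also have "\<dots> = of_nat (card B1)" using fB B(3) by (simp add: sum.If_cases Int_absorb1)
  finally show ?thesis using B1(4) by simp
qed

lemma tr_gproj:
  assumes A: "lin A" shows "tr (gproj A c) = of_nat (dim (genE A c))"
proof -
  have "range (gproj A c) = genE A c"
  proof (intro equalityI subsetI)
    fix v assume "v \<in> genE A c"
    then show "v \<in> range (gproj A c)" using gproj_same[OF A, of v c] by (intro range_eqI[of _ _ v]) simp
  qed (use gproj_in[OF A] in auto)
  then show ?thesis
    using tr_idempotent[OF lin_gproj[OF A]] gproj_same[OF A gproj_in[OF A]] by simp
qed

text \<open>On \<open>genE A c\<close> the operator is \<open>c\<close> plus a nilpotent one, and
  the nilpotent part is traceless.\<close>

lemma tr_gproj_op:
  assumes A: "lin A" shows "tr (\<lambda>v. gproj A c (A v)) = c * of_nat (dim (genE A c))"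
proof -
  let ?N = "\<lambda>v. A v - c *s v"
  let ?M = "\<lambda>v. gproj A c (?N v)"
  have comm: "gproj A c (?N v) = ?N (gproj A c v)" for v
    by (simp add: gproj_commute[OF A A] lin_diff[OF lin_gproj[OF A]] lin_scale[OF lin_gproj[OF A]])
  have pow: "(?M ^^ Suc k) v = (?N ^^ Suc k) (gproj A c v)" for k v
  proof (induction k)
    case (Suc k)
    have "(?M ^^ Suc (Suc k)) v = ?N (gproj A c ((?N ^^ Suc k) (gproj A c v)))"
      using Suc comm[of "(?N ^^ Suc k) (gproj A c v)"] by (simp only: funpow.simps(2)[of "Suc k" ?M] o_def)
    also have "gproj A c ((?N ^^ Suc k) (gproj A c v)) = (?N ^^ Suc k) (gproj A c v)"
    proof (rule gproj_same[OF A])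
      have "(?N ^^ j) w \<in> genE A c" if "w \<in> genE A c" for j w
        using that by (induction j) (auto intro!: subspace_diff subspace_scale subspace_genE genE_invariant A)
      then show "(?N ^^ Suc k) (gproj A c v) \<in> genE A c" using gproj_in[OF A] by blast
    qed
    finally show ?case by simp
  qed (simp add: comm)
  have "nilp ?M"
    unfolding nilp_def
  proof
    fix v
    obtain k where "(?N ^^ k) (gproj A c v) = 0" using gproj_in[OF A, of c v] unfolding genE_def by blast
    then have "(?N ^^ Suc k) (gproj A c v) = 0"
      using pow_zero_mono[OF lin_shift[OF A], of k c _ "Suc k"] by simp
    then show "\<exists>k. (?M ^^ k) v = 0" using pow by metis
  qed
  then have "tr ?M = 0" by (intro tr_nilp lin_comp[OF lin_gproj[OF A] lin_shift[OF A]])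
  moreover have "tr ?M = tr (\<lambda>v. gproj A c (A v)) - c * tr (gproj A c)"
    by (simp add: lin_diff[OF lin_gproj[OF A]] lin_scale[OF lin_gproj[OF A]] tr_diff tr_scale)
  ultimately show ?thesis by (simp add: tr_gproj[OF A])
qed

end

lemma (in acl_vector_space) ex_max_dim:
  assumes "P M" shows "\<exists>M. P M \<and> (\<forall>M'. P M' \<longrightarrow> dim M' \<le> dim M)"
  using ex_has_greatest_nat[of P M dim "Suc dimension"] assms dim_subset_UNIV by (simp add: less_Suc_eq_le)

section \<open>Bracket calculus and derivations of a semisimple Lie algebra\<close>

locale semisimple_lie_algebra = acl_vector_space scale Basis
  for scale :: "'k::field_char_0 \<Rightarrow> 'v::ab_group_add \<Rightarrow> 'v" (infixr \<open>*s\<close> 75)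
    and Basis :: "'v set" +
  fixes br :: "'v \<Rightarrow> 'v \<Rightarrow> 'v"
  assumes semisimple: "semisimple_lie scale br"
begin

lemma br_add_left: "br (x + y) z = br x z + br y z"
  and br_add_right: "br x (y + z) = br x y + br x z"
  and br_scale_left: "br (c *s x) y = c *s br x y"
  and br_scale_right: "br x (c *s y) = c *s br x y"
  and br_self: "br x x = 0"
  and br_cyclic: "br x (br y z) + br y (br z x) + br z (br x y) = 0"
  using semisimple unfolding semisimple_lie_def lie_algebra_def by auto

lemma br_anti: "br x y = - br y x"
proof -
  have "br (x + y) (x + y) = br x y + br y x"
    unfolding br_add_left br_add_right by (simp add: br_self)
  then show ?thesis by (simp add: br_self eq_neg_iff_add_eq_0)
qed

lemma lin_br: "lin (br x)"
  by (rule linI) (simp_all add: br_add_right br_scale_right)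

lemma lin_br_left: "lin (\<lambda>x. br x y)"
  by (rule linI) (simp_all add: br_add_left br_scale_left)

lemmas br_zero = lin_zero[OF lin_br] lin_zero[OF lin_br_left]
lemmas br_neg_right = lin_neg[OF lin_br]
lemmas br_neg_left = lin_neg[OF lin_br_left]
lemmas br_diff_right = lin_diff[OF lin_br]
lemmas br_diff_left = lin_diff[OF lin_br_left]

lemma br_zero_sym: "br x y = 0 \<longleftrightarrow> br y x = 0"
  using br_anti[of x y] by simp

lemma jacobi: "br (br x y) z = br x (br y z) - br y (br x z)"
proof -
  have "br y (br z x) = - br y (br x z)" "br z (br x y) = - br (br x y) z"
    using br_anti[of z x] br_anti[of z "br x y"] by (simp_all add: br_neg_right)
  then show ?thesis using br_cyclic[of x y z] by (simp add: algebra_simps add_eq_0_iff)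
qed

lemma jacobi_derivation: "br x (br y z) = br (br x y) z + br y (br x z)"
  by (simp add: jacobi)

definition derivation :: "('v \<Rightarrow> 'v) \<Rightarrow> bool" where
  "derivation d \<longleftrightarrow> lin d \<and> (\<forall>x y. d (br x y) = br (d x) y + br x (d y))"

lemma derivation_br: "derivation (br x)"
  unfolding derivation_def using lin_br jacobi_derivation by blast

text \<open>\<open>D - (a + b)\<close> applied to \<open>br v w\<close> is the sum of the bracket of
  \<open>(D - a) v\<close> with \<open>w\<close> and that of \<open>v\<close> with
  \<open>(D - b) w\<close>. Hence the nested induction, over \<open>v\<close> and then over
  \<open>w\<close>.\<close>

lemma genE_br:
  assumes "derivation D" "v \<in> genE D a" "w \<in> genE D b"
  shows "br v w \<in> genE D (a + b)"
proof -
  have D: "lin D" "\<And>x y. D (br x y) = br (D x) y + br x (D y)" using assms(1) by (auto simp: derivation_def)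
  have z: "0 \<in> genE D (a + b)" using subspace_0[OF subspace_genE[OF D(1)]] .
  show ?thesis using D(1) assms(2) assms(3)
  proof (induction arbitrary: w rule: genE_induct)
    case (step v)
    from D(1) step.prems show ?case
    proof (induction rule: genE_induct)
      case (step w)
      have "D (br v w) - (a + b) *s br v w = br (D v - a *s v) w + br v (D w - b *s w)"
        by (simp add: D(2) br_diff_left br_diff_right br_scale_left br_scale_right algebra_simps)
      also have "\<dots> \<in> genE D (a + b)"
        using step \<open>\<And>w. w \<in> genE D b \<Longrightarrow> br (D v - a *s v) w \<in> genE D (a + b)\<close>
        by (intro subspace_add subspace_genE D(1))
      finally show ?case by (rule genE_shiftI)
    qed (simp add: br_zero z)
  qed (simp add: br_zero z)
qed

text \<open>Weights add under the bracket, so scaling each weight space by an additive function of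
  the weight obeys the Leibniz rule on weight vectors. These span, and the rule is extended in one
  argument at a time.\<close>

lemma derivation_scop:
  assumes D: "derivation D" and f: "\<And>x y. f (x + y) = f x + f y"
  shows "derivation (scop D f)"
proof -
  have lD: "lin D" using D by (simp add: derivation_def)
  let ?d = "scop D f"
  have ld: "lin ?d" by (rule lin_scop[OF lD])
  have 1: "?d (br u w) = br (?d u) w + br u (?d w)" if u: "u \<in> genE D a" and w: "w \<in> genE D b" for u w a b
    using scop_genE[OF lD genE_br[OF D u w]] scop_genE[OF lD u] scop_genE[OF lD w]
    by (simp add: f br_scale_left br_scale_right scale_left_distrib)
  have 2: "?d (br u w) = br (?d u) w + br u (?d w)" if w: "w \<in> genE D b" for u w b
  proof -
    have "(\<lambda>u. ?d (br u w)) = (\<lambda>u. br (?d u) w + br u (?d w))"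
      by (rule lin_eq_on_genE[OF lD]) (auto intro: 1 w linI
          simp: lin_add[OF ld] lin_scale[OF ld] br_add_left br_scale_left scale_right_distrib)
    from fun_cong[OF this, of u] show ?thesis .
  qed
  have "?d (br u w) = br (?d u) w + br u (?d w)" for u w
  proof -
    have "(\<lambda>w. ?d (br u w)) = (\<lambda>w. br (?d u) w + br u (?d w))"
      by (rule lin_eq_on_genE[OF lD]) (auto intro: 2 linI
          simp: lin_add[OF ld] lin_scale[OF ld] br_add_right br_scale_right scale_right_distrib)
    from fun_cong[OF this, of w] show ?thesis .
  qed
  then show ?thesis using ld by (simp add: derivation_def)
qed

subsection \<open>Engel's theorem\<close>

text \<open>The filtration of the whole algebra by the number of operators \<open>br m\<close>
  applied. \<open>act M N = {0}\<close> says that all products of \<open>N\<close> such operators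
  vanish.\<close>

primrec act :: "'v set \<Rightarrow> nat \<Rightarrow> 'v set" where
  "act M 0 = UNIV"
| "act M (Suc i) = span {br m w | m w. m \<in> M \<and> w \<in> act M i}"

lemma subspace_act: "subspace (act M i)"
  by (cases i) auto

lemma act_Suc: "m \<in> M \<Longrightarrow> w \<in> act M i \<Longrightarrow> br m w \<in> act M (Suc i)"
  by (auto intro: span_base)

lemma act_decreasing: "act M (Suc i) \<subseteq> act M i"
proof (induction i)
  case (Suc i)
  then show ?case by (subst (1 2) act.simps(2)) (intro span_mono, blast)
qed simp

text \<open>As \<open>y\<close> normalises \<open>M\<close>, \<open>br y\<close> preserves every
  \<open>act M i\<close>. In a long product of factors from \<open>span (insert y M)\<close> acting
  on \<open>act M i\<close>, either some factor contributes an element of \<open>M\<close>, which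
  leads into \<open>act M (Suc i)\<close>, or a high power of \<open>br y\<close> remains, which is
  zero.\<close>

lemma act_extend:
  assumes M: "subspace M" and y: "\<And>m. m \<in> M \<Longrightarrow> br y m \<in> M" and nil: "\<And>v. (br y ^^ K) v = 0"
    and N: "act M N = {0}"
  shows "\<exists>j. act (span (insert y M)) j = {0}"
proof -
  let ?M = "span (insert y M)"
  have yact: "br y w \<in> act M i" if "w \<in> act M i" for w i
    using that
  proof (induction i arbitrary: w)
    case (Suc i)
    have "subspace {w. br y w \<in> act M (Suc i)}"
      using vp.linear_subspace_vimage[OF lin_br subspace_act, of y M "Suc i"] by (simp add: vimage_def)
    moreover have "{br m w | m w. m \<in> M \<and> w \<in> act M i} \<subseteq> {w. br y w \<in> act M (Suc i)}"
    proof clarify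
      fix m w assume mw: "m \<in> M" "w \<in> act M i"
      have "br (br y m) w \<in> act M (Suc i)" "br m (br y w) \<in> act M (Suc i)"
        using act_Suc y[OF mw(1)] mw Suc.IH by blast+
      then show "br y (br m w) \<in> act M (Suc i)"
        unfolding jacobi_derivation[of y m w] by (intro subspace_add subspace_act)
    qed
    ultimately have "act M (Suc i) \<subseteq> {w. br y w \<in> act M (Suc i)}"
      using span_minimal by simp
    with Suc.prems show ?case by blast
  qed simp
  have "\<exists>j. act ?M j \<subseteq> act M i" for i
  proof (induction i)
    case 0
    show ?case by simp
  next
    case (Suc i)
    then obtain j where j: "act ?M j \<subseteq> act M i" by blast
    \<comment> \<open>After \<open>k\<close> further factors, only the pure power of
      \<open>br y\<close> can still lie outside \<open>act M (Suc i)\<close>; \<open>k = K\<close>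
      removes it.\<close>
    have "act ?M (j + k) \<subseteq> {a + (br y ^^ k) b | a b. a \<in> act M (Suc i) \<and> b \<in> act M i}" for k
    proof (induction k)
      case 0
      have "v \<in> {a + (br y ^^ 0) b | a b. a \<in> act M (Suc i) \<and> b \<in> act M i}" if "v \<in> act ?M j" for v
        using that j subspace_0[OF subspace_act, of M "Suc i"]
        by (intro CollectI exI[of _ 0] exI[of _ v]) auto
      then show ?case by auto
    next
      case (Suc k)
      let ?T = "\<lambda>k. {a + (br y ^^ k) b | a b. a \<in> act M (Suc i) \<and> b \<in> act M i}"
      have yk: "(br y ^^ k) b \<in> act M i" if "b \<in> act M i" for b k
        using that yact by (induction k) auto
      have sT: "subspace (?T (Suc k))"
      proof -
        have "subspace ((br y ^^ Suc k) ` act M i)"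
          by (intro vp.linear_subspace_image lin_pow lin_br subspace_act)
        then have "subspace {x + z | x z. x \<in> act M (Suc i) \<and> z \<in> (br y ^^ Suc k) ` act M i}"
          by (intro subspace_sums subspace_act)
        moreover have "{x + z | x z. x \<in> act M (Suc i) \<and> z \<in> (br y ^^ Suc k) ` act M i} = ?T (Suc k)"
          by blast
        ultimately show ?thesis by simp
      qed
      have "{br m w | m w. m \<in> ?M \<and> w \<in> act ?M (j + k)} \<subseteq> ?T (Suc k)"
      proof clarify
        fix m w assume m: "m \<in> ?M" and w: "w \<in> act ?M (j + k)"
        obtain a b where ab: "w = a + (br y ^^ k) b" "a \<in> act M (Suc i)" "b \<in> act M i" using Suc w by blast
        obtain c where "m - c *s y \<in> M" using m M span_breakdown_eq[of m y M] by (metis span_eq_iff)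
        define m' where "m' = m - c *s y"
        have m': "m' \<in> M" "m = m' + c *s y" using \<open>m - c *s y \<in> M\<close> by (simp_all add: m'_def)
        have wi: "w \<in> act M i"
          unfolding ab(1) using ab act_decreasing yk by (intro subspace_add subspace_act) blast+
        have "br m w = (br m' w + c *s br y a) + (br y ^^ Suc k) (c *s b)"
        proof -
          have "br y w = br y a + (br y ^^ Suc k) b" using ab(1) by (simp add: br_add_right)
          then show ?thesis
            unfolding m'(2) lin_scale[OF lin_pow[OF lin_br]]
            by (simp only: br_add_left br_scale_left scale_right_distrib add.assoc)
        qed
        moreover have "br m' w + c *s br y a \<in> act M (Suc i)"
          using act_Suc[OF m'(1) wi] yact[OF ab(2)] by (intro subspace_add subspace_scale subspace_act)
        moreover have "c *s b \<in> act M i" using ab(3) by (intro subspace_scale subspace_act)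
        ultimately show "\<exists>a b. br m w = a + (br y ^^ Suc k) b \<and> a \<in> act M (Suc i) \<and> b \<in> act M i" by blast
      qed
      then have "span {br m w | m w. m \<in> ?M \<and> w \<in> act ?M (j + k)} \<subseteq> ?T (Suc k)"
        using sT by (rule span_minimal)
      then show ?case by simp
    qed
    from this[of K] have "act ?M (j + K) \<subseteq> act M (Suc i)" by (auto simp: nil)
    then show ?case by blast
  qed
  from this[of N] obtain j where "act ?M j \<subseteq> {0}" using N by auto
  then have "act ?M j = {0}" using subspace_0[OF subspace_act, of ?M j] by blast
  then show ?thesis ..
qed

text \<open>Take a subalgebra \<open>M\<close> of \<open>D\<close> of maximal dimension among those
  with vanishing filtration. If \<open>M\<close> were proper, some \<open>y\<close> in
  \<open>D - M\<close> would normalise it, and \<open>act_extend\<close> would give a larger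
  one.\<close>

lemma engel:
  assumes D: "subspace D" "\<And>x y. x \<in> D \<Longrightarrow> y \<in> D \<Longrightarrow> br x y \<in> D" and nil: "\<And>x. x \<in> D \<Longrightarrow> nilp (br x)"
  shows "\<exists>N. act D N = {0}"
proof -
  let ?Q = "\<lambda>M. subspace M \<and> M \<subseteq> D \<and> (\<forall>x\<in>M. \<forall>y\<in>M. br x y \<in> M) \<and> (\<exists>N. act M N = {0})"
  have "act {0} (Suc 0) = {0}"
  proof -
    have "{br m w | m w. m \<in> {0} \<and> w \<in> act {0} 0} = {0}" by (auto simp: br_zero)
    then show ?thesis by simp
  qed
  then have "\<exists>N. act {0} N = {0}" by blast
  then have "?Q {0}" using subspace_0[OF D(1)] by (simp add: br_zero)
  then have "\<exists>M. ?Q M \<and> (\<forall>M'. ?Q M' \<longrightarrow> dim M' \<le> dim M)"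
    by (rule ex_max_dim)
  then obtain M where M: "?Q M" and max: "\<And>M'. ?Q M' \<Longrightarrow> dim M' \<le> dim M" by blast
  obtain N where N: "act M N = {0}" using M by blast
  have "M = D"
  proof (rule ccontr)
    assume "M \<noteq> D"
    then obtain z where z: "z \<in> D" "z \<notin> M" using M by blast
    \<comment> \<open>Otherwise bracketing with elements of \<open>M\<close> could be repeated
      forever without leaving \<open>D - M\<close>, although \<open>act M N\<close> is zero.\<close>
    have "\<exists>y\<in>D - M. \<forall>m\<in>M. br m y \<in> M"
    proof (rule ccontr)
      assume no: "\<not> ?thesis"
      have "\<exists>y\<in>D - M. y \<in> act M i" for i
      proof (induction i)
        case 0
        show ?case using z by auto
      next
        case (Suc i)
        then obtain y where y: "y \<in> D - M" "y \<in> act M i" by blast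
        then obtain m where "m \<in> M" "br m y \<notin> M" using no by blast
        moreover have "br m y \<in> D" using D(2) M y \<open>m \<in> M\<close> by blast
        ultimately show ?case using act_Suc[OF _ y(2)] by blast
      qed
      from this[of N] show False using N M subspace_0 by auto
    qed
    then obtain y where y: "y \<in> D" "y \<notin> M" "\<And>m. m \<in> M \<Longrightarrow> br m y \<in> M" by blast
    let ?M = "span (insert y M)"
    have yM: "br y m \<in> M" if "m \<in> M" for m
      using y(3)[OF that] br_anti[of y m] M subspace_neg by metis
    obtain K where K: "\<And>v. (br y ^^ K) v = 0" using nilp_uniform[OF lin_br nil[OF y(1)]] by blast
    have "?M \<subseteq> D" using y(1) M D(1) by (intro span_minimal) auto
    moreover have "br a b \<in> ?M" if ab: "a \<in> ?M" "b \<in> ?M" for a b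
    proof -
      have sM: "span M = M" using M by simp
      obtain c d where "a - c *s y \<in> M" "b - d *s y \<in> M"
        using ab span_breakdown_eq[of _ y M] sM by metis
      then obtain a' b' where ab': "a' \<in> M" "b' \<in> M" "a = a' + c *s y" "b = b' + d *s y"
        by (metis diff_add_cancel)
      have "br a b = br a' b' + d *s br a' y + c *s br y b'"
        unfolding ab'(3,4) by (simp add: br_add_left br_add_right br_scale_left br_scale_right br_self)
      also have "\<dots> \<in> M" using M ab' y(3) yM by (intro subspace_add subspace_scale) auto
      finally show ?thesis using span_superset by blast
    qed
    moreover have "\<exists>j. act ?M j = {0}" using act_extend[OF _ yM K N] M by blast
    ultimately have "dim ?M \<le> dim M" by (intro max) auto
    moreover have "M \<subseteq> ?M" using span_superset by blast
    ultimately have "M = ?M" using M subspace_dim_equal[of M ?M] by auto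
    then show False using y(2) span_base[of y "insert y M"] by auto
  qed
  then show ?thesis using N by blast
qed

text \<open>A perfect \<open>D\<close> is contained in every term of its own filtration
  \<open>act D i\<close>, and by Engel's theorem one term is zero.\<close>

lemma perfect_nil_zero:
  assumes D: "D = span {br x y | x y. x \<in> D \<and> y \<in> D}" and nil: "\<And>x. x \<in> D \<Longrightarrow> nilp (br x)"
  shows "D = {0}"
proof -
  have sD: "subspace D" by (subst D) (rule subspace_span)
  have cl: "br x y \<in> D" if "x \<in> D" "y \<in> D" for x y
    by (subst D, rule span_base) (use that in blast)
  obtain N where N: "act D N = {0}" using engel[OF sD cl nil] by blast
  have "D \<subseteq> act D i" for i
  proof (induction i)
    case (Suc i)
    have "span {br x y | x y. x \<in> D \<and> y \<in> D} \<subseteq> act D (Suc i)"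
      unfolding act.simps using Suc by (intro span_mono) blast
    then show ?case using D by simp
  qed simp
  from this[of N] show ?thesis using N sD subspace_0 by blast
qed

end

lemma
  fixes f :: "'k::ring_1 \<Rightarrow> 'k"
  assumes f: "\<And>x y. f (x + y) = f x + f y"
  shows additive_zero: "f 0 = 0"
    and additive_of_int: "f (of_int z * x) = of_int z * f x"
    and additive_sum: "f (sum g A) = (\<Sum>a\<in>A. f (g a))"
proof -
  show z: "f 0 = 0" using f[of 0 0] by simp
  have neg: "f (- x) = - f x" for x using f[of x "- x"] z by (simp add: add_eq_0_iff)
  have nat: "f (of_nat n * x) = of_nat n * f x" for n
    by (induction n) (simp_all add: z f algebra_simps)
  show "f (of_int z * x) = of_int z * f x"
    by (cases z rule: int_cases2) (simp_all add: nat neg)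
  show "f (sum g A) = (\<Sum>a\<in>A. f (g a))"
    by (induction A rule: infinite_finite_induct) (simp_all add: z f)
qed

context semisimple_lie_algebra
begin

subsection \<open>Killing form\<close>

definition kil :: "'v \<Rightarrow> 'v \<Rightarrow> 'k" where
  "kil x y = tr (\<lambda>v. br x (br y v))"

lemma kil_sym: "kil x y = kil y x"
  unfolding kil_def by (rule tr_comm[OF lin_br lin_br])

lemma kil_add_left: "kil (x + y) z = kil x z + kil y z"
  and kil_scale_left: "kil (c *s x) z = c * kil x z"
  unfolding kil_def by (simp_all add: br_add_left br_scale_left tr_add tr_scale)

lemma kil_add_right: "kil z (x + y) = kil z x + kil z y"
  and kil_scale_right: "kil z (c *s x) = c * kil z x"
  unfolding kil_sym[of z] by (simp_all add: kil_add_left kil_scale_left)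

lemma kil_zero: "kil 0 x = 0" "kil x 0 = 0"
  using kil_scale_left[of 0 0 x] kil_sym[of 0 x] by simp_all

lemma kil_neg: "kil (- x) y = - kil x y" "kil x (- y) = - kil x y"
  using kil_scale_left[of "-1" x y] kil_scale_right[of x "-1" y] by simp_all

lemma kil_diff: "kil (x - z) y = kil x y - kil z y" "kil x (y - z) = kil x y - kil x z"
  using kil_add_left[of x "- z" y] kil_add_right[of x y "- z"] by (simp_all add: kil_neg)

lemma kil_invariant: "kil (br x y) z = kil x (br y z)"
proof -
  have "kil (br x y) z = tr (\<lambda>v. br x (br y (br z v))) - tr (\<lambda>v. br y (br x (br z v)))"
    unfolding kil_def jacobi by (rule tr_diff)
  also have "tr (\<lambda>v. br y (br x (br z v))) = tr (\<lambda>v. br x (br z (br y v)))"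
    by (rule tr_comm[OF lin_br lin_comp[OF lin_br lin_br]])
  also have "tr (\<lambda>v. br x (br y (br z v))) - \<dots> = kil x (br y z)"
    unfolding kil_def jacobi br_diff_right by (rule tr_diff[symmetric])
  finally show ?thesis .
qed

lemma subspace_kil_orth: "subspace {x. \<forall>y\<in>S. kil x y = 0}"
  by (rule subspaceI) (auto simp: kil_zero kil_add_left kil_scale_left)

text \<open>
  Let \<open>d\<close> act on the generalised eigenspaces of \<open>ad x\<close> by an additive function \<open>f\<close> of the eigenvalue.
  Then \<open>d\<close> is a derivation, so \<open>tr (d \<circ> ad x) = 0\<close>; applying \<open>f\<close>, integral on the spectrum,
  to \<open>\<Sum> m\<^sub>c f(c) c = 0\<close> leaves a vanishing sum of squares.
\<close>

lemma nilp_of_radical_commutators: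
  assumes x: "x \<in> span {br a b | a b. a \<in> UNIV \<and> (\<forall>z. kil b z = 0)}"
  shows "nilp (br x)"
proof -
  let ?A = "br x"
  have fin: "finite (spec ?A)" by (rule finite_spec[OF lin_br])
  obtain f :: "'k \<Rightarrow> 'k" where f: "\<And>x y. f (x + y) = f x + f y"
    and fint: "\<And>s. s \<in> spec ?A \<Longrightarrow> f s \<in> \<int>" and f0: "\<And>s. s \<in> spec ?A \<Longrightarrow> f s = 0 \<Longrightarrow> s = 0"
    using additive_int_valued[OF fin] by blast
  define d where "d = scop ?A f"
  have "derivation d" unfolding d_def by (rule derivation_scop[OF derivation_br f])
  then have ld: "lin d" and d: "\<And>x y. d (br x y) = br (d x) y + br x (d y)" by (auto simp: derivation_def)
  have "tr (\<lambda>v. d (br z v)) = 0" if "z \<in> span {br a b | a b. a \<in> UNIV \<and> (\<forall>z. kil b z = 0)}" for z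
    using that
  proof (induction rule: span_induct_alt)
    case base
    show ?case by (simp add: br_zero lin_zero[OF ld] tr_zero)
  next
    case (step c z w)
    then obtain a b where ab: "z = br a b" "\<And>z. kil b z = 0" by blast
    \<comment> \<open>Cyclicity of the trace moves the commutator onto \<open>d\<close> and
      \<open>br a\<close>. Since \<open>d\<close> is a derivation, this commutator is
      \<open>br (d a)\<close>, so the trace is the pairing of \<open>b\<close> with
      \<open>d a\<close>, which is zero.\<close>
    have "tr (\<lambda>v. d (br z v)) = tr (\<lambda>v. d (br a (br b v))) - tr (\<lambda>v. d (br b (br a v)))"
      unfolding ab(1) jacobi lin_diff[OF ld] by (rule tr_diff)
    also have "tr (\<lambda>v. d (br b (br a v))) = tr (\<lambda>v. br a (d (br b v)))"
      by (rule tr_comm[OF lin_comp[OF ld lin_br] lin_br])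
    also have "tr (\<lambda>v. d (br a (br b v))) - \<dots> = tr (\<lambda>v. br (d a) (br b v))"
      by (simp add: d[of a] flip: tr_diff)
    also have "\<dots> = kil b (d a)" by (simp add: kil_sym[of b] flip: kil_def)
    finally have "tr (\<lambda>v. d (br z v)) = 0" using ab(2) by simp
    then show ?case
      using step by (simp add: br_add_left br_scale_left lin_add[OF ld] lin_scale[OF ld] tr_add tr_scale)
  qed
  then have "tr (\<lambda>v. d (br x v)) = 0" using x by blast
  moreover have "tr (\<lambda>v. d (br x v)) = (\<Sum>c\<in>spec ?A. f c * (c * of_nat (dim (genE ?A c))))"
    unfolding d_def scop_def by (simp add: tr_sum tr_scale tr_gproj_op[OF lin_br])
  ultimately have "f (\<Sum>c\<in>spec ?A. f c * (c * of_nat (dim (genE ?A c)))) = 0"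
    using additive_zero[of f] f by simp
  then have sum0: "(\<Sum>c\<in>spec ?A. f (f c * (c * of_nat (dim (genE ?A c))))) = 0"
    unfolding additive_sum[of f, OF f] .
  have "\<forall>c\<in>spec ?A. \<exists>z. f c = of_int z" using fint Ints_cases by blast
  from bchoice[OF this] obtain g where g: "\<And>c. c \<in> spec ?A \<Longrightarrow> f c = of_int (g c)" by blast
  have "f (f c * (c * of_nat (dim (genE ?A c)))) = of_int (int (dim (genE ?A c)) * (g c)\<^sup>2)"
    if "c \<in> spec ?A" for c
  proof -
    have "f c * (c * of_nat (dim (genE ?A c))) = of_int (g c * int (dim (genE ?A c))) * c"
      using g[OF that] by simp
    then have "f (f c * (c * of_nat (dim (genE ?A c)))) = of_int (g c * int (dim (genE ?A c))) * f c"
      using additive_of_int[of f, OF f] by metis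
    then show ?thesis using g[OF that] by (simp add: power2_eq_square)
  qed
  then have "(of_int (\<Sum>c\<in>spec ?A. int (dim (genE ?A c)) * (g c)\<^sup>2) :: 'k) = 0"
    using sum0 by simp
  then have "(\<Sum>c\<in>spec ?A. int (dim (genE ?A c)) * (g c)\<^sup>2) = 0" by (simp only: of_int_eq_0_iff)
  then have all0: "\<forall>c\<in>spec ?A. int (dim (genE ?A c)) * (g c)\<^sup>2 = 0"
    using fin by (subst (asm) sum_nonneg_eq_0_iff) auto
  have "c = 0" if c: "c \<in> spec ?A" for c
  proof -
    have "dim (genE ?A c) \<noteq> 0"
      using c subspace_0[OF subspace_genE[OF lin_br]] unfolding spec_def dim_eq_0 by blast
    then have "g c = 0" using all0 c by auto
    then show ?thesis using g[OF c] f0[OF c] by simp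
  qed
  then have "v \<in> genE ?A 0" for v
  proof -
    have "(\<Sum>c\<in>spec ?A. gproj ?A c v) \<in> genE ?A 0"
      using \<open>\<And>c. c \<in> spec ?A \<Longrightarrow> c = 0\<close> gproj_in[OF lin_br, of x 0 v]
      by (intro subspace_sum subspace_genE lin_br) auto
    then show ?thesis by (simp add: sum_gproj[OF lin_br])
  qed
  then show ?thesis unfolding nilp_def genE_def by simp
qed

text \<open>Cartan's criterion. The radical \<open>S\<close> of the form is an ideal whose derived
  series becomes stationary at a term of least dimension. That term is perfect and consists of
  ad-nilpotent elements, hence is zero, so \<open>S\<close> is solvable.\<close>

lemma kil_nondegenerate:
  assumes "\<And>y. kil x y = 0" shows "x = 0"
proof -
  define S where "S = {x. \<forall>y. kil x y = 0}"
  have sS: "subspace S" using subspace_kil_orth[of UNIV] by (simp add: S_def)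
  have "br x y \<in> S" if "y \<in> S" for x y
    using that by (simp add: S_def br_anti[of x y] kil_neg kil_invariant)
  then have ideal: "lie_ideal scale br S" using sS by (simp add: lie_ideal_def)
  let ?D = "derived_series scale br S"
  have sD: "subspace (?D n)" for n by (cases n) (auto simp: sS)
  have dec: "?D (Suc n) \<subseteq> ?D n" for n
  proof (induction n)
    case 0
    have "{br x y | x y. x \<in> S \<and> y \<in> S} \<subseteq> S" using \<open>\<And>x y. y \<in> S \<Longrightarrow> br x y \<in> S\<close> by blast
    then show ?case using span_minimal sS by simp
  next
    case (Suc n)
    have "span {br x y | x y. x \<in> ?D (Suc n) \<and> y \<in> ?D (Suc n)} \<subseteq> span {br x y | x y. x \<in> ?D n \<and> y \<in> ?D n}"
      using Suc by (intro span_mono) blast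
    then show ?case by simp
  qed
  have DS: "?D n \<subseteq> S" for n using dec by (induction n) auto
  obtain n where n: "\<And>m. dim (?D n) \<le> dim (?D m)"
    using ex_has_least_nat[of "\<lambda>_. True" 0 "\<lambda>n. dim (?D n)"] by auto
  have eq: "?D (Suc n) = ?D n" using subspace_dim_equal[OF sD sD dec n] .
  then have perfect: "?D n = span {br x y | x y. x \<in> ?D n \<and> y \<in> ?D n}" by simp
  have "?D n = {0}"
  proof (rule perfect_nil_zero[OF perfect])
    fix x assume "x \<in> ?D n"
    then have "x \<in> span {br x y | x y. x \<in> ?D n \<and> y \<in> ?D n}" using perfect by simp
    moreover have "{br x y | x y. x \<in> ?D n \<and> y \<in> ?D n} \<subseteq> {br a b | a b. a \<in> UNIV \<and> (\<forall>z. kil b z = 0)}"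
      using DS[of n] unfolding S_def by blast
    ultimately show "nilp (br x)" using span_mono nilp_of_radical_commutators by blast
  qed
  then have "solvable scale br S" unfolding solvable_def by blast
  then have "S = {0}" using ideal semisimple unfolding semisimple_lie_def by blast
  then show ?thesis using assms by (auto simp: S_def)
qed

section \<open>Representing functionals by the Killing form; derivations are inner\<close>

lemma ad_injective: "(\<And>v. br x v = br y v) \<Longrightarrow> x = y"
proof -
  assume "\<And>v. br x v = br y v"
  then have "\<And>v. br (x - y) v = 0" by (simp add: br_diff_left)
  then have "kil (x - y) z = 0" for z by (simp add: kil_def tr_zero)
  then show "x = y" using kil_nondegenerate[of "x - y"] by simp
qed

text \<open>The endomorphism \<open>?T\<close> records the pairings of \<open>x\<close> with the
  basis vectors as coordinates. Nondegeneracy makes it injective, hence surjective.\<close>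

lemma kil_riesz:
  assumes add: "\<And>x y. \<psi> (x + y) = \<psi> x + \<psi> y" and sc: "\<And>c x. \<psi> (c *s x) = c * \<psi> x"
  shows "\<exists>x. \<forall>y. kil x y = \<psi> y"
proof -
  let ?T = "\<lambda>x. \<Sum>b\<in>Basis. kil x b *s b"
  have ext: "\<forall>y. p y = q y" if "\<And>b. b \<in> Basis \<Longrightarrow> p b = q b"
    "\<And>x y. p (x + y) = p x + p y" "\<And>x y. q (x + y) = q x + q y"
    "\<And>c x. p (c *s x) = c * p x" "\<And>c x. q (c *s x) = c * q x" for p q :: "'v \<Rightarrow> 'k"
  proof
    fix y
    have "p 0 = 0" "q 0 = 0" using that(4)[of 0 0] that(5)[of 0 0] by simp_all
    then have "subspace {y. p y = q y}" by (intro subspaceI) (auto simp: that)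
    moreover have "Basis \<subseteq> {y. p y = q y}" using that(1) by auto
    ultimately show "p y = q y" using span_minimal[of Basis "{y. p y = q y}"] span_Basis by blast
  qed
  have coord: "kil x b = h b" if eq: "?T x = (\<Sum>b\<in>Basis. h b *s b)" and b: "b \<in> Basis" for x h b
  proof -
    have "(\<Sum>b\<in>Basis. (kil x b - h b) *s b) = 0"
      using eq by (simp add: scale_left_diff_distrib sum_subtractf)
    then have "kil x b - h b = 0"
      using independentD[OF independent_Basis finite_Basis, of "\<lambda>b. kil x b - h b" b] b by simp
    then show ?thesis by simp
  qed
  have lT: "lin ?T"
    by (rule linI) (simp_all add: kil_add_left kil_scale_left scale_left_distrib sum.distrib scale_sum_right)
  have "inj ?T"
  proof (subst vp.linear_inj_iff_eq_0[OF lT], intro allI impI)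
    fix x assume "?T x = 0"
    then have "\<forall>b\<in>Basis. kil x b = 0" using coord[of x "\<lambda>_. 0"] by simp
    then have "\<forall>y. kil x y = 0"
      by (intro ext[of "kil x" "\<lambda>_. 0"]) (auto simp: kil_add_right kil_scale_right)
    then show "x = 0" using kil_nondegenerate by blast
  qed
  then have "surj ?T" by (rule linear_inj_imp_surj[OF lT])
  then obtain x where "?T x = (\<Sum>b\<in>Basis. \<psi> b *s b)" by (metis (no_types, lifting) surj_def)
  then have "\<forall>y. kil x y = \<psi> y"
    by (intro ext) (auto simp: kil_add_right kil_scale_right add sc dest: coord)
  then show ?thesis ..
qed

text \<open>Choose \<open>x\<close> to represent the functional sending \<open>y\<close> to the
  trace of \<open>d\<close> after \<open>ad y\<close>. For \<open>e = d - ad x\<close> these traces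
  vanish, and \<open>kil (e a) b\<close> is the one belonging to \<open>br a b\<close>; so
  \<open>e = 0\<close> by nondegeneracy.\<close>

lemma derivation_inner:
  assumes "derivation d" shows "\<exists>x. \<forall>v. d v = br x v"
proof -
  have ld: "lin d" and d: "\<And>x y. d (br x y) = br (d x) y + br x (d y)"
    using assms by (auto simp: derivation_def)
  obtain x where x: "\<And>y. kil x y = tr (\<lambda>v. d (br y v))"
    using kil_riesz[of "\<lambda>y. tr (\<lambda>v. d (br y v))"]
    by (auto simp: br_add_left br_scale_left lin_add[OF ld] lin_scale[OF ld] tr_add tr_scale)
  define e where "e = (\<lambda>v. d v - br x v)"
  have le: "lin e" unfolding e_def by (rule vp.linear_compose_sub[OF ld lin_br])
  have e: "e (br a b) = br (e a) b + br a (e b)" for a b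
    using d[of a b] jacobi_derivation[of x a b] by (simp add: e_def br_diff_left br_diff_right)
  have tre: "tr (\<lambda>v. e (br y v)) = 0" for y
    using x[of y] by (simp add: e_def tr_diff kil_def)
  have "kil (e a) b = 0" for a b
  proof -
    have "kil (e a) b = tr (\<lambda>v. e (br a (br b v)) - br a (e (br b v)))"
      unfolding kil_def using e[of a] by simp
    also have "\<dots> = tr (\<lambda>v. e (br a (br b v))) - tr (\<lambda>v. br a (e (br b v)))" by (rule tr_diff)
    also have "tr (\<lambda>v. br a (e (br b v))) = tr (\<lambda>v. e (br b (br a v)))"
      by (rule tr_comm[OF lin_br lin_comp[OF le lin_br]])
    also have "tr (\<lambda>v. e (br a (br b v))) - \<dots> = tr (\<lambda>v. e (br (br a b) v))"
      unfolding jacobi lin_diff[OF le] by (rule tr_diff[symmetric])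
    finally show ?thesis using tre by simp
  qed
  then have "e a = 0" for a using kil_nondegenerate by blast
  then show ?thesis unfolding e_def by (metis eq_iff_diff_eq_0)
qed

text \<open>The source of auxiliary elements: \<open>f\<close> the identity gives the semisimple
  Jordan part of \<open>y\<close>, and \<open>f\<close> integral on the spectrum gives an integral
  grading.\<close>

lemma element_of_eigenvalue_map:
  assumes f: "\<And>x y. f (x + y) = f x + f y"
  obtains s where "\<And>c v. v \<in> genE (br y) c \<Longrightarrow> br s v = f c *s v"
proof -
  obtain s where "\<forall>v. scop (br y) f v = br s v"
    using derivation_inner[OF derivation_scop[OF derivation_br f]] by blast
  then show thesis using that scop_genE[OF lin_br] by metis
qed

end

section \<open>Commuting operators, generic elements and semisimple elements\<close>

context acl_vector_space
begin

lemma span_UNIV_mono: "A \<subseteq> B \<Longrightarrow> span A = UNIV \<Longrightarrow> span B = UNIV"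
  using span_mono[of A B] by auto

text \<open>\<open>A - a\<close> and \<open>B - b\<close> commute and are nilpotent at
  \<open>v\<close>, hence so is \<open>(A - a) + t (B - b)\<close>. The induction runs on the sum of
  the two exponents.\<close>

lemma genE_commuting_sum:
  assumes A: "lin A" and B: "lin B" and comm: "\<And>v. A (B v) = B (A v)"
    and "v \<in> genE A a" "v \<in> genE B b"
  shows "v \<in> genE (\<lambda>v. A v + t *s B v) (a + t * b)"
proof -
  let ?N = "\<lambda>v. A v - a *s v" and ?M = "\<lambda>v. B v - b *s v" and ?C = "\<lambda>v. A v + t *s B v"
  have lC: "lin ?C" using A B by (simp add: lin_iff scale_right_distrib mult.commute)
  have NM: "?N (?M v) = ?M (?N v)" for v
    by (simp add: lin_diff[OF A] lin_diff[OF B] lin_scale[OF A] lin_scale[OF B] comm algebra_simps)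
  have NMk: "(?N ^^ k) (?M v) = ?M ((?N ^^ k) v)" for k v
    by (induction k) (simp_all only: funpow.simps o_apply id_apply NM)
  have MNk: "(?M ^^ k) (?N v) = ?N ((?M ^^ k) v)" for k v
    by (induction k) (simp_all only: funpow.simps o_apply id_apply NM)
  have main: "v \<in> genE ?C (a + t * b)" if "k + l = n" "(?N ^^ k) v = 0" "(?M ^^ l) v = 0" for k l n v
    using that
  proof (induction n arbitrary: k l v)
    case 0
    then show ?case using subspace_0[OF subspace_genE[OF lC]] by simp
  next
    case (Suc n)
    show ?case
    proof (cases "k = 0 \<or> l = 0")
      case True
      then have "v = 0" using Suc.prems by auto
      then show ?thesis using subspace_0[OF subspace_genE[OF lC]] by simp
    next
      case False
      then obtain k' l' where kl: "k = Suc k'" "l = Suc l'" by (meson not0_implies_Suc)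
      have "?N v \<in> genE ?C (a + t * b)"
      proof (rule Suc.IH[of k' l])
        show "(?N ^^ k') (?N v) = 0" using Suc.prems(2) kl by (simp add: funpow_Suc_right del: funpow.simps)
        show "(?M ^^ l) (?N v) = 0" unfolding MNk Suc.prems(3) by (simp add: lin_zero[OF A])
      qed (use Suc.prems(1) kl in simp)
      moreover have "?M v \<in> genE ?C (a + t * b)"
      proof (rule Suc.IH[of k l'])
        show "(?M ^^ l') (?M v) = 0" using Suc.prems(3) kl by (simp add: funpow_Suc_right del: funpow.simps)
        show "(?N ^^ k) (?M v) = 0" unfolding NMk Suc.prems(2) by (simp add: lin_zero[OF B])
      qed (use Suc.prems(1) kl in simp)
      ultimately have "?N v + t *s ?M v \<in> genE ?C (a + t * b)"
        by (intro subspace_add subspace_scale subspace_genE lC)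
      moreover have "?N v + t *s ?M v = ?C v - (a + t * b) *s v" by (simp add: algebra_simps)
      ultimately show ?thesis by (metis (no_types, lifting) genE_shiftI)
    qed
  qed
  obtain k l where "(?N ^^ k) v = 0" "(?M ^^ l) v = 0" using assms(4,5) by (auto simp: genE_def)
  then show ?thesis using main by blast
qed

lemma genE_if_gproj_zero:
  assumes A: "lin A" and "\<And>c. c \<noteq> a \<Longrightarrow> gproj A c v = 0"
  shows "v \<in> genE A a"
proof -
  have "(\<Sum>c\<in>spec A. gproj A c v) \<in> genE A a"
    using assms(2) gproj_in[OF A, of a v] subspace_0[OF subspace_genE[OF A]]
    by (intro subspace_sum subspace_genE A) metis
  then show ?thesis by (simp add: sum_gproj[OF A])
qed

lemma gproj_nonzero_spec: "lin A \<Longrightarrow> gproj A c v \<noteq> 0 \<Longrightarrow> c \<in> spec A"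
  using gproj_in[of A c v] by (auto simp: spec_def)

end

context semisimple_lie_algebra
begin

lemma br_commute: "br x y = 0 \<Longrightarrow> br x (br y v) = br y (br x v)"
  using jacobi[of x y v] by (simp add: br_zero)

text \<open>A joint generalised eigenvector with weights \<open>c\<close> and \<open>d\<close> has
  weight \<open>c + t * d\<close> for \<open>x + t *s y\<close>. Avoiding the finitely many ratios
  \<open>- c / d\<close>, this weight is zero only for \<open>c = d = 0\<close>.\<close>

lemma generic_pair:
  assumes xy: "br x y = 0"
  shows "\<exists>t. genE (br (x + t *s y)) 0 \<subseteq> genE (br x) 0 \<inter> genE (br y) 0"
proof -
  let ?A = "br x" and ?B = "br y"
  have "finite ((\<lambda>(a, b). - a / b) ` (spec ?A \<times> spec ?B))"
    using finite_spec[OF lin_br] by simp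
  then obtain t where t: "t \<notin> (\<lambda>(a, b). - a / b) ` (spec ?A \<times> spec ?B)"
    using ex_new_if_finite[OF infinite_UNIV_char_0] by blast
  let ?z = "x + t *s y"
  have z: "br ?z = (\<lambda>v. br x v + t *s br y v)" by (simp add: br_add_left br_scale_left fun_eq_iff)
  note comm = br_commute[OF xy]
  have zx: "br ?z (br x v) = br x (br ?z v)" and zy: "br ?z (br y v) = br y (br ?z v)" for v
    by (simp_all add: z comm br_add_right br_scale_right)
  have zero: "gproj ?A c (gproj ?B d v) = 0" if v: "v \<in> genE (br ?z) 0" and cd: "c \<noteq> 0 \<or> d \<noteq> 0" for v c d
  proof (rule ccontr)
    define w where "w = gproj ?A c (gproj ?B d v)"
    assume "gproj ?A c (gproj ?B d v) \<noteq> 0"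
    then have "w \<noteq> 0" "gproj ?B d v \<noteq> 0" by (auto simp: w_def lin_zero[OF lin_gproj[OF lin_br]])
    then have cds: "c \<in> spec ?A" "d \<in> spec ?B"
      using gproj_nonzero_spec[OF lin_br] w_def by blast+
    have w1: "w \<in> genE ?A c" unfolding w_def by (rule gproj_in[OF lin_br])
    have w2: "w \<in> genE ?B d" unfolding w_def
      by (rule genE_commute[OF lin_gproj[OF lin_br] _ gproj_in[OF lin_br]])
        (simp add: gproj_commute[OF lin_br lin_br] comm)
    have "gproj ?B d v \<in> genE (br ?z) 0"
      by (rule genE_commute[OF lin_gproj[OF lin_br] _ v]) (rule gproj_commute[OF lin_br lin_br zy[symmetric], symmetric])
    then have w3: "w \<in> genE (br ?z) 0" unfolding w_def
      by (rule genE_commute[OF lin_gproj[OF lin_br], rotated]) (rule gproj_commute[OF lin_br lin_br zx[symmetric], symmetric])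
    have "w \<in> genE (br ?z) (c + t * d)" unfolding z by (rule genE_commuting_sum[OF lin_br lin_br comm w1 w2])
    then have ct: "c + t * d = 0" using genE_disjoint[OF lin_br w3] \<open>w \<noteq> 0\<close> by metis
    then have "d \<noteq> 0" using cd by auto
    then have "t = - c / d" using ct by (simp add: field_simps add_eq_0_iff)
    then show False using t cds by auto
  qed
  have "v \<in> genE ?A 0 \<inter> genE ?B 0" if v: "v \<in> genE (br ?z) 0" for v
  proof -
    have "gproj ?B d v = 0" if "d \<noteq> 0" for d
      using gproj_zero_imp_zero[OF lin_br] zero[OF v] that by blast
    then have B: "v \<in> genE ?B 0" by (rule genE_if_gproj_zero[OF lin_br])
    have "gproj ?A c v = 0" if "c \<noteq> 0" for c
      using zero[OF v, of c 0] that gproj_same[OF lin_br B] by simp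
    then have "v \<in> genE ?A 0" by (rule genE_if_gproj_zero[OF lin_br])
    with B show ?thesis by blast
  qed
  then show ?thesis by blast
qed

text \<open>Choose \<open>h\<close> with \<open>genE (br h) 0\<close> of least dimension. By
  \<open>generic_pair\<close>, adding a suitable multiple of \<open>y\<close> shrinks this space
  into \<open>genE (br y) 0\<close>, and minimality shows that nothing was lost.\<close>

lemma generic_element:
  assumes H: "subspace H" "\<And>x y. x \<in> H \<Longrightarrow> y \<in> H \<Longrightarrow> br x y = 0"
  shows "\<exists>h\<in>H. \<forall>y\<in>H. genE (br h) 0 \<subseteq> genE (br y) 0"
proof -
  obtain h where h: "h \<in> H" and min: "\<And>y. y \<in> H \<Longrightarrow> dim (genE (br h) 0) \<le> dim (genE (br y) 0)"
    using ex_has_least_nat[of "\<lambda>x. x \<in> H" 0 "\<lambda>x. dim (genE (br x) 0)"] subspace_0[OF H(1)] by blast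
  have "genE (br h) 0 \<subseteq> genE (br y) 0" if y: "y \<in> H" for y
  proof -
    obtain t where t: "genE (br (h + t *s y)) 0 \<subseteq> genE (br h) 0 \<inter> genE (br y) 0"
      using generic_pair[OF H(2)[OF h y]] by blast
    have "h + t *s y \<in> H" using h y by (intro subspace_add subspace_scale H(1))
    then have "genE (br (h + t *s y)) 0 = genE (br h) 0"
      using t min by (intro subspace_dim_equal subspace_genE lin_br) auto
    then show ?thesis using t by blast
  qed
  with h show ?thesis by blast
qed

text \<open>If eigenvectors span, \<open>br x\<close> agrees with its semisimple part, which is
  scalar on each generalised eigenspace. Nilpotent blocks are thereby excluded.\<close>

lemma semisimple_elt_iff:
  "semisimple_elt scale br x \<longleftrightarrow> (\<forall>c. \<forall>v\<in>genE (br x) c. br x v = c *s v)"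
proof
  assume "semisimple_elt scale br x"
  then have sp: "span {y. \<exists>c. br x y = c *s y} = UNIV" by (simp add: semisimple_elt_def)
  have "br x = scop (br x) (\<lambda>c. c)"
  proof (rule lin_eq_on_span[OF lin_br lin_scop[OF lin_br] sp])
    fix v assume "v \<in> {y. \<exists>c. br x y = c *s y}"
    then obtain c where "br x v = c *s v" by blast
    then show "br x v = scop (br x) (\<lambda>c. c) v" using scop_genE[OF lin_br eigenvector_genE, of x v c] by simp
  qed
  then show "\<forall>c. \<forall>v\<in>genE (br x) c. br x v = c *s v" using scop_genE[OF lin_br] by metis
next
  assume "\<forall>c. \<forall>v\<in>genE (br x) c. br x v = c *s v"
  then have "(\<Union>c. genE (br x) c) \<subseteq> {y. \<exists>c. br x y = c *s y}" by blast
  then show "semisimple_elt scale br x"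
    unfolding semisimple_elt_def using span_genE[OF lin_br] by (rule span_UNIV_mono)
qed

lemma semisimple_genE: "semisimple_elt scale br x \<Longrightarrow> v \<in> genE (br x) c \<Longrightarrow> br x v = c *s v"
  by (simp add: semisimple_elt_iff)

lemma semisimple_scale: "semisimple_elt scale br x \<Longrightarrow> semisimple_elt scale br (t *s x)"
proof -
  assume x: "semisimple_elt scale br x"
  have "{y. \<exists>c. br x y = c *s y} \<subseteq> {y. \<exists>c. br (t *s x) y = c *s y}"
  proof clarify
    fix v c assume "br x v = c *s v"
    then have "br (t *s x) v = (t * c) *s v" by (simp add: br_scale_left)
    then show "\<exists>c. br (t *s x) v = c *s v" ..
  qed
  then show ?thesis using x unfolding semisimple_elt_def by (rule span_UNIV_mono)
qed

text \<open>The spectral projections of commuting elements commute, so applying both to a vector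
  gives joint eigenvectors, and these add up to the vector.\<close>

lemma semisimple_add:
  assumes x: "semisimple_elt scale br x" and y: "semisimple_elt scale br y" and xy: "br x y = 0"
  shows "semisimple_elt scale br (x + y)"
proof -
  let ?E = "{v. \<exists>c. br (x + y) v = c *s v}"
  have "gproj (br y) d (gproj (br x) c v) \<in> ?E" for c d v
  proof -
    let ?w = "gproj (br y) d (gproj (br x) c v)"
    have "?w \<in> genE (br x) c"
      by (rule genE_commute[OF lin_gproj[OF lin_br] _ gproj_in[OF lin_br]])
        (rule gproj_commute[OF lin_br lin_br br_commute[OF xy, symmetric], symmetric])
    then have "br x ?w = c *s ?w" by (rule semisimple_genE[OF x])
    moreover have "br y ?w = d *s ?w" by (rule semisimple_genE[OF y gproj_in[OF lin_br]])
    ultimately have "br (x + y) ?w = (c + d) *s ?w" by (simp add: br_add_left scale_left_distrib)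
    then show ?thesis by blast
  qed
  then have "(\<Sum>d\<in>spec (br y). gproj (br y) d (gproj (br x) c v)) \<in> span ?E" for c v
    by (intro span_sum span_base) auto
  then have "gproj (br x) c v \<in> span ?E" for c v by (simp add: sum_gproj[OF lin_br])
  then have "(\<Sum>c\<in>spec (br x). gproj (br x) c v) \<in> span ?E" for v by (intro span_sum) auto
  then show ?thesis unfolding semisimple_elt_def by (auto simp: sum_gproj[OF lin_br])
qed

section \<open>Centralizers of commuting semisimple elements, and orthogonality of weight
  spaces\<close>

definition centralizer :: "'v set \<Rightarrow> 'v set" where
  "centralizer C = {x. \<forall>c\<in>C. br x c = 0}"

lemma subspace_centralizer: "subspace (centralizer C)"
  unfolding centralizer_def by (rule subspaceI) (auto simp: br_zero br_add_left br_scale_left)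

text \<open>The generalised null space of a generic \<open>h\<close> lies in that of every element
  of \<open>C\<close>, and by semisimplicity the latter is the ordinary null space.\<close>

lemma generic_centralizer:
  assumes "commuting_ss_subspace scale br V C"
  shows "\<exists>h\<in>C. genE (br h) 0 = centralizer C"
proof -
  have C: "subspace C" "\<And>x. x \<in> C \<Longrightarrow> semisimple_elt scale br x" "\<And>x y. x \<in> C \<Longrightarrow> y \<in> C \<Longrightarrow> br x y = 0"
    using assms by (auto simp: commuting_ss_subspace_def)
  obtain h where h: "h \<in> C" "\<And>y. y \<in> C \<Longrightarrow> genE (br h) 0 \<subseteq> genE (br y) 0"
    using generic_element[OF C(1,3)] by blast
  have "br v c = 0" if "v \<in> genE (br h) 0" "c \<in> C" for v c
    using semisimple_genE[OF C(2)[OF that(2)], of v 0] h(2)[OF that(2)] that(1) br_zero_sym[of v c] by auto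
  moreover have "v \<in> genE (br h) 0" if "v \<in> centralizer C" for v
    using that h(1) br_zero_sym[of v h] by (intro eigenvector_genE) (simp add: centralizer_def)
  ultimately show ?thesis using h(1) by (intro bexI[of _ h]) (auto simp: centralizer_def)
qed

text \<open>Provides the larger candidate against which maximality of a Cartan subspace is
  tested.\<close>

lemma commuting_ss_insert:
  assumes C: "commuting_ss_subspace scale br V C" and V: "subspace V" and s: "s \<in> V" "semisimple_elt scale br s"
    and comm: "\<And>c. c \<in> C \<Longrightarrow> br s c = 0"
  shows "commuting_ss_subspace scale br V (span (insert s C))"
proof -
  have C': "subspace C" "C \<subseteq> V" "\<And>x. x \<in> C \<Longrightarrow> semisimple_elt scale br x" "\<And>x y. x \<in> C \<Longrightarrow> y \<in> C \<Longrightarrow> br x y = 0"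
    using C by (auto simp: commuting_ss_subspace_def)
  have dec: "\<exists>c\<in>C. \<exists>t. x = c + t *s s" if x: "x \<in> span (insert s C)" for x
  proof -
    have sC: "span C = C" using C'(1) by simp
    obtain t where "x - t *s s \<in> C" using x span_breakdown_eq[of x s C] unfolding sC by blast
    then show ?thesis by (intro bexI[of _ "x - t *s s"] exI[of _ t]) simp_all
  qed
  have cs: "br c s = 0" if "c \<in> C" for c using comm[OF that] br_zero_sym by blast
  have "semisimple_elt scale br x" if x: "x \<in> span (insert s C)" for x
  proof -
    obtain c t where ct: "c \<in> C" "x = c + t *s s" using dec[OF x] by blast
    show ?thesis unfolding ct(2)
      using C'(3)[OF ct(1)] semisimple_scale[OF s(2)] cs[OF ct(1)]
      by (intro semisimple_add) (simp_all add: br_scale_right)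
  qed
  moreover have "br x y = 0" if xy: "x \<in> span (insert s C)" "y \<in> span (insert s C)" for x y
  proof -
    obtain c t c' t' where ct: "c \<in> C" "x = c + t *s s" "c' \<in> C" "y = c' + t' *s s"
      using dec[OF xy(1)] dec[OF xy(2)] by blast
    then show ?thesis using C'(4) cs comm
      by (simp add: br_add_left br_add_right br_scale_left br_scale_right br_self)
  qed
  moreover have "span (insert s C) \<subseteq> V" using s(1) C'(2) V by (intro span_minimal) auto
  ultimately show ?thesis by (simp add: commuting_ss_subspace_def)
qed

text \<open>For \<open>b\<close> different from \<open>- a\<close>, the operator
  \<open>br x + a\<close> is surjective on the \<open>b\<close>-space. Writing \<open>w\<close> as
  an image, invariance shifts the operator to \<open>- (br x - a)\<close> on \<open>v\<close>, which
  the induction handles.\<close>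

lemma kil_genE_orth:
  assumes "v \<in> genE (br x) a" "w \<in> genE (br x) b" "a + b \<noteq> 0"
  shows "kil v w = 0"
  using lin_br assms(1,2)
proof (induction arbitrary: w rule: genE_induct)
  case (step v)
  have "b \<noteq> - a" using assms(3) by auto
  then obtain w' where w': "w' \<in> genE (br x) b" "br x w' - (- a) *s w' = w"
    using genE_shift_surj[OF lin_br step.prems] by blast
  have "kil v (br x w') = - kil (br x v) w'"
    using kil_invariant[of v x w'] br_anti[of v x] by (simp add: kil_neg)
  then have "kil v w = - kil (br x v - a *s v) w'"
    unfolding w'(2)[symmetric] by (simp add: kil_diff kil_neg kil_scale_left kil_scale_right kil_add_right)
  then show ?case using step.IH[OF w'(1)] by simp
qed (simp add: kil_zero)

lemma kil_sum_right: "kil v (sum f A) = (\<Sum>a\<in>A. kil v (f a))"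
  by (induction A rule: infinite_finite_induct) (simp_all add: kil_zero kil_add_right)

text \<open>The zero weight space is orthogonal to all other weight spaces, so the restricted form
  inherits nondegeneracy.\<close>

lemma kil_nondegenerate_genE0:
  assumes v: "v \<in> genE (br x) 0" and "\<And>w. w \<in> genE (br x) 0 \<Longrightarrow> kil v w = 0"
  shows "v = 0"
proof (rule kil_nondegenerate)
  fix w
  have "kil v (gproj (br x) c w) = 0" for c
    using assms(2) kil_genE_orth[OF v] gproj_in[OF lin_br, of x c w] by (cases "c = 0") auto
  then have "kil v (\<Sum>c\<in>spec (br x). gproj (br x) c w) = 0" by (simp add: kil_sum_right)
  then show "kil v w = 0" by (simp add: sum_gproj[OF lin_br])
qed

text \<open>A product of commuting operators, one of them nilpotent, is nilpotent and so
  traceless.\<close>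

lemma kil_nilp_commuting:
  assumes n: "nilp (br n)" and nc: "br n c = 0"
  shows "kil n c = 0"
proof -
  obtain k where k: "\<And>v. (br n ^^ k) v = 0" using nilp_uniform[OF lin_br n] by blast
  let ?f = "\<lambda>v. br n (br c v)"
  have pc: "(br n ^^ j) (br c v) = br c ((br n ^^ j) v)" for j v
    by (induction j) (simp_all add: br_commute[OF nc])
  have "(?f ^^ j) v = (br n ^^ j) ((br c ^^ j) v)" for j v
  proof (induction j)
    case (Suc j)
    then show ?case by (simp add: pc)
  qed simp
  then have "(?f ^^ k) v = 0" for v using k by simp
  then show ?thesis unfolding kil_def by (rule tr_nilpotent_pow[OF lin_comp[OF lin_br lin_br]])
qed

subsection \<open>Jordan decomposition and involutions\<close>

definition invol :: "('v \<Rightarrow> 'v) \<Rightarrow> bool" where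
  "invol \<sigma> \<longleftrightarrow> lin \<sigma> \<and> (\<forall>x y. \<sigma> (br x y) = br (\<sigma> x) (\<sigma> y)) \<and> (\<forall>x. \<sigma> (\<sigma> x) = x)"

lemma
  assumes "invol \<sigma>"
  shows invol_lin: "lin \<sigma>" and invol_br: "\<sigma> (br x y) = br (\<sigma> x) (\<sigma> y)" and invol_invol: "\<sigma> (\<sigma> x) = x"
  using assms by (auto simp: invol_def)

lemma kil_invol: assumes s: "invol \<sigma>" shows "kil (\<sigma> x) (\<sigma> y) = kil x y"
proof -
  have "br (\<sigma> x) v = \<sigma> (br x (\<sigma> v))" for x v by (simp add: invol_br[OF s] invol_invol[OF s])
  then have "kil (\<sigma> x) (\<sigma> y) = tr (\<lambda>v. \<sigma> (br x (br y (\<sigma> v))))"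
    by (simp add: kil_def invol_invol[OF s])
  also have "\<dots> = tr (\<lambda>v. br x (br y (\<sigma> (\<sigma> v))))"
    using tr_comm[OF invol_lin[OF s], of "\<lambda>v. br x (br y (\<sigma> v))"] lin_comp[OF lin_br lin_comp[OF lin_br invol_lin[OF s]]]
    by simp
  finally show ?thesis by (simp add: invol_invol[OF s] kil_def)
qed

text \<open>As \<open>\<sigma>\<close> negates \<open>y\<close>, it intertwines \<open>br y\<close>
  with \<open>- br y\<close>.\<close>

lemma invol_genE:
  assumes s: "invol \<sigma>" and y: "\<sigma> y = - y" and v: "v \<in> genE (br y) c"
  shows "\<sigma> v \<in> genE (br y) (- c)"
  using lin_br v
proof (induction rule: genE_induct)
  case zero
  show ?case using subspace_0[OF subspace_genE[OF lin_br]] by (simp add: lin_zero[OF invol_lin[OF s]])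
next
  case (step v)
  have "\<sigma> (br y v - c *s v) = - (br y (\<sigma> v) - (- c) *s \<sigma> v)"
    by (simp add: lin_diff[OF invol_lin[OF s]] lin_scale[OF invol_lin[OF s]] invol_br[OF s] y br_neg_left)
  then have "br y (\<sigma> v) - (- c) *s \<sigma> v = - \<sigma> (br y v - c *s v)" by simp
  then have "br y (\<sigma> v) - (- c) *s \<sigma> v \<in> genE (br y) (- c)"
    using subspace_neg[OF subspace_genE[OF lin_br] step.IH] by simp
  then show ?case by (rule genE_shiftI)
qed

text \<open>\<open>s\<close> acts on each generalised eigenspace of \<open>ad y\<close> as the
  eigenvalue, so it inherits what respects these spaces: elements commuting with \<open>y\<close>
  preserve them, and an involution negating \<open>y\<close> swaps those for \<open>c\<close> and
  \<open>- c\<close>. Injectivity of \<open>ad\<close> then gives identities between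
  elements.\<close>

lemma jordan_decomposition:
  obtains s where "semisimple_elt scale br s" "nilp (br (y - s))"
    "\<And>z. br z y = 0 \<Longrightarrow> br z s = 0"
    "\<And>\<sigma>. invol \<sigma> \<Longrightarrow> \<sigma> y = - y \<Longrightarrow> \<sigma> s = - s"
proof -
  obtain s where s: "\<And>c v. v \<in> genE (br y) c \<Longrightarrow> br s v = c *s v"
    using element_of_eigenvalue_map[of "\<lambda>c. c" y] by metis
  show thesis
  proof (rule that[of s])
    have "(\<Union>c. genE (br y) c) \<subseteq> {v. \<exists>c. br s v = c *s v}" using s by blast
    then show "semisimple_elt scale br s"
      unfolding semisimple_elt_def using span_genE[OF lin_br] by (rule span_UNIV_mono)
  next
    let ?N = "{v. \<exists>k. (br (y - s) ^^ k) v = 0}"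
    have "v \<in> ?N" if v: "v \<in> genE (br y) c" for v c
    proof -
      let ?f = "\<lambda>v. br y v - c *s v"
      have "(br (y - s) ^^ k) v = (?f ^^ k) v \<and> (?f ^^ k) v \<in> genE (br y) c" for k
      proof (induction k)
        case (Suc k)
        then have "?f ((?f ^^ k) v) \<in> genE (br y) c"
          by (intro subspace_diff subspace_scale subspace_genE genE_invariant lin_br) auto
        then show ?case using Suc s by (simp add: br_diff_left)
      qed (simp add: v)
      then show ?thesis using v by (auto simp: genE_def)
    qed
    then have "span (\<Union>c. genE (br y) c) \<subseteq> ?N"
      by (intro span_minimal subspace_locally_nilpotent lin_br) blast
    then show "nilp (br (y - s))" unfolding nilp_def using span_genE[OF lin_br] by blast
  next
    fix z assume z: "br z y = 0"
    then have yz: "br y (br z v) = br z (br y v)" for v using br_commute by simp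
    have "br (br z s) = (\<lambda>_. 0)"
    proof (rule lin_eq_on_genE[OF lin_br[of y] lin_br])
      fix c v assume v: "v \<in> genE (br y) c"
      then have "br z v \<in> genE (br y) c" using genE_commute[OF lin_br, of "br y"] yz by blast
      then show "br (br z s) v = 0" using s v by (simp add: jacobi br_scale_right)
    qed (simp add: lin_iff)
    then show "br z s = 0" using ad_injective[of "br z s" 0] by (simp add: br_zero)
  next
    fix \<sigma> assume \<sigma>: "invol \<sigma>" "\<sigma> y = - y"
    have "br (\<sigma> s) = br (- s)"
    proof (rule lin_eq_on_genE[OF lin_br[of y] lin_br lin_br])
      fix c v assume v: "v \<in> genE (br y) c"
      have "br (\<sigma> s) v = \<sigma> (br s (\<sigma> v))" by (simp add: invol_br[OF \<sigma>(1)] invol_invol[OF \<sigma>(1)])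
      also have "br s (\<sigma> v) = (- c) *s \<sigma> v" using s invol_genE[OF \<sigma> v] by blast
      also have "\<sigma> \<dots> = (- c) *s v" by (simp only: lin_scale[OF invol_lin[OF \<sigma>(1)]] invol_invol[OF \<sigma>(1)])
      finally show "br (\<sigma> s) v = br (- s) v" using s[OF v] by (simp add: br_neg_left)
    qed
    from fun_cong[OF this] show "\<sigma> s = - s" by (rule ad_injective)
  qed
qed

text \<open>Let \<open>m\<close> be the centralizer of \<open>C\<close> in the common eigenspace.
  Modulo \<open>C\<close> each element of \<open>m\<close> is nilpotent; nilpotent elements of
  \<open>m\<close> are orthogonal to \<open>C\<close> and to each other, and the form is
  nondegenerate on \<open>m\<close>. Taking \<open>\<tau> = \<sigma>\<close> covers the eigenspace
  of a single involution.\<close>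

lemma cartan_subspace_self_centralizing:
  assumes \<sigma>: "invol \<sigma>" and \<tau>: "invol \<tau>" and st: "\<And>x. \<sigma> (\<tau> x) = \<tau> (\<sigma> x)"
    and cart: "cartan_subspace scale br {x. \<sigma> x = - x \<and> \<tau> x = - x} C"
    and y: "\<sigma> y = - y" "\<tau> y = - y" "y \<in> centralizer C"
  shows "y \<in> C"
proof -
  let ?V = "{x. \<sigma> x = - x \<and> \<tau> x = - x}"
  define m where "m = ?V \<inter> centralizer C"
  note l\<sigma> = invol_lin[OF \<sigma>] and l\<tau> = invol_lin[OF \<tau>]
  have V: "subspace ?V"
    by (rule subspaceI) (auto simp: lin_zero[OF l\<sigma>] lin_zero[OF l\<tau>] lin_add[OF l\<sigma>] lin_add[OF l\<tau>]
        lin_scale[OF l\<sigma>] lin_scale[OF l\<tau>])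
  have C: "commuting_ss_subspace scale br ?V C"
    and max: "\<And>C'. commuting_ss_subspace scale br ?V C' \<Longrightarrow> C \<subseteq> C' \<Longrightarrow> C' = C"
    using cart by (auto simp: cartan_subspace_def)
  have C': "C \<subseteq> ?V" "\<And>x y. x \<in> C \<Longrightarrow> y \<in> C \<Longrightarrow> br x y = 0" using C by (auto simp: commuting_ss_subspace_def)
  have Cm: "C \<subseteq> m" using C' unfolding m_def centralizer_def by blast
  have sm: "subspace m" unfolding m_def by (intro subspace_inter V subspace_centralizer)
  have comm: "br u c = 0" if "u \<in> m" "c \<in> C" for u c using that by (auto simp: m_def centralizer_def)
  \<comment> \<open>The semisimple part of \<open>u\<close> is negated by both involutions and
    commutes with \<open>C\<close>, so adjoining it to \<open>C\<close> cannot enlarge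
    \<open>C\<close>.\<close>
  have dec: "\<exists>c\<in>C. u - c \<in> m \<and> nilp (br (u - c))" if u: "u \<in> m" for u
  proof -
    obtain s where s: "semisimple_elt scale br s" "nilp (br (u - s))" "\<And>z. br z u = 0 \<Longrightarrow> br z s = 0"
      "\<And>\<sigma>. invol \<sigma> \<Longrightarrow> \<sigma> u = - u \<Longrightarrow> \<sigma> s = - s" using jordan_decomposition by metis
    have sV: "s \<in> ?V" using s(4)[OF \<sigma>] s(4)[OF \<tau>] u by (simp add: m_def)
    have "br s c = 0" if "c \<in> C" for c using comm[OF u that] s(3)[of c] br_zero_sym by blast
    then have "commuting_ss_subspace scale br ?V (span (insert s C))"
      by (intro commuting_ss_insert C V sV s(1))
    then have "span (insert s C) = C" using max span_superset by blast
    then have "s \<in> C" using span_base[of s "insert s C"] by auto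
    then show ?thesis using s(2) Cm sm u by (intro bexI[of _ s] conjI subspace_diff) auto
  qed
  \<comment> \<open>The form is nondegenerate on the whole centralizer of \<open>C\<close>. An
    element \<open>w\<close> of it is moved into \<open>m\<close> by subtracting its image under
    \<open>\<sigma>\<close>, then the same with \<open>\<tau>\<close>; each move doubles the pairing
    with \<open>u\<close>.\<close>
  have nondeg: "u = 0" if u: "u \<in> m" "\<And>w. w \<in> m \<Longrightarrow> kil u w = 0" for u
  proof -
    obtain h where h: "genE (br h) 0 = centralizer C" using generic_centralizer[OF C] by blast
    show ?thesis
    proof (rule kil_nondegenerate_genE0[of u h])
      show "u \<in> genE (br h) 0" using u(1) h by (simp add: m_def)
      fix w assume "w \<in> genE (br h) 0"
      then have w: "\<And>c. c \<in> C \<Longrightarrow> br w c = 0" using h by (auto simp: centralizer_def)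
      have half: "w1 - \<rho> w1 \<in> centralizer C \<and> kil u (w1 - \<rho> w1) = 2 * kil u w1 \<and> \<rho> (w1 - \<rho> w1) = - (w1 - \<rho> w1)"
        if \<rho>: "invol \<rho>" and r: "\<And>x. x \<in> ?V \<Longrightarrow> \<rho> x = - x" and w1: "\<And>c. c \<in> C \<Longrightarrow> br w1 c = 0" for \<rho> w1
      proof (intro conjI)
        have "br (\<rho> w1) c = 0" if "c \<in> C" for c
        proof -
          have "br (\<rho> w1) c = \<rho> (br w1 (\<rho> c))" by (simp add: invol_br[OF \<rho>] invol_invol[OF \<rho>])
          also have "\<rho> c = - c" using r C'(1) that by blast
          finally show ?thesis using w1[OF that] by (simp add: br_neg_right lin_zero[OF invol_lin[OF \<rho>]])
        qed
        then show "w1 - \<rho> w1 \<in> centralizer C" using w1 by (simp add: centralizer_def br_diff_left)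
        have "\<rho> u = - u" using r u(1) by (simp add: m_def)
        then have "kil u (\<rho> w1) = - kil u w1" using kil_invol[OF \<rho>, of u w1] by (simp add: kil_neg)
            (metis minus_equation_iff)
        then show "kil u (w1 - \<rho> w1) = 2 * kil u w1" by (simp add: kil_diff)
        show "\<rho> (w1 - \<rho> w1) = - (w1 - \<rho> w1)" by (simp add: lin_diff[OF invol_lin[OF \<rho>]] invol_invol[OF \<rho>])
      qed
      define w1 where "w1 = w - \<sigma> w"
      define w2 where "w2 = w1 - \<tau> w1"
      have w1: "w1 \<in> centralizer C" "kil u w1 = 2 * kil u w" "\<sigma> w1 = - w1"
        using half[OF \<sigma> _ w] by (auto simp: w1_def)
      have w2: "w2 \<in> centralizer C" "kil u w2 = 2 * kil u w1" "\<tau> w2 = - w2"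
        using half[OF \<tau> _, of w1] w1(1) by (auto simp: w2_def centralizer_def)
      have "\<sigma> w2 = - w2" by (simp add: w2_def lin_diff[OF l\<sigma>] st w1(3) lin_neg[OF l\<tau>])
      then have "w2 \<in> m" using w2 by (simp add: m_def)
      then show "kil u w = 0" using u(2) w1(2) w2(2) by simp
    qed
  qed
  have nC: "kil n c = 0" if "n \<in> m" "nilp (br n)" "c \<in> C" for n c
    using kil_nilp_commuting[OF that(2) comm[OF that(1,3)]] .
  have C0: "c = 0" if c: "c \<in> C" "\<And>c'. c' \<in> C \<Longrightarrow> kil c c' = 0" for c
  proof (rule nondeg)
    show "c \<in> m" using c(1) Cm by blast
    fix w assume "w \<in> m"
    then obtain c' where c': "c' \<in> C" "w - c' \<in> m" "nilp (br (w - c'))" using dec by blast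
    have "kil c w = kil c c' + kil (w - c') c" using kil_diff(2)[of c w c'] kil_sym by simp
    then show "kil c w = 0" using c(2)[OF c'(1)] nC[OF c'(2,3) c(1)] by simp
  qed
  \<comment> \<open>Polarisation needs \<open>p + q\<close> to be nilpotent. The
    \<open>C\<close>-component of \<open>p + q\<close> is orthogonal to \<open>C\<close>, and the
    form is nondegenerate on \<open>C\<close> by \<open>C0\<close>, so this component is
    zero.\<close>
  have nn: "kil p q = 0" if p: "p \<in> m" "nilp (br p)" and q: "q \<in> m" "nilp (br q)" for p q
  proof -
    have "p + q \<in> m" using p q by (intro subspace_add sm)
    then obtain c where c: "c \<in> C" "p + q - c \<in> m" "nilp (br (p + q - c))" using dec by blast
    have "kil c c' = 0" if "c' \<in> C" for c'
    proof -
      have "kil (p + q - c) c' = kil p c' + kil q c' - kil c c'" by (simp add: kil_diff kil_add_left)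
      then show ?thesis using nC p q c that by simp
    qed
    then have "c = 0" using C0 c(1) by blast
    then have "kil (p + q) (p + q) = 0" using c(3) kil_nilp_commuting br_self by simp
    moreover have "kil p p = 0" "kil q q = 0" using kil_nilp_commuting br_self p q by auto
    ultimately show ?thesis by (simp add: kil_add_left kil_add_right kil_sym[of q p])
  qed
  have ym: "y \<in> m" using y by (simp add: m_def)
  then obtain c where c: "c \<in> C" "y - c \<in> m" "nilp (br (y - c))" using dec by blast
  have "y - c = 0"
  proof (rule nondeg[OF c(2)])
    fix w assume "w \<in> m"
    then obtain c' where c': "c' \<in> C" "w - c' \<in> m" "nilp (br (w - c'))" using dec by blast
    have "kil (y - c) w = kil (y - c) c' + kil (y - c) (w - c')" by (simp flip: kil_add_right)
    then show "kil (y - c) w = 0" using nC[OF c(2,3) c'(1)] nn[OF c(2,3) c'(2,3)] by simp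
  qed
  then show ?thesis using c(1) by simp
qed

end

section \<open>Dimension counts for sums, kernels and orthogonal subspaces\<close>

context acl_vector_space
begin

lemma neg_self_zero:
  fixes v :: 'v
  assumes "v = - v" shows "v = 0"
proof -
  have "(2::'k) *s v = v + v" using scale_left_distrib[of 1 1 v] by simp
  also have "\<dots> = 0" using assms by (simp add: eq_neg_iff_add_eq_0)
  finally show ?thesis by simp
qed

lemma fixed_inter_negated: "{v::'v. f v = v} \<inter> {v. f v = - v} \<subseteq> {0}"
proof
  fix v assume "v \<in> {v. f v = v} \<inter> {v. f v = - v}"
  then have "f v = v" "f v = - v" by blast+
  then have "v = - v" by (rule subst)
  then show "v \<in> {0}" using neg_self_zero by blast
qed

lemma dim_direct_sum:
  assumes "subspace S" "subspace T" "S \<inter> T \<subseteq> {0}"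
  shows "dim {x + y | x y. x \<in> S \<and> y \<in> T} = dim S + dim T"
proof -
  have "dim (S \<inter> T) = 0" using assms(3) by simp
  then show ?thesis using dim_sums_Int[OF assms(1,2)] by linarith
qed

lemma dim_sum_le:
  assumes "subspace S" "subspace T"
  shows "dim {x + y | x y. x \<in> S \<and> y \<in> T} \<le> dim S + dim T"
  using dim_sums_Int[OF assms] by linarith

text \<open>With a linear section \<open>g\<close> of \<open>f\<close> over the image of
  \<open>S\<close>, each \<open>v\<close> in \<open>S\<close> is \<open>g (f v)\<close> plus an
  element of the kernel.\<close>

lemma rank_nullity_le:
  assumes f: "lin f" and S: "subspace S"
  shows "dim S \<le> dim (f ` S) + dim {v \<in> S. f v = 0}"
proof -
  obtain g where g: "range g \<subseteq> S" "lin g" "\<And>v. v \<in> f ` S \<Longrightarrow> f (g v) = v"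
    using vp.linear_exists_right_inverse_on[OF f S] by auto
  let ?K = "{v \<in> S. f v = 0}"
  have K: "subspace ?K"
    using subspace_inter[OF S vp.linear_subspace_kernel[OF f]] by (simp add: Int_def)
  have gfS: "subspace (g ` f ` S)" by (intro vp.linear_subspace_image f g(2) S)
  have "S \<subseteq> {x + y | x y. x \<in> g ` f ` S \<and> y \<in> ?K}"
  proof
    fix v assume v: "v \<in> S"
    have "v - g (f v) \<in> ?K" using v g by (auto intro!: subspace_diff S simp: lin_diff[OF f])
    then show "v \<in> {x + y | x y. x \<in> g ` f ` S \<and> y \<in> ?K}"
      using v by (intro CollectI exI[of _ "g (f v)"] exI[of _ "v - g (f v)"]) auto
  qed
  then have "dim S \<le> dim {x + y | x y. x \<in> g ` f ` S \<and> y \<in> ?K}" by (rule dim_subset)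
  also have "\<dots> \<le> dim (g ` f ` S) + dim ?K" by (rule dim_sum_le[OF gfS K])
  also have "dim (g ` f ` S) \<le> dim (f ` S)" by (rule vp.dim_image_le[OF g(2)])
  finally show ?thesis by simp
qed

end

context semisimple_lie_algebra
begin

text \<open>In a basis extending one of \<open>W\<close>, the vector \<open>?T u\<close> of pairings
  has no coordinates along \<open>W\<close>. So the injective map \<open>?T\<close> embeds
  \<open>U\<close> into the span of the remaining basis vectors.\<close>

lemma dim_orthogonal_le:
  assumes U: "subspace U" and W: "subspace W" and orth: "\<And>u w. u \<in> U \<Longrightarrow> w \<in> W \<Longrightarrow> kil u w = 0"
  shows "dim U + dim W \<le> dim UNIV"
proof -
  obtain BW where BW: "BW \<subseteq> W" "independent BW" "W \<subseteq> span BW" "card BW = dim W"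
    using basis_exists by metis
  define B where "B = extend_basis BW"
  have B: "independent B" "span B = UNIV" "BW \<subseteq> B"
    using BW(2) independent_extend_basis span_extend_basis extend_basis_superset by (auto simp: B_def)
  have fB: "finite B" using B finiteI_independent by auto
  have cB: "card B = dim UNIV" using dim_eq_card[of B UNIV] B by simp
  let ?T = "\<lambda>x. \<Sum>b\<in>B. kil x b *s b"
  have lT: "lin ?T"
    by (rule linI) (simp_all add: kil_add_left kil_scale_left scale_left_distrib sum.distrib scale_sum_right)
  have inj: "inj ?T"
  proof (subst vp.linear_inj_iff_eq_0[OF lT], intro allI impI)
    fix x assume "?T x = 0"
    then have "B \<subseteq> {y. \<forall>z\<in>{x}. kil y z = 0}"
      using independentD[OF B(1) fB, of "\<lambda>b. kil x b"] by (auto simp: kil_sym[of _ x])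
    then have "span B \<subseteq> {y. \<forall>z\<in>{x}. kil y z = 0}" by (intro span_minimal subspace_kil_orth)
    then show "x = 0" using B(2) kil_sym by (intro kil_nondegenerate) auto
  qed
  have "?T ` U \<subseteq> span (B - BW)"
  proof clarify
    fix u assume u: "u \<in> U"
    have "?T u = (\<Sum>b\<in>B - BW. kil u b *s b)"
      using orth[OF u] BW(1) fB by (intro sum.mono_neutral_right) auto
    moreover have "(\<Sum>b\<in>B - BW. kil u b *s b) \<in> span (B - BW)"
      by (intro span_sum span_scale span_base)
    ultimately show "?T u \<in> span (B - BW)" by simp
  qed
  then have "dim (?T ` U) \<le> card (B - BW)" using fB by (intro dim_le_card) auto
  moreover have "dim (?T ` U) = dim U" by (rule vp.dim_image_eq[OF lT inj_on_subset[OF inj]]) simp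
  moreover have "card (B - BW) = card B - card BW" "card BW \<le> card B"
    using B(3) fB finite_subset[OF B(3) fB] by (auto simp: card_Diff_subset card_mono)
  ultimately show ?thesis using cB BW(4) by linarith
qed

subsection \<open>Integral gradings\<close>

text \<open>The sum of the graded pieces with degree in \<open>I\<close>. With integral spectrum,
  \<open>{0..}\<close> plays the role of a parabolic subalgebra and \<open>{1..}\<close> that of its
  nilradical.\<close>

definition part :: "'v \<Rightarrow> int set \<Rightarrow> 'v set" where
  "part z I = span (\<Union>i\<in>I. genE (br z) (of_int i))"

lemma subspace_part: "subspace (part z I)"
  by (simp add: part_def)

lemma part_base: "v \<in> genE (br z) (of_int i) \<Longrightarrow> i \<in> I \<Longrightarrow> v \<in> part z I"
  unfolding part_def by (intro span_base) auto

lemma part_leI: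
  assumes "subspace S" "\<And>i v. i \<in> I \<Longrightarrow> v \<in> genE (br z) (of_int i) \<Longrightarrow> v \<in> S"
  shows "part z I \<subseteq> S"
  unfolding part_def using assms by (intro span_minimal) auto

lemma part_single: "part z {i} = genE (br z) (of_int i)"
  unfolding part_def using subspace_genE[OF lin_br] by simp

lemma part_mono: "I \<subseteq> J \<Longrightarrow> part z I \<subseteq> part z J"
  unfolding part_def by (intro span_mono) auto

lemma part_mono_spec:
  assumes "\<And>i. i \<in> I \<Longrightarrow> i \<notin> J \<Longrightarrow> of_int i \<notin> spec (br z)"
  shows "part z I \<subseteq> part z J"
proof (rule part_leI[OF subspace_part])
  fix i v assume iv: "i \<in> I" "v \<in> genE (br z) (of_int i)"
  show "v \<in> part z J"
  proof (cases "i \<in> J")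
    case False
    then have "v = 0" using assms[OF iv(1)] iv(2) by (auto simp: spec_def)
    then show ?thesis using subspace_0[OF subspace_part] by simp
  qed (use iv part_base in blast)
qed

lemma part_Un: "part z (I \<union> J) = {x + y | x y. x \<in> part z I \<and> y \<in> part z J}"
  unfolding part_def UN_Un by (rule span_Un)

lemma part_gproj_zero:
  assumes "v \<in> part z I" "c \<notin> of_int ` I" shows "gproj (br z) c v = 0"
proof -
  have "part z I \<subseteq> {v. gproj (br z) c v = 0}"
    using assms(2) gproj_other[OF lin_br, of _ z _ c]
    by (intro part_leI vp.linear_subspace_kernel lin_gproj lin_br) auto
  with assms(1) show ?thesis by blast
qed

lemma part_disjoint:
  assumes "I \<inter> J = {}" shows "part z I \<inter> part z J \<subseteq> {0}"
proof
  fix v assume v: "v \<in> part z I \<inter> part z J"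
  have "gproj (br z) c v = 0" for c
  proof -
    have "c \<notin> of_int ` I \<or> c \<notin> of_int ` J" using assms by auto
    then show ?thesis using v part_gproj_zero by blast
  qed
  then show "v \<in> {0}" using gproj_zero_imp_zero[OF lin_br] by blast
qed

lemma dim_part_Un: "I \<inter> J = {} \<Longrightarrow> dim (part z (I \<union> J)) = dim (part z I) + dim (part z J)"
  unfolding part_Un by (intro dim_direct_sum subspace_part part_disjoint)

lemma part_UNIV:
  assumes "spec (br z) \<subseteq> \<int>" shows "part z UNIV = UNIV"
proof -
  have "(\<Union>c. genE (br z) c) \<subseteq> part z UNIV"
  proof clarify
    fix v c assume v: "v \<in> genE (br z) c"
    show "v \<in> part z UNIV"
    proof (cases "c \<in> spec (br z)")
      case True
      then obtain i where "c = of_int i" using assms Ints_cases by blast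
      then show ?thesis using v part_base by blast
    next
      case False
      then have "v = 0" using v by (auto simp: spec_def)
      then show ?thesis using subspace_0[OF subspace_part] by simp
    qed
  qed
  then have "span (\<Union>c. genE (br z) c) \<subseteq> part z UNIV" by (rule span_minimal[OF _ subspace_part])
  then show ?thesis using span_genE[OF lin_br] by auto
qed

lemma part_br:
  assumes "v \<in> part z I" "w \<in> part z J" "\<And>i j. i \<in> I \<Longrightarrow> j \<in> J \<Longrightarrow> i + j \<in> K"
  shows "br v w \<in> part z K"
proof -
  have 1: "br v w \<in> part z K" if "i \<in> I" "v \<in> genE (br z) (of_int i)" "w \<in> part z J" for i v w
  proof -
    have "part z J \<subseteq> {w. br v w \<in> part z K}"
    proof (rule part_leI)
      show "subspace {w. br v w \<in> part z K}"
        using vp.linear_subspace_vimage[OF lin_br subspace_part] by (simp add: vimage_def)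
      fix j w assume "j \<in> J" "w \<in> genE (br z) (of_int j)"
      then show "w \<in> {w. br v w \<in> part z K}"
        using genE_br[OF derivation_br that(2)] assms(3)[OF that(1)] part_base[of "br v w" z "i + j" K] by simp
    qed
    with that(3) show ?thesis by blast
  qed
  have "part z I \<subseteq> {v. br v w \<in> part z K}"
  proof (rule part_leI)
    show "subspace {v. br v w \<in> part z K}"
      using vp.linear_subspace_vimage[OF lin_br_left subspace_part] by (simp add: vimage_def)
  qed (use 1 assms(2) in blast)
  with assms(1) show ?thesis by blast
qed

lemma part_orth:
  assumes "v \<in> part z I" "w \<in> part z J" "\<And>i j. i \<in> I \<Longrightarrow> j \<in> J \<Longrightarrow> i + j \<noteq> 0"
  shows "kil v w = 0"
proof -
  have 1: "kil w v = 0" if "i \<in> I" "v \<in> genE (br z) (of_int i)" "w \<in> part z J" for i v w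
  proof -
    have "part z J \<subseteq> {w. \<forall>u\<in>{v}. kil w u = 0}"
    proof (rule part_leI[OF subspace_kil_orth])
      fix j w assume jw: "j \<in> J" "w \<in> genE (br z) (of_int j)"
      have "of_int j + of_int i \<noteq> (0::'k)"
        using assms(3)[OF that(1) jw(1)] by (metis add.commute of_int_0_eq_iff of_int_add)
      then show "w \<in> {w. \<forall>u\<in>{v}. kil w u = 0}" using kil_genE_orth[OF jw(2) that(2)] by simp
    qed
    with that(3) show ?thesis by blast
  qed
  have "part z I \<subseteq> {v. \<forall>u\<in>{w}. kil v u = 0}"
    by (rule part_leI[OF subspace_kil_orth]) (use 1 assms(2) kil_sym in auto)
  with assms(1) show ?thesis by blast
qed

lemma part_bounded:
  assumes z: "spec (br z) \<subseteq> \<int>"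
  shows "\<exists>M. part z {M..} = {0} \<and> part z {-M..} = UNIV"
proof -
  let ?S = "{i::int. of_int i \<in> spec (br z)}"
  have "finite ?S"
    using finite_vimageI[OF finite_spec[OF lin_br], of "of_int :: int \<Rightarrow> 'k" z] by (simp add: vimage_def inj_on_def)
  \<comment> \<open>Inserting 0 keeps the set nonempty, and adding 1 makes the bound on the degrees
    strict.\<close>
  define M where "M = Max (insert 0 (abs ` ?S)) + 1"
  have M: "\<bar>i\<bar> < M" if "i \<in> ?S" for i
    unfolding M_def using \<open>finite ?S\<close> that by (intro zle_add1_eq_le[THEN iffD2] Max_ge) auto
  have "part z {M..} \<subseteq> part z {}" by (rule part_mono_spec) (use M in force)
  then have "part z {M..} = {0}" using subspace_0[OF subspace_part] by (auto simp: part_def)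
  moreover have "part z UNIV \<subseteq> part z {-M..}" by (rule part_mono_spec) (use M in force)
  ultimately show ?thesis using part_UNIV[OF z] by blast
qed

text \<open>Each application of \<open>br y\<close> raises the degree bound by one. Starting at
  \<open>-M\<close>, after \<open>2 * M\<close> applications it has reached \<open>M\<close>, where
  nothing is left.\<close>

lemma nilp_part_positive:
  assumes z: "spec (br z) \<subseteq> \<int>" and y: "y \<in> part z {1..}"
  shows "nilp (br y)"
proof -
  obtain M where M: "part z {M..} = {0}" "part z {-M..} = UNIV" using part_bounded[OF z] by blast
  have pow: "(br y ^^ k) v \<in> part z {-M + int k..}" for k v
  proof (induction k)
    case 0
    show ?case using M(2) by simp
  next
    case (Suc k)
    have "br y ((br y ^^ k) v) \<in> part z {-M + int (Suc k)..}"
      by (rule part_br[OF y Suc]) simp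
    then show ?case by simp
  qed
  have "(br y ^^ nat (2 * M)) v = 0" for v
  proof -
    have "part z {-M + int (nat (2 * M))..} \<subseteq> part z {M..}" by (rule part_mono) auto
    then show ?thesis using pow[of "nat (2 * M)" v] M(1) by blast
  qed
  then show ?thesis unfolding nilp_def by blast
qed

lemma part_nonneg_decompose:
  assumes "y \<in> part z {0..}"
  shows "y - gproj (br z) 0 y \<in> part z {1..}"
proof -
  have "{0::int..} = {0} \<union> {1..}" by auto
  then have "y \<in> part z ({0} \<union> {1..})" using assms by simp
  then obtain a b where ab: "y = a + b" "a \<in> part z {0}" "b \<in> part z {1..}" unfolding part_Un by blast
  have "gproj (br z) 0 b = 0" by (rule part_gproj_zero[OF ab(3)]) auto
  moreover have "gproj (br z) 0 a = a" using ab(2) gproj_same[OF lin_br] by (simp add: part_single)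
  ultimately show ?thesis using ab by (simp add: lin_add[OF lin_gproj[OF lin_br]])
qed

text \<open>On a homogeneous vector, the powers of \<open>br y\<close> and of \<open>br\<close> of
  its degree zero component differ only in higher degrees. When the former vanish, so do the leading
  terms.\<close>

lemma nilp_degree_zero_component:
  assumes z: "spec (br z) \<subseteq> \<int>" and y: "y \<in> part z {0..}" "nilp (br y)"
  shows "nilp (br (gproj (br z) 0 y))"
proof -
  define y0 where "y0 = gproj (br z) 0 y"
  define y1 where "y1 = y - y0"
  have y1: "y1 \<in> part z {1..}" unfolding y1_def y0_def by (rule part_nonneg_decompose[OF y(1)])
  have y0: "y0 \<in> part z {0}" using gproj_in[OF lin_br] by (simp add: y0_def part_single)
  have yy: "y = y0 + y1" by (simp add: y1_def)
  obtain K where K: "\<And>v. (br y ^^ K) v = 0" using nilp_uniform[OF lin_br y(2)] by blast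
  have "(br y0 ^^ K) v = 0" if v: "v \<in> part z {i}" for v i
  proof -
    have "(br y0 ^^ k) v \<in> part z {i} \<and> (br y ^^ k) v - (br y0 ^^ k) v \<in> part z {i + 1..}" for k
    proof (induction k)
      case 0
      show ?case using v subspace_0[OF subspace_part] by simp
    next
      case (Suc k)
      let ?a = "(br y0 ^^ k) v" and ?r = "(br y ^^ k) v - (br y0 ^^ k) v"
      have 1: "br y0 ?a \<in> part z {i}" by (rule part_br[OF y0 conjunct1[OF Suc]]) simp
      have 2: "br y1 ?a \<in> part z {i + 1..}" by (rule part_br[OF y1 conjunct1[OF Suc]]) simp
      have 3: "br y ?r \<in> part z {i + 1..}" by (rule part_br[OF y(1) conjunct2[OF Suc]]) simp
      have "br y ((br y ^^ k) v) - br y0 ?a = br y1 ?a + br y ?r"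
        by (simp add: yy br_add_left br_diff_right)
      then have "br y ((br y ^^ k) v) - br y0 ?a \<in> part z {i + 1..}"
        using subspace_add[OF subspace_part 2 3] by simp
      with 1 show ?case by simp
    qed
    from this[of K] have "(br y0 ^^ K) v \<in> part z {i}" "- (br y0 ^^ K) v \<in> part z {i + 1..}"
      using K by auto
    then have "(br y0 ^^ K) v \<in> part z {i} \<inter> part z {i + 1..}"
      using subspace_neg[OF subspace_part, of "- (br y0 ^^ K) v"] by simp
    then show ?thesis using part_disjoint[of "{i}" "{i + 1..}" z] by auto
  qed
  then have "part z UNIV \<subseteq> {v. \<exists>k. (br y0 ^^ k) v = 0}"
    by (intro part_leI subspace_locally_nilpotent lin_br) (auto simp: part_single)
  then show ?thesis unfolding nilp_def y0_def[symmetric] using part_UNIV[OF z] by blast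
qed

text \<open>The parts \<open>{..-1}\<close> and \<open>{..0}\<close> are orthogonal, so their
  dimensions add up to at most the total. Hence the negative part is no larger than the positive
  one.\<close>

lemma dim_part_nonneg:
  assumes z: "spec (br z) \<subseteq> \<int>"
  shows "dim UNIV + dim (genE (br z) 0) \<le> 2 * dim (part z {0..})"
proof -
  have eqs: "{0::int..} = {0} \<union> {1..}" "UNIV = {0::int..} \<union> {..-1}" "UNIV = {..0::int} \<union> {1..}" by auto
  have 1: "dim (part z {0..}) = dim (genE (br z) 0) + dim (part z {1..})"
    using dim_part_Un[of "{0}" "{1..}" z] eqs(1) by (simp add: part_single)
  have 2: "dim UNIV = dim (part z {0..}) + dim (part z {..-1})"
    using dim_part_Un[of "{0..}" "{..-1}" z] eqs(2) part_UNIV[OF z] by (simp add: Int_def del: dim_UNIV)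
  have 3: "dim UNIV = dim (part z {..0}) + dim (part z {1..})"
    using dim_part_Un[of "{..0}" "{1..}" z] eqs(3) part_UNIV[OF z] by (simp add: Int_def del: dim_UNIV)
  have "dim (part z {..-1}) + dim (part z {..0}) \<le> dim UNIV"
    by (intro dim_orthogonal_le subspace_part part_orth[of _ z "{..-1}" _ "{..0}"]) auto
  with 1 2 3 show ?thesis by linarith
qed

text \<open>From above, \<open>?b \<inter> ?p\<close> is measured by projecting to degree zero for
  \<open>h\<close>, leaving \<open>?n \<inter> ?p\<close>, and then for \<open>x\<close>, leaving
  \<open>?n \<inter> ?u\<close>. From below, \<open>?b + ?p\<close> is orthogonal to
  \<open>?n \<inter> ?u\<close>. The unknown dimension of \<open>?n \<inter> ?u\<close>
  cancels.\<close>

lemma dim_centralizer_bound: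
  assumes h: "spec (br h) \<subseteq> \<int>" and x: "spec (br x) \<subseteq> \<int>"
  shows "dim (genE (br x) 0) \<le> dim (genE (br h) 0)
    + 2 * dim (gproj (br x) 0 ` (part h {1..} \<inter> part x {0..}))"
proof -
  let ?b = "part h {0..}" and ?n = "part h {1..}" and ?p = "part x {0..}" and ?u = "part x {1..}"
  let ?N = "gproj (br x) 0 ` (?n \<inter> ?p)"
  note sp = subspace_part
  have s1: "subspace (?b \<inter> ?p)" "subspace (?n \<inter> ?p)" "subspace (?n \<inter> ?u)"
    by (intro subspace_inter sp)+
  have "dim (?b \<inter> ?p) \<le> dim (gproj (br h) 0 ` (?b \<inter> ?p)) + dim {v \<in> ?b \<inter> ?p. gproj (br h) 0 v = 0}"
    by (rule rank_nullity_le[OF lin_gproj[OF lin_br] s1(1)])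
  also have "dim (gproj (br h) 0 ` (?b \<inter> ?p)) \<le> dim (genE (br h) 0)"
    using gproj_in[OF lin_br] by (intro dim_subset) auto
  also have "dim {v \<in> ?b \<inter> ?p. gproj (br h) 0 v = 0} \<le> dim (?n \<inter> ?p)"
    using part_nonneg_decompose[of _ h] by (intro dim_subset) force
  finally have 1: "dim (?b \<inter> ?p) \<le> dim (genE (br h) 0) + dim (?n \<inter> ?p)" by simp
  have "dim (?n \<inter> ?p) \<le> dim ?N + dim {v \<in> ?n \<inter> ?p. gproj (br x) 0 v = 0}"
    by (rule rank_nullity_le[OF lin_gproj[OF lin_br] s1(2)])
  also have "dim {v \<in> ?n \<inter> ?p. gproj (br x) 0 v = 0} \<le> dim (?n \<inter> ?u)"
    using part_nonneg_decompose[of _ x] by (intro dim_subset) force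
  finally have 2: "dim (?n \<inter> ?p) \<le> dim ?N + dim (?n \<inter> ?u)" by simp
  let ?bp = "{v + w | v w. v \<in> ?b \<and> w \<in> ?p}"
  have 3: "dim ?bp + dim (?b \<inter> ?p) = dim ?b + dim ?p" by (rule dim_sums_Int[OF sp sp])
  have 4: "dim ?bp + dim (?n \<inter> ?u) \<le> dim UNIV"
  proof (rule dim_orthogonal_le[OF subspace_sums[OF sp sp] s1(3)])
    fix a c assume "a \<in> ?bp" and c: "c \<in> ?n \<inter> ?u"
    then obtain v w where vw: "a = v + w" "v \<in> ?b" "w \<in> ?p" by blast
    have "kil v c = 0" by (rule part_orth[OF vw(2), of c "{1..}"]) (use c in auto)
    moreover have "kil w c = 0" by (rule part_orth[OF vw(3), of c "{1..}"]) (use c in auto)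
    ultimately show "kil a c = 0" by (simp add: vw(1) kil_add_left)
  qed
  from 1 2 3 4 dim_part_nonneg[OF h] dim_part_nonneg[OF x] show ?thesis by linarith
qed

text \<open>An additive function, integral on the spectrum of \<open>br x\<close> and without new
  zeros there, replaces the weights by integers and keeps the zero weight space.\<close>

lemma integral_element:
  obtains z where "spec (br z) \<subseteq> \<int>" "genE (br z) 0 = genE (br x) 0"
proof -
  have fin: "finite (spec (br x))" by (rule finite_spec[OF lin_br])
  obtain f :: "'k \<Rightarrow> 'k" where f: "\<And>x y. f (x + y) = f x + f y"
    and fint: "\<And>s. s \<in> spec (br x) \<Longrightarrow> f s \<in> \<int>" and f0: "\<And>s. s \<in> spec (br x) \<Longrightarrow> f s = 0 \<Longrightarrow> s = 0"
    using additive_int_valued[OF fin] by blast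
  obtain z where z: "\<And>c v. v \<in> genE (br x) c \<Longrightarrow> br z v = f c *s v" using element_of_eigenvalue_map[of f x] f by metis
  have zE: "v \<in> genE (br z) (f c)" if "v \<in> genE (br x) c" for v c
    using z[OF that] by (rule eigenvector_genE)
  have nz: "c \<in> spec (br x)" if "v \<in> genE (br x) c" "v \<noteq> 0" for v c using that by (auto simp: spec_def)
  have f00: "f 0 = 0" using additive_zero[of f] f by blast
  have "c \<in> \<int>" if c: "c \<in> spec (br z)" for c
  proof (rule ccontr)
    assume "c \<notin> \<int>"
    have "gproj (br z) c = (\<lambda>_. 0)"
    proof (rule lin_eq_on_genE[OF lin_br[of x] lin_gproj[OF lin_br]])
      fix d v assume v: "v \<in> genE (br x) d"
      show "gproj (br z) c v = 0"
      proof (cases "v = 0")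
        case False
        then have "f d \<noteq> c" using fint nz[OF v] \<open>c \<notin> \<int>\<close> by blast
        then show ?thesis by (rule gproj_other[OF lin_br zE[OF v]])
      qed (simp add: lin_zero[OF lin_gproj[OF lin_br]])
    qed (simp add: lin_iff)
    then have "v = 0" if "v \<in> genE (br z) c" for v using gproj_same[OF lin_br that] by simp
    then show False using c subspace_0[OF subspace_genE[OF lin_br]] by (auto simp: spec_def)
  qed
  then have 1: "spec (br z) \<subseteq> \<int>" by blast
  have eq: "gproj (br z) 0 = gproj (br x) 0"
  proof (rule lin_eq_on_genE[OF lin_br[of x] lin_gproj[OF lin_br] lin_gproj[OF lin_br]])
    fix d v assume v: "v \<in> genE (br x) d"
    show "gproj (br z) 0 v = gproj (br x) 0 v"
    proof (cases "v = 0 \<or> d = 0")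
      case True
      then show ?thesis
        using v zE[OF v] f00 by (auto simp: lin_zero[OF lin_gproj[OF lin_br]] gproj_same[OF lin_br])
    next
      case False
      then have "f d \<noteq> 0" using f0 nz[OF v] by blast
      then show ?thesis using gproj_other[OF lin_br zE[OF v]] gproj_other[OF lin_br v] False by simp
    qed
  qed
  have "genE (br z) 0 = genE (br x) 0"
  proof (intro equalityI subsetI)
    fix v assume "v \<in> genE (br z) 0"
    then show "v \<in> genE (br x) 0" using gproj_same[OF lin_br, of v z 0] gproj_in[OF lin_br, of x 0 v] eq by simp
  next
    fix v assume "v \<in> genE (br x) 0"
    then show "v \<in> genE (br z) 0" using zE[of v 0] f00 by simp
  qed
  with 1 that show thesis by blast
qed

subsection \<open>Involutions of maximal rank\<close>

lemma subspace_eigen: assumes "invol \<sigma>" shows "subspace {v. \<sigma> v = v}" "subspace {v. \<sigma> v = - v}"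
  using invol_lin[OF assms] by (auto intro!: subspaceI simp: lin_zero lin_add lin_scale)

lemma dim_invol_stable:
  assumes s: "invol \<sigma>" and U: "subspace U" and st: "\<And>v. v \<in> U \<Longrightarrow> \<sigma> v \<in> U"
  shows "dim U = dim (U \<inter> {v. \<sigma> v = v}) + dim (U \<inter> {v. \<sigma> v = - v})"
proof -
  let ?P = "U \<inter> {v. \<sigma> v = v}" and ?M = "U \<inter> {v. \<sigma> v = - v}"
  have l: "lin \<sigma>" by (rule invol_lin[OF s])
  have sPM: "subspace ?P" "subspace ?M" by (intro subspace_inter U subspace_eigen[OF s])+
  have "?P \<inter> ?M \<subseteq> {0}" using fixed_inter_negated[of \<sigma>] by blast
  then have "dim {x + y | x y. x \<in> ?P \<and> y \<in> ?M} = dim ?P + dim ?M" by (rule dim_direct_sum[OF sPM])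
  moreover have "{x + y | x y. x \<in> ?P \<and> y \<in> ?M} = U"
  proof (intro equalityI subsetI)
    fix v assume "v \<in> {x + y | x y. x \<in> ?P \<and> y \<in> ?M}"
    then show "v \<in> U" using subspace_add[OF U] by blast
  next
    fix v assume v: "v \<in> U"
    define p where "p = (1/2::'k) *s (v + \<sigma> v)"
    define q where "q = (1/2::'k) *s (v - \<sigma> v)"
    have "p \<in> ?P" using v st[OF v]
      by (auto simp: p_def lin_scale[OF l] lin_add[OF l] invol_invol[OF s] add.commute intro!: subspace_scale subspace_add U)
    moreover have "q \<in> ?M" using v st[OF v]
      by (auto simp: q_def lin_scale[OF l] lin_diff[OF l] invol_invol[OF s] simp flip: scale_minus_right
          intro!: subspace_scale subspace_diff U)
    moreover have "p + q = v"
    proof -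
      have "p + q = (1/2::'k) *s v + (1/2::'k) *s v" by (simp add: p_def q_def scale_right_distrib scale_right_diff_distrib)
      also have "\<dots> = v" by (simp flip: scale_left_distrib)
      finally show ?thesis .
    qed
    ultimately show "v \<in> {x + y | x y. x \<in> ?P \<and> y \<in> ?M}" by blast
  qed
  ultimately show ?thesis by simp
qed

text \<open>\<open>\<sigma>\<close> exchanges the weights \<open>c\<close> and \<open>- c\<close>,
  and 0 is its own negative.\<close>

lemma gproj_zero_invol:
  assumes s: "invol \<sigma>" and x: "\<sigma> x = - x"
  shows "gproj (br x) 0 (\<sigma> v) = \<sigma> (gproj (br x) 0 v)"
proof -
  have "(\<lambda>v. gproj (br x) 0 (\<sigma> v)) = (\<lambda>v. \<sigma> (gproj (br x) 0 v))"
  proof (rule lin_eq_on_genE[OF lin_br[of x]])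
    fix c v assume v: "v \<in> genE (br x) c"
    then have sv: "\<sigma> v \<in> genE (br x) (- c)" by (rule invol_genE[OF s x])
    show "gproj (br x) 0 (\<sigma> v) = \<sigma> (gproj (br x) 0 v)"
    proof (cases "c = 0")
      case True
      then show ?thesis using v sv by (simp add: gproj_same[OF lin_br])
    next
      case False
      then show ?thesis
        using gproj_other[OF lin_br v, of 0] gproj_other[OF lin_br sv, of 0] by (simp add: lin_zero[OF invol_lin[OF s]])
    qed
  qed (rule lin_comp[OF lin_gproj[OF lin_br] invol_lin[OF s]] lin_comp[OF invol_lin[OF s] lin_gproj[OF lin_br]])+
  from fun_cong[OF this, of v] show ?thesis .
qed

text \<open>On the complement \<open>?R\<close> of the zero weight space \<open>br x\<close> is
  injective and exchanges the two eigenspaces of \<open>\<sigma>\<close>, so both have equal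
  dimension there. Any difference between them is carried by \<open>genE (br x) 0\<close>.\<close>

lemma dim_genE0_invol:
  assumes s: "invol \<sigma>" and x: "\<sigma> x = - x"
  shows "dim (genE (br x) 0 \<inter> {v. \<sigma> v = - v}) + dim {v. \<sigma> v = v}
       = dim (genE (br x) 0 \<inter> {v. \<sigma> v = v}) + dim {v. \<sigma> v = - v}"
proof -
  let ?G = "genE (br x) 0" and ?P = "{v. \<sigma> v = v}" and ?M = "{v. \<sigma> v = - v}"
  let ?R = "{v. gproj (br x) 0 v = 0}"
  have sG: "subspace ?G" by (rule subspace_genE[OF lin_br])
  have sR: "subspace ?R" by (rule vp.linear_subspace_kernel[OF lin_gproj[OF lin_br]])
  note sPM = subspace_eigen[OF s]
  have l: "lin \<sigma>" by (rule invol_lin[OF s])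
  have split: "dim E = dim (?G \<inter> E) + dim (?R \<inter> E)"
    if E: "subspace E" "\<And>v. v \<in> E \<Longrightarrow> gproj (br x) 0 v \<in> E" for E
  proof -
    have "(?G \<inter> E) \<inter> (?R \<inter> E) \<subseteq> {0}" using gproj_same[OF lin_br, of _ x 0] by auto
    then have "dim {a + b | a b. a \<in> ?G \<inter> E \<and> b \<in> ?R \<inter> E} = dim (?G \<inter> E) + dim (?R \<inter> E)"
      by (intro dim_direct_sum subspace_inter sG sR E(1))
    moreover have "{a + b | a b. a \<in> ?G \<inter> E \<and> b \<in> ?R \<inter> E} = E"
    proof (intro equalityI subsetI)
      fix v assume "v \<in> {a + b | a b. a \<in> ?G \<inter> E \<and> b \<in> ?R \<inter> E}"
      then show "v \<in> E" using subspace_add[OF E(1)] by blast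
    next
      fix v assume v: "v \<in> E"
      let ?a = "gproj (br x) 0 v"
      have "?a \<in> ?G \<inter> E" using gproj_in[OF lin_br] E(2)[OF v] by blast
      moreover have "v - ?a \<in> ?R \<inter> E"
        using subspace_diff[OF E(1) v E(2)[OF v]] gproj_same[OF lin_br gproj_in[OF lin_br]]
        by (simp add: lin_diff[OF lin_gproj[OF lin_br]])
      moreover have "v = ?a + (v - ?a)" by simp
      ultimately show "v \<in> {a + b | a b. a \<in> ?G \<inter> E \<and> b \<in> ?R \<inter> E}" by blast
    qed
    ultimately show ?thesis by simp
  qed
  have dP: "dim ?P = dim (?G \<inter> ?P) + dim (?R \<inter> ?P)"
  proof (rule split[OF sPM(1)])
    fix v assume "v \<in> ?P"
    then show "gproj (br x) 0 v \<in> ?P" using gproj_zero_invol[OF s x, of v] by simp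
  qed
  have dM: "dim ?M = dim (?G \<inter> ?M) + dim (?R \<inter> ?M)"
  proof (rule split[OF sPM(2)])
    fix v assume "v \<in> ?M"
    then show "gproj (br x) 0 v \<in> ?M"
      using gproj_zero_invol[OF s x, of v] lin_neg[OF lin_gproj[OF lin_br], of x 0 v] by simp
  qed
  have swap: "\<sigma> (br x v) = - br x (\<sigma> v)" for v by (simp add: invol_br[OF s] x br_neg_left)
  have inj: "inj_on (br x) ?R"
  proof (rule inj_onI)
    fix a b assume ab: "a \<in> ?R" "b \<in> ?R" "br x a = br x b"
    then have "br x (a - b) = 0" by (simp add: br_diff_right)
    then have "a - b \<in> ?G" by (intro eigenvector_genE) simp
    moreover have "a - b \<in> ?R" by (rule subspace_diff[OF sR ab(1,2)])
    ultimately have "a - b = 0" using gproj_same[OF lin_br, of "a - b" x 0] by simp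
    then show "a = b" by simp
  qed
  have le: "dim (?R \<inter> E) \<le> dim (?R \<inter> F)" if E: "subspace E" and EF: "\<And>v. v \<in> E \<Longrightarrow> br x v \<in> F" for E F
  proof -
    have "dim (?R \<inter> E) = dim (br x ` (?R \<inter> E))"
    proof (rule vp.dim_image_eq[OF lin_br, symmetric])
      have "span (?R \<inter> E) = ?R \<inter> E" using subspace_inter[OF sR E] by simp
      then show "inj_on (br x) (span (?R \<inter> E))" using inj_on_subset[OF inj] by (metis inf_le1)
    qed
    also have "\<dots> \<le> dim (?R \<inter> F)"
      using EF gproj_commute[OF lin_br lin_br, of x x 0] by (intro dim_subset) (auto simp: br_zero)
    finally show ?thesis .
  qed
  have "dim (?R \<inter> ?P) \<le> dim (?R \<inter> ?M)" by (rule le[OF sPM(1)]) (simp add: swap)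
  moreover have "dim (?R \<inter> ?M) \<le> dim (?R \<inter> ?P)" by (rule le[OF sPM(2)]) (simp add: swap br_neg_right)
  ultimately show ?thesis using dP dM by linarith
qed

text \<open>\<open>H\<close> is abelian, because \<open>\<sigma>\<close> both fixes and negates a
  bracket of its elements. All of \<open>H\<close> acts locally nilpotently on the zero weight space
  of a generic \<open>h\<close>; if this exceeded \<open>H\<close>, a vector outside
  \<open>H\<close> would normalise \<open>H\<close>.\<close>

lemma cartan_subalgebra_genE0:
  assumes s: "invol \<sigma>" and H: "cartan_subalgebra scale br H" "H \<subseteq> {x. \<sigma> x = - x}"
  shows "\<exists>h\<in>H. genE (br h) 0 = H"
proof -
  have sH: "subspace H" and Hbr: "\<And>x y. x \<in> H \<Longrightarrow> y \<in> H \<Longrightarrow> br x y \<in> H"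
    and norm: "{x. \<forall>y\<in>H. br x y \<in> H} = H"
    using H(1) by (auto simp: cartan_subalgebra_def subalgebra_def)
  have ab: "br x y = 0" if "x \<in> H" "y \<in> H" for x y
  proof (rule neg_self_zero)
    have "\<sigma> (br x y) = - br x y" using Hbr[OF that] H(2) by blast
    moreover have "\<sigma> x = - x" "\<sigma> y = - y" using H(2) that by blast+
    then have "\<sigma> (br x y) = br (- x) (- y)" using invol_br[OF s, of x y] by simp
    ultimately show "br x y = - br x y" by (simp add: br_neg_left br_neg_right)
  qed
  obtain h where h: "h \<in> H" "\<And>y. y \<in> H \<Longrightarrow> genE (br h) 0 \<subseteq> genE (br y) 0"
    using generic_element[OF sH ab] by blast
  let ?W = "genE (br h) 0"
  have HW: "H \<subseteq> ?W" using ab[OF h(1)] by (auto intro: eigenvector_genE)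
  \<comment> \<open>For a new \<open>b\<close>, take the last iterate of \<open>br b\<close> on
    \<open>v\<close> before \<open>H\<close> is reached. Since \<open>H\<close> is abelian, the
    condition for the earlier elements of \<open>F\<close> survives.\<close>
  have step: "\<exists>v\<in>?W - H. \<forall>b\<in>F. br b v \<in> H" if "finite F" "F \<subseteq> H" "v0 \<in> ?W - H" for F v0
    using that
  proof (induction F)
    case (insert b F)
    then obtain v where v: "v \<in> ?W" "v \<notin> H" "\<And>b'. b' \<in> F \<Longrightarrow> br b' v \<in> H" by blast
    have b: "b \<in> H" using insert.prems by blast
    have "v \<in> genE (br b) 0" using h(2)[OF b] v(1) by blast
    then obtain k where "(br b ^^ k) v = 0" by (auto simp: genE_def)
    then have "(br b ^^ k) v \<in> H" using subspace_0[OF sH] by simp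
    then obtain j where j: "(br b ^^ j) v \<in> H" "\<And>i. i < j \<Longrightarrow> (br b ^^ i) v \<notin> H"
      using exists_least_iff[of "\<lambda>k. (br b ^^ k) v \<in> H"] by blast
    obtain i where i: "j = Suc i" using j(1) v(2) by (cases j) auto
    let ?w = "(br b ^^ i) v"
    have "(br b ^^ n) v \<in> ?W" for n
    proof (induction n)
      case (Suc n)
      then have "br b ((br b ^^ n) v) \<in> ?W"
        using genE_commute[OF lin_br, of "br h" b] br_commute[OF ab[OF h(1) b]] by blast
      then show ?case by simp
    qed (simp add: v(1))
    moreover have "?w \<notin> H" using j(2) i by simp
    moreover have "br b ?w \<in> H" using j(1) i by simp
    moreover have "br b' ?w \<in> H" if b': "b' \<in> F" for b'
    proof -
      have "b' \<in> H" using b' insert.prems by blast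
      then have comm: "br b' (br b u) = br b (br b' u)" for u using br_commute[OF ab] b by blast
      have "br b' ((br b ^^ i) v) = (br b ^^ i) (br b' v)" for i by (induction i) (simp_all add: comm)
      moreover have "(br b ^^ i) u \<in> H" if "u \<in> H" for u i using that by (induction i) (simp_all add: Hbr b)
      ultimately show ?thesis using v(3)[OF b'] by simp
    qed
    ultimately show ?case by blast
  qed blast
  have "?W \<subseteq> H"
  proof (rule ccontr)
    assume "\<not> ?W \<subseteq> H"
    then obtain v0 where v0: "v0 \<in> ?W - H" by blast
    obtain B where B: "B \<subseteq> H" "independent B" "H \<subseteq> span B" using basis_exists by metis
    obtain v where v: "v \<in> ?W - H" "\<And>b. b \<in> B \<Longrightarrow> br b v \<in> H"
      using step[OF finiteI_independent[OF B(2)] B(1) v0] by blast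
    have "subspace {y. br y v \<in> H}"
      using vp.linear_subspace_vimage[OF lin_br_left sH] by (simp add: vimage_def)
    then have "span B \<subseteq> {y. br y v \<in> H}" using v(2) by (intro span_minimal) auto
    then have "br y v \<in> H" if "y \<in> H" for y using that B(3) by blast
    then have "br v y \<in> H" if "y \<in> H" for y
      using that subspace_neg[OF sH, of "br y v"] br_anti[of v y] by simp
    then have "v \<in> H" using norm by blast
    then show False using v(1) by blast
  qed
  then show ?thesis using HW h(1) by blast
qed

lemma kil_eigen_orth:
  assumes s: "invol \<sigma>" and "\<sigma> v = v" "\<sigma> w = - w" shows "kil v w = 0"
proof -
  have "kil v w = - kil v w" using kil_invol[OF s, of v w] assms(2,3) by (simp add: kil_neg)
  then show ?thesis by (metis add.inverse_unique mult_2 mult_eq_0_iff neg_eq_iff_add_eq_0 zero_neq_numeral)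
qed

text \<open>Here \<open>l\<close> is the centralizer of \<open>T\<close>, and its
  \<open>\<sigma>\<close>-fixed part \<open>l0\<close> is the space to be shown zero. The count
  relative to \<open>H\<close> forces \<open>l0\<close> to consist of nilpotent elements.\<close>

lemma maximal_rank_centralizer:
  assumes s: "invol \<sigma>" and H: "cartan_subalgebra scale br H" "H \<subseteq> {x. \<sigma> x = - x}"
    and T: "cartan_subspace scale br {x. \<sigma> x = - x} T"
  shows "centralizer T \<subseteq> T"
proof -
  let ?P = "{v. \<sigma> v = v}" and ?M = "{v. \<sigma> v = - v}"
  have Tss: "commuting_ss_subspace scale br ?M T" using T by (simp add: cartan_subspace_def)
  then have sT: "subspace T" and TM: "T \<subseteq> ?M" and Tab: "\<And>x y. x \<in> T \<Longrightarrow> y \<in> T \<Longrightarrow> br x y = 0"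
    by (auto simp: commuting_ss_subspace_def)
  define l where "l = centralizer T"
  define l0 where "l0 = l \<inter> ?P"
  have lM: "l \<inter> ?M = T"
  proof
    show "T \<subseteq> l \<inter> ?M" using TM Tab by (auto simp: l_def centralizer_def)
    show "l \<inter> ?M \<subseteq> T"
      using cartan_subspace_self_centralizing[OF s s, of T] T by (auto simp: l_def)
  qed
  obtain h where h: "h \<in> H" "genE (br h) 0 = H" using cartan_subalgebra_genE0[OF s H] by blast
  obtain x where x: "x \<in> T" "genE (br x) 0 = l" using generic_centralizer[OF Tss] by (auto simp: l_def)
  have xh: "\<sigma> x = - x" "\<sigma> h = - h" using x(1) TM h(1) H(2) by blast+
  have sl: "subspace l" unfolding l_def by (rule subspace_centralizer)
  have sl0: "subspace l0" unfolding l0_def by (intro subspace_inter sl subspace_eigen s)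
  have lst: "\<sigma> v \<in> l" if "v \<in> l" for v
    using invol_genE[OF s xh(1), of v 0] that x(2) by simp
  have "H \<inter> ?P \<subseteq> {0}" using H(2) fixed_inter_negated[of \<sigma>] by blast
  then have "dim (H \<inter> ?P) = 0" by simp
  moreover have "H \<inter> ?M = H" using H(2) by blast
  \<comment> \<open>The difference of the dimensions of \<open>?M\<close> and \<open>?P\<close> is
    computed twice: as \<open>dim H\<close> from \<open>h\<close>, and as
    \<open>dim T - dim l0\<close> from \<open>x\<close>. Together they give
    \<open>dl'\<close>.\<close>
  ultimately have "dim H + dim ?P = dim ?M" using dim_genE0_invol[OF s xh(2)] h(2) by simp
  moreover have "dim T + dim ?P = dim l0 + dim ?M"
    using dim_genE0_invol[OF s xh(1)] x(2) lM by (simp add: l0_def)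
  moreover have dl: "dim l = dim l0 + dim T" using dim_invol_stable[OF s sl lst] lM by (simp add: l0_def)
  ultimately have dl': "dim l = dim H + 2 * dim l0" by linarith
  obtain h' where h': "spec (br h') \<subseteq> \<int>" "genE (br h') 0 = H" using integral_element[of h] h(2) by metis
  obtain x' where x': "spec (br x') \<subseteq> \<int>" "genE (br x') 0 = l" using integral_element[of x] x(2) by metis
  define N where "N = gproj (br x') 0 ` (part h' {1..} \<inter> part x' {0..})"
  have "dim l \<le> dim H + 2 * dim N" using dim_centralizer_bound[OF h'(1) x'(1)] h'(2) x'(2) by (simp add: N_def)
  then have dN: "dim l0 \<le> dim N" using dl' by linarith
  have sN: "subspace N" unfolding N_def
    by (intro vp.linear_subspace_image lin_gproj lin_br subspace_inter subspace_part)
  have Nl: "N \<subseteq> l" using gproj_in[OF lin_br, of x' 0] x'(2) by (auto simp: N_def)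
  have Nnil: "nilp (br y)" if "y \<in> N" for y
    using that nilp_degree_zero_component[OF x'(1)] nilp_part_positive[OF h'(1)] by (auto simp: N_def)
  have nondeg: "u = 0" if "u \<in> l" "\<And>w. w \<in> l \<Longrightarrow> kil u w = 0" for u
    using kil_nondegenerate_genE0[of u x] that x(2) by simp
  have split: "\<exists>c\<in>T. \<exists>w\<in>l0. y = w + c" if y: "y \<in> l" for y
  proof -
    have l\<sigma>: "lin \<sigma>" by (rule invol_lin[OF s])
    let ?w = "(1/2) *s (y + \<sigma> y)" and ?c = "(1/2) *s (y - \<sigma> y)"
    have "?w \<in> l0" unfolding l0_def using y lst[OF y]
      by (auto simp: lin_scale[OF l\<sigma>] lin_add[OF l\<sigma>] invol_invol[OF s] add.commute intro!: subspace_scale subspace_add sl)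
    moreover have "?c \<in> l \<inter> ?M" using y lst[OF y]
      by (auto simp: lin_scale[OF l\<sigma>] lin_diff[OF l\<sigma>] invol_invol[OF s] simp flip: scale_minus_right
          intro!: subspace_scale subspace_diff sl)
    moreover have "y = ?w + ?c"
    proof -
      have "?w + ?c = (1/2) *s y + (1/2) *s y" by (simp add: scale_right_distrib scale_right_diff_distrib)
      also have "\<dots> = y" by (simp flip: scale_left_distrib)
      finally show ?thesis by simp
    qed
    ultimately show ?thesis using lM by blast
  qed
  have orth: "kil w c = 0" if "w \<in> l0" "c \<in> T" for w c
    using kil_eigen_orth[OF s] that TM by (auto simp: l0_def)
  \<comment> \<open>An element of \<open>N\<close> is nilpotent and commutes with \<open>T\<close>,
    hence is orthogonal to \<open>T\<close>. Its \<open>T\<close>-component is then orthogonal to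
    \<open>T\<close> and to \<open>l0\<close>, so to all of \<open>l\<close>.\<close>
  have "N \<subseteq> l0"
  proof
    fix y assume y: "y \<in> N"
    obtain c w where cw: "c \<in> T" "w \<in> l0" "y = w + c" using split Nl y by blast
    have "c = 0"
    proof (rule nondeg)
      show "c \<in> l" using cw(1) lM by blast
      fix u assume "u \<in> l"
      then obtain c' w' where cw': "c' \<in> T" "w' \<in> l0" "u = w' + c'" using split by blast
      have "br y c' = 0" using Nl y cw'(1) by (auto simp: l_def centralizer_def)
      then have "kil y c' = 0" by (rule kil_nilp_commuting[OF Nnil[OF y]])
      then have "kil c c' = 0" using orth[OF cw(2) cw'(1)] by (simp add: cw(3) kil_add_left)
      moreover have "kil c w' = 0" using orth[OF cw'(2) cw(1)] kil_sym by simp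
      ultimately show "kil c u = 0" by (simp add: cw'(3) kil_add_right)
    qed
    then show "y \<in> l0" using cw by simp
  qed
  then have "N = l0" using subspace_dim_equal[OF sN sl0] dN by blast
  \<comment> \<open>All of \<open>l0 = N\<close> is nilpotent, so the quadratic form of
    \<open>kil\<close> vanishes there; by polarisation so does the bilinear form, and
    \<open>nondeg\<close> leaves only zero.\<close>
  then have nil0: "kil w w = 0" if "w \<in> l0" for w
    using kil_nilp_commuting[OF Nnil br_self] that by blast
  have "w = 0" if w: "w \<in> l0" for w
  proof (rule nondeg)
    show "w \<in> l" using w by (simp add: l0_def)
    fix u assume "u \<in> l"
    then obtain c' w' where cw': "c' \<in> T" "w' \<in> l0" "u = w' + c'" using split by blast
    have "kil (w + w') (w + w') = 0" using nil0 subspace_add[OF sl0 w cw'(2)] by blast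
    then have "kil w w' = 0"
      using nil0[OF w] nil0[OF cw'(2)] by (simp add: kil_add_left kil_add_right kil_sym[of w' w])
    then show "kil w u = 0" using orth[OF w cw'(1)] by (simp add: cw'(3) kil_add_right)
  qed
  then have "l \<subseteq> T" using split by fastforce
  then show ?thesis by (simp add: l_def)
qed

section \<open>Cartan subspaces of the common eigenspace remain maximal in the larger
  eigenspace\<close>

text \<open>An element \<open>y = a + b\<close> of a larger candidate centralizes \<open>C\<close>,
  and so does \<open>y + \<sigma> y\<close>, which is \<open>a + a\<close>. By \<open>zero\<close>
  this vanishes, and then \<open>y = b\<close> lies in the self-centralizing
  \<open>C\<close>.\<close>

lemma cartan_subspace_extends:
  assumes s: "invol \<sigma>" and t: "invol \<tau>" and st: "\<And>x. \<sigma> (\<tau> x) = \<tau> (\<sigma> x)"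
    and H: "cartan_subalgebra scale br H" "H \<subseteq> {x. \<sigma> x = - x}"
    and C: "cartan_subspace scale br {x. \<sigma> x = - x \<and> \<tau> x = - x} C"
  shows "cartan_subspace scale br
    {a + b | a b. a \<in> {x. \<sigma> x = x \<and> \<tau> x = - x} \<and> b \<in> {x. \<sigma> x = - x \<and> \<tau> x = - x}} C"
proof -
  let ?M = "{v. \<sigma> v = - v}" and ?V = "{x. \<sigma> x = - x \<and> \<tau> x = - x}"
  let ?U = "{a + b | a b. a \<in> {x. \<sigma> x = x \<and> \<tau> x = - x} \<and> b \<in> ?V}"
  note ls = invol_lin[OF s] and lt = invol_lin[OF t]
  have Css: "commuting_ss_subspace scale br ?V C" using C by (simp add: cartan_subspace_def)
  then have sC: "subspace C" and CV: "C \<subseteq> ?V"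
    by (auto simp: commuting_ss_subspace_def)
  have self: "y \<in> C" if "y \<in> ?V" "y \<in> centralizer C" for y
    using cartan_subspace_self_centralizing[OF s t st C] that by blast
  have stable: "\<rho> y \<in> centralizer C" if \<rho>: "invol \<rho>" "\<And>c. c \<in> C \<Longrightarrow> \<rho> c = - c" and y: "y \<in> centralizer C" for \<rho> y
  proof -
    have "br (\<rho> y) c = 0" if c: "c \<in> C" for c
    proof -
      have "br (\<rho> y) c = \<rho> (br y (\<rho> c))" by (simp add: invol_br[OF \<rho>(1)] invol_invol[OF \<rho>(1)])
      then show ?thesis
        using y c \<rho>(2)[OF c] by (simp add: centralizer_def br_neg_right lin_zero[OF invol_lin[OF \<rho>(1)]])
    qed
    then show ?thesis by (simp add: centralizer_def)
  qed
  have "commuting_ss_subspace scale br ?M C \<and> C \<subseteq> C" using Css by (auto simp: commuting_ss_subspace_def)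
  \<comment> \<open>Maximal dimension among the candidates containing \<open>C\<close> implies
    maximality under inclusion, so \<open>T\<close> is a Cartan subspace of
    \<open>?M\<close>.\<close>
  from ex_max_dim[of "\<lambda>T. commuting_ss_subspace scale br ?M T \<and> C \<subseteq> T", OF this]
  obtain T where T: "commuting_ss_subspace scale br ?M T" "C \<subseteq> T"
    and max: "\<And>T'. commuting_ss_subspace scale br ?M T' \<Longrightarrow> C \<subseteq> T' \<Longrightarrow> dim T' \<le> dim T" by blast
  have sT: "subspace T" and TM: "T \<subseteq> ?M" and Tab: "\<And>x y. x \<in> T \<Longrightarrow> y \<in> T \<Longrightarrow> br x y = 0"
    and Tsem: "\<And>x. x \<in> T \<Longrightarrow> semisimple_elt scale br x"
    using T(1) by (auto simp: commuting_ss_subspace_def)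
  have "T' = T" if T': "commuting_ss_subspace scale br ?M T'" "T \<subseteq> T'" for T'
    using subspace_dim_equal[of T T'] sT T' max[OF T'(1)] T(2) by (auto simp: commuting_ss_subspace_def)
  then have "cartan_subspace scale br ?M T" using T(1) by (auto simp: cartan_subspace_def)
  then have ZT: "centralizer T \<subseteq> T" by (rule maximal_rank_centralizer[OF s H])
  \<comment> \<open>Split \<open>2 t0 = p + q\<close> by the sign under \<open>\<tau>\<close>. The
    part \<open>q\<close> lies in \<open>C\<close> and commutes with \<open>x\<close>;
    \<open>br x p\<close> has both signs negative and centralizes \<open>C\<close>, so lies in
    \<open>C\<close>. Hence \<open>(ad t0)^2 x = 0\<close>, and semisimplicity of \<open>t0\<close>
    removes the square. Thus \<open>x\<close> centralizes \<open>T\<close>.\<close>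
  have zero: "x = 0" if x: "x \<in> centralizer C" "\<sigma> x = x" "\<tau> x = - x" for x
  proof -
    have "br x t0 = 0" if t0: "t0 \<in> T" for t0
    proof -
      have t0C: "t0 \<in> centralizer C" using t0 T(2) Tab by (auto simp: centralizer_def)
      have st0: "\<sigma> t0 = - t0" using t0 TM by blast
      have tt0: "\<tau> t0 \<in> centralizer C" using CV by (intro stable[OF t _ t0C]) auto
      define p where "p = t0 + \<tau> t0"
      define q where "q = t0 - \<tau> t0"
      have pC: "p \<in> centralizer C" unfolding p_def by (rule subspace_add[OF subspace_centralizer t0C tt0])
      have "q \<in> C"
      proof (rule self)
        show "q \<in> centralizer C" unfolding q_def by (rule subspace_diff[OF subspace_centralizer t0C tt0])
        show "q \<in> ?V"
          by (simp add: q_def lin_diff[OF ls] lin_diff[OF lt] st st0 invol_invol[OF t] lin_neg[OF lt])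
      qed
      then have xq: "br x q = 0" using x(1) by (simp add: centralizer_def)
      have "\<sigma> p = - p" "\<tau> p = p"
        by (simp_all add: p_def lin_add[OF ls] lin_add[OF lt] st st0 invol_invol[OF t] lin_neg[OF lt] add.commute)
      then have "br x p \<in> ?V" using x(2,3) by (simp add: invol_br[OF s] invol_br[OF t] br_neg_left br_neg_right)
      moreover have "br x p \<in> centralizer C"
        using x(1) pC by (simp add: centralizer_def jacobi br_zero)
      ultimately have xp: "br x p \<in> C" by (rule self)
      have "p + q = 2 *s t0" by (simp add: p_def q_def flip: scale_left_distrib)
        (metis one_add_one scale_left_distrib scale_one)
      then have "2 *s br x t0 = br x p" using xq br_add_right[of x p q] by (simp add: br_scale_right)
      then have "br x t0 = (1/2) *s br x p" by (metis (no_types) nonzero_divide_eq_eq scale_one scale_scale times_divide_eq_left mult.commute zero_neq_numeral)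
      then have "br x t0 \<in> C" using subspace_scale[OF sC xp] by simp
      then have "br t0 (br x t0) = 0" using t0 T(2) Tab by blast
      then have "br t0 (br t0 x) = 0" using br_anti[of x t0] by (simp add: br_neg_right)
      then have "br t0 x - 0 *s x \<in> genE (br t0) 0" by (intro eigenvector_genE) simp
      then have "x \<in> genE (br t0) 0" by (rule genE_shiftI)
      then have "br t0 x = 0" using semisimple_genE[OF Tsem[OF t0], of x 0] by simp
      then show ?thesis using br_zero_sym by blast
    qed
    then have "x \<in> T" using ZT by (auto simp: centralizer_def)
    then have "\<sigma> x = - x" using TM by blast
    then have "x = - x" using x(2) by (rule back_subst[of "\<lambda>y. y = - x"])
    then show ?thesis by (rule neg_self_zero)
  qed
  have "0 \<in> {x. \<sigma> x = x \<and> \<tau> x = - x}" by (simp add: lin_zero[OF ls] lin_zero[OF lt])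
  then have "?V \<subseteq> ?U" by force
  then have "commuting_ss_subspace scale br ?U C" using Css unfolding commuting_ss_subspace_def by blast
  moreover have "C' = C" if C': "commuting_ss_subspace scale br ?U C'" "C \<subseteq> C'" for C'
  proof
    have C'U: "C' \<subseteq> ?U" and C'ab: "\<And>x y. x \<in> C' \<Longrightarrow> y \<in> C' \<Longrightarrow> br x y = 0"
      using C'(1) unfolding commuting_ss_subspace_def by blast+
    show "C' \<subseteq> C"
    proof
      fix y assume y: "y \<in> C'"
      then obtain a b where ab: "y = a + b" "\<sigma> a = a" "\<tau> a = - a" "\<sigma> b = - b" "\<tau> b = - b" using C'U by blast
      have yC: "y \<in> centralizer C" using y C'ab C'(2) by (auto simp: centralizer_def)
      have syC: "\<sigma> y \<in> centralizer C" using CV by (intro stable[OF s _ yC]) auto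
      have "y + \<sigma> y \<in> centralizer C" by (rule subspace_add[OF subspace_centralizer yC syC])
      moreover have "y + \<sigma> y = a + a" by (simp add: ab lin_add[OF ls])
      ultimately have "a + a = 0" using zero[of "a + a"] ab by (simp add: lin_add[OF ls] lin_add[OF lt])
      then have "a = 0" using neg_self_zero[of a] by (simp add: eq_neg_iff_add_eq_0)
      then have "y = b" using ab(1) by simp
      then show "y \<in> C" using self[of y] yC ab by simp
    qed
  qed (rule C'(2))
  ultimately show ?thesis unfolding cartan_subspace_def by blast
qed

end

section \<open>Both claims, from the pairs \<open>\<sigma>1, \<sigma>2\<close> and
  \<open>\<sigma>1, \<sigma>3\<close> of commuting involutions\<close>

theorem theorem3p3:
  fixes sc :: "'k::field_char_0 \<Rightarrow> 'v::ab_group_add \<Rightarrow> 'v"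
    and br :: "'v \<Rightarrow> 'v \<Rightarrow> 'v"
    and \<sigma>1 \<sigma>2 \<sigma>3 :: "'v \<Rightarrow> 'v"
  assumes "alg_closed TYPE('k)"
    and "semisimple_lie sc br"
    and "lie_involution sc br \<sigma>1" and "lie_involution sc br \<sigma>2" and "lie_involution sc br \<sigma>3"
    and "\<sigma>1 \<circ> \<sigma>2 = \<sigma>2 \<circ> \<sigma>1" and "\<sigma>1 \<noteq> \<sigma>2" and "\<sigma>3 = \<sigma>1 \<circ> \<sigma>2"
    and "maximal_rank sc br \<sigma>1"
  shows "(\<forall>C. cartan_subspace sc br {x. \<sigma>1 x = - x \<and> \<sigma>2 x = - x} C \<longrightarrow>
            cartan_subspace sc br
              {a + b | a b. a \<in> {x. \<sigma>1 x = x \<and> \<sigma>2 x = - x} \<and> b \<in> {x. \<sigma>1 x = - x \<and> \<sigma>2 x = - x}} C)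
       \<and> (\<forall>C. cartan_subspace sc br {x. \<sigma>1 x = - x \<and> \<sigma>2 x = x} C \<longrightarrow>
            cartan_subspace sc br
              {a + b | a b. a \<in> {x. \<sigma>1 x = - x \<and> \<sigma>2 x = x} \<and> b \<in> {x. \<sigma>1 x = x \<and> \<sigma>2 x = - x}} C)"
proof -
  have "lie_algebra sc br" "fin_dim sc" using assms(2) by (auto simp: semisimple_lie_def)
  then interpret vs: vector_space sc by (simp add: lie_algebra_def)
  obtain B0 where B0: "finite B0" "vs.span B0 = UNIV" using \<open>fin_dim sc\<close> by (auto simp: fin_dim_def)
  \<comment> \<open>The finite spanning set is thinned out to a basis, the parameter that the locale
    requires.\<close>
  obtain B where B: "B \<subseteq> B0" "vs.independent B" "B0 \<subseteq> vs.span B"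
    using vs.maximal_independent_subset[of B0] by blast
  have "vs.span B = UNIV" using vs.span_mono[OF B(3)] B0(2) by (auto simp: vs.span_span)
  then interpret semisimple_lie_algebra sc B br
    using B B0 assms(1,2) by unfold_locales (auto intro: finite_subset)
  have inv: "invol \<sigma>1" "invol \<sigma>2" "invol \<sigma>3"
    using assms(3-5) by (auto simp: lie_involution_def invol_def fun_eq_iff)
  have c12: "\<sigma>1 (\<sigma>2 x) = \<sigma>2 (\<sigma>1 x)" for x using assms(6) by (metis comp_apply)
  have s3: "\<sigma>3 x = \<sigma>1 (\<sigma>2 x)" for x using assms(8) by simp
  have c13: "\<sigma>1 (\<sigma>3 x) = \<sigma>3 (\<sigma>1 x)" for x by (simp add: s3 c12)
  obtain H where H: "cartan_subalgebra sc br H" "H \<subseteq> {x. \<sigma>1 x = - x}"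
    using assms(9) by (auto simp: maximal_rank_def)
  \<comment> \<open>Once the sign of \<open>\<sigma>1\<close> is known, those of
    \<open>\<sigma>2\<close> and \<open>\<sigma>3\<close> determine each other. So for the pair
    \<open>\<sigma>1, \<sigma>3\<close> the space with both signs negative is the one with indices
    1, 0.\<close>
  have eq1: "{x. \<sigma>1 x = - x \<and> \<sigma>2 x = x} = {x. \<sigma>1 x = - x \<and> \<sigma>3 x = - x}"
    using s3 c12 lin_neg[OF invol_lin[OF inv(2)]] by auto
  have eq2: "{x. \<sigma>1 x = x \<and> \<sigma>2 x = - x} = {x. \<sigma>1 x = x \<and> \<sigma>3 x = - x}"
    using s3 c12 by auto
  \<comment> \<open>The second claim lists the two summands in the opposite order to
    \<open>cartan_subspace_extends\<close>.\<close>
  have swap: "{a + b | a b. a \<in> P \<and> b \<in> Q} = {a + b | a b. a \<in> Q \<and> b \<in> P}" for P Q :: "'v set"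
    using add.commute by blast
  show ?thesis
  proof (intro conjI allI impI)
    fix C assume "cartan_subspace sc br {x. \<sigma>1 x = - x \<and> \<sigma>2 x = x} C"
    then show "cartan_subspace sc br
        {a + b | a b. a \<in> {x. \<sigma>1 x = - x \<and> \<sigma>2 x = x} \<and> b \<in> {x. \<sigma>1 x = x \<and> \<sigma>2 x = - x}} C"
      unfolding eq1 eq2 swap[of "{x. \<sigma>1 x = - x \<and> \<sigma>3 x = - x}"]
      by (rule cartan_subspace_extends[OF inv(1,3) c13 H])
  qed (rule cartan_subspace_extends[OF inv(1,2) c12 H])
qed

end
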